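(* For every $\Psi \in E$, the limit $$\mathcal{E}(\Psi) := \lim_{r \to +\infty} \int_{B_r} \big( e_{GL}(\Psi) - e_{GL}(V_1) \big)$$ exists (as a finite real number), so that the renormalized Ginzburg-Landau energy $\mathcal{E}$ is well-defined on $E$. Moreover, $\mathcal{E}$ is invariant by translations and constant phase shifts: for every $\Psi \in E$, $a \in \mathbb{R}^2$ and $\varphi \in \mathbb{R}$, $\mathcal{E}(e^{i\varphi}\Psi(\cdot + a)) = \mathcal{E}(\Psi)$.
   Context: $B_r$ is the open ball of $\mathbb{R}^2$ with center $0$ and radius $r$. Let $\rho_1 : [0,\infty) \to \mathbb{R}$ be the unique solution of $\rho_1'' + \rho_1'/r - \rho_1/r^2 + \rho_1(1-\rho_1^2) = 0$ with $\rho_1(0)=0$ and $\rho_1(r)\to 1$ as $r\to+\infty$ (it is smooth and increasing, $0 \le \rho_1 < 1$). The degree-one Ginzburg-Landau vortex is $V_1(x) = \rho_1(r)e^{i\theta}$ for $x=(r\cos\theta, r\sin\theta)\in\mathbb{R}^2$; it solves $\Delta V_1 + (1-|V_1|^2)V_1=0$ on $\mathbb{R}^2$. The Ginzburg-Landau energy density is $e_{GL}(\Psi) := \frac12 |\nabla \Psi|^2 + \frac14 (1-|\Psi|^2)^2$. The space $H$ is the set of $\Psi \in L^2_{loc}(\mathbb{R}^2,\mathbb{C})$ such that $\|\Psi\|_H < \infty$, where $\|\Psi\|_H^2 := \int_{\mathbb{R}^2} \big( |\nabla(\Psi \bar V_1)|^2 + (1-|V_1|^2)|\nabla \Psi|^2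 \big)$ (distributional derivatives). The energy space is $E := \{\Psi \in H : 1-|\Psi|^2 \in L^2(\mathbb{R}^2)\}$. The spaces $H$ and $E$ are invariant by translations and by constant phase shifts. *)

theory Defs
  imports "HOL-Analysis.Analysis"
begin

section \<open>Distributional gradients\<close>

definition partial_deriv :: "'n \<Rightarrow> (real^'n \<Rightarrow> real) \<Rightarrow> real^'n \<Rightarrow> real" where
  "partial_deriv i f x = frechet_derivative f (at x) (axis i 1)"

primrec times_cont_diff :: "nat \<Rightarrow> (real^'n \<Rightarrow> real) \<Rightarrow> bool" where
  "times_cont_diff 0 f \<longleftrightarrow> continuous_on UNIV f"
| "times_cont_diff (Suc k) f \<longleftrightarrow>
     (\<forall>x. f differentiable (at x)) \<and> (\<forall>i. times_cont_diff k (partial_deriv i f))"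

definition test_function :: "(real^'n \<Rightarrow> real) \<Rightarrow> bool" where
  "test_function \<phi> \<longleftrightarrow> (\<forall>k. times_cont_diff k \<phi>) \<and> compact (closure {x. \<phi> x \<noteq> 0})"

definition L1_loc :: "(real^'n \<Rightarrow> 'b::euclidean_space) set" where
  "L1_loc = {f. \<forall>K. compact K \<longrightarrow> f absolutely_integrable_on K}"

definition L2_loc :: "(real^'n \<Rightarrow> complex) set" where
  "L2_loc = {f \<in> borel_measurable lebesgue.
     \<forall>K. compact K \<longrightarrow> (\<lambda>x. (cmod (f x))\<^sup>2) absolutely_integrable_on K}"

definition has_weak_gradient :: "(real^'n \<Rightarrow> complex) \<Rightarrow> (real^'n \<Rightarrow> complex^'n) \<Rightarrow> bool" where
  "has_weak_gradient f G \<longleftrightarrow> f \<in> L1_loc \<and> G \<in> L1_loc \<and>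
     (\<forall>\<phi> i. test_function \<phi> \<longrightarrow>
        (LINT x|lebesgue. f x * of_real (partial_deriv i \<phi> x)) =
        - (LINT x|lebesgue. G x $ i * of_real (\<phi> x)))"

definition weakly_differentiable :: "(real^'n \<Rightarrow> complex) \<Rightarrow> bool" where
  "weakly_differentiable f \<longleftrightarrow> (\<exists>G. has_weak_gradient f G)"

text \<open>A weak gradient is determined only up to a null set. The choice of representative
  is immaterial because it is only ever used under integrals.\<close>

definition weak_gradient :: "(real^'n \<Rightarrow> complex) \<Rightarrow> real^'n \<Rightarrow> complex^'n" where
  "weak_gradient f = (SOME G. has_weak_gradient f G)"


section \<open>The vortex of degree one\<close>

text \<open>The profile is the unique function on \<open>[0, \<infinity>)\<close> with the following property; its
  values at negative arguments are irrelevant.\<close>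

definition vortex_profile :: "(real \<Rightarrow> real) \<Rightarrow> bool" where
  "vortex_profile \<rho> \<longleftrightarrow>
     continuous_on {0..} \<rho> \<and> \<rho> 0 = 0 \<and> (\<rho> \<longlongrightarrow> 1) at_top \<and>
     (\<exists>\<rho>' \<rho>''. \<forall>r>0.
        (\<rho> has_real_derivative \<rho>' r) (at r) \<and>
        (\<rho>' has_real_derivative \<rho>'' r) (at r) \<and>
        \<rho>'' r + \<rho>' r / r - \<rho> r / r\<^sup>2 + \<rho> r * (1 - (\<rho> r)\<^sup>2) = 0)"

definition vortex :: "(real \<Rightarrow> real) \<Rightarrow> real^2 \<Rightarrow> complex" where
  "vortex \<rho> x = of_real (\<rho> (norm x)) * cis (Arg (Complex (x $ 1) (x $ 2)))"


section \<open>Function spaces and the renormalized energy\<close>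

text \<open>The norm on \<open>complex^2\<close> is the Euclidean one, so that \<open>(norm (weak_gradient \<Psi> x))\<^sup>2\<close>
  is the sum of the squared moduli of both partial derivatives.\<close>

definition gl_density :: "(real^2 \<Rightarrow> complex) \<Rightarrow> real^2 \<Rightarrow> real" where
  "gl_density \<Psi> x =
     1/2 * (norm (weak_gradient \<Psi> x))\<^sup>2 + 1/4 * (1 - (cmod (\<Psi> x))\<^sup>2)\<^sup>2"

definition H_norm_sq :: "(real \<Rightarrow> real) \<Rightarrow> (real^2 \<Rightarrow> complex) \<Rightarrow> ennreal" where
  "H_norm_sq \<rho> \<Psi> = (\<integral>\<^sup>+x. ennreal (
     (norm (weak_gradient (\<lambda>y. \<Psi> y * cnj (vortex \<rho> y)) x))\<^sup>2 +
     (1 - (cmod (vortex \<rho> x))\<^sup>2) * (norm (weak_gradient \<Psi> x))\<^sup>2) \<partial>lebesgue)"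

text \<open>Finiteness of the norm forces the distributional gradients to be locally integrable
  functions, as \<open>1 - (cmod (vortex \<rho> x))\<^sup>2\<close> is continuous and positive.\<close>

definition H_space :: "(real \<Rightarrow> real) \<Rightarrow> (real^2 \<Rightarrow> complex) set" where
  "H_space \<rho> = {\<Psi> \<in> L2_loc. weakly_differentiable \<Psi> \<and>
     weakly_differentiable (\<lambda>y. \<Psi> y * cnj (vortex \<rho> y)) \<and> H_norm_sq \<rho> \<Psi> < \<infinity>}"

definition energy_space :: "(real \<Rightarrow> real) \<Rightarrow> (real^2 \<Rightarrow> complex) set" where
  "energy_space \<rho> =
     {\<Psi> \<in> H_space \<rho>. integrable lebesgue (\<lambda>x. (1 - (cmod (\<Psi> x))\<^sup>2)\<^sup>2)}"

definition excess_density :: "(real \<Rightarrow> real) \<Rightarrow> (real^2 \<Rightarrow> complex) \<Rightarrow> real^2 \<Rightarrow> real" where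
  "excess_density \<rho> \<Psi> x = gl_density \<Psi> x - gl_density (vortex \<rho>) x"

definition excess_energy :: "(real \<Rightarrow> real) \<Rightarrow> (real^2 \<Rightarrow> complex) \<Rightarrow> real \<Rightarrow> real" where
  "excess_energy \<rho> \<Psi> r = (LINT x:ball 0 r|lebesgue. excess_density \<rho> \<Psi> x)"

definition renormalized_energy :: "(real \<Rightarrow> real) \<Rightarrow> (real^2 \<Rightarrow> complex) \<Rightarrow> real" where
  "renormalized_energy \<rho> \<Psi> = Lim at_top (excess_energy \<rho> \<Psi>)"

end

theory Submission
  imports Defs
begin

text \<open>
  Write \<open>V\<close> for the vortex, \<open>U = \<Psi> * cnj V\<close> and \<open>\<theta>\<close> for the polar angle. As
  \<open>cnj V * grad \<Psi> = grad U - \<Psi> * grad (cnj V)\<close>, expanding the square gives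

    \<open>|grad \<Psi>|^2 - |grad V|^2 = (1 - |V|^2) |grad \<Psi>|^2 + |grad U|^2
        - 2 Re <grad U, \<Psi> grad (cnj V)> + (|\<Psi>|^2 - 1) |grad V|^2\<close>.

  The first two terms are the density of the squared norm of \<open>H\<close>. The last one is a product of
  two square integrable functions, as \<open>|grad V|^2\<close> decays like \<open>1 / |x|^2\<close>. In the third one
  \<open>grad V\<close> differs from \<open>\<i> V grad \<theta>\<close> only by a term of order \<open>1 / |x|^2\<close>, which again
  contributes an integrable function. There remains, away from the origin, the current
  \<open>2 Im (cnj U * \<partial>\<^sub>\<theta> U) / |x|^2\<close>, whose size \<open>|U| |grad U| / |x|\<close> is borderline. Its integral
  converges by cancellation: on every circle the mean of \<open>\<partial>\<^sub>\<theta> U\<close> is zero, so that \<open>U\<close> may be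
  replaced by \<open>U\<close> minus its mean, and Wirtinger's inequality bounds the integral over
  \<open>s \<le> |x| < R\<close> by a multiple of the integral of \<open>|grad U|^2\<close> over \<open>s \<le> |x|\<close>
  (\<open>angular_pairing_bound\<close>). The energies on balls therefore satisfy the Cauchy criterion
  (\<open>energy_converges\<close>).

  For the invariance, the same expansion shows that \<open>|grad \<Psi>|^2\<close> is at most an integrable
  function plus a multiple of \<open>1 / (1 + |x|^2)\<close> (\<open>W_sq_le\<close>). A translation by \<open>a\<close> changes the
  energy on the ball of radius \<open>R\<close> by at most the integral of the energy density over a shell of
  radius \<open>R\<close> and width \<open>2 |a|\<close>. The area of the shell grows only like \<open>R\<close>, so this integral
  tends to zero (\<open>energy_translate\<close>). The translated function stays in \<open>H\<close> because \<open>V\<close> and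
  \<open>grad V\<close> change under the translation by terms of order \<open>1 / |x|\<close> and \<open>1 / |x|^2\<close>.

  The proof has three further ingredients. Weak gradients, defined by smooth test functions, are
  extended to test functions of class \<open>C^1\<close> by mollification; uniqueness and the product rule
  follow. The bounds on \<open>V\<close> come from the profile equation by the maximum principle, with
  \<open>A / r^2\<close> as a barrier for \<open>1 - \<rho>\<close>. Finally, the argument on circles is carried out without
  slicing: a weakly differentiable function satisfies, for almost every \<open>x\<close>, the fundamental
  theorem of calculus along the rotation orbit of \<open>x\<close> (\<open>rotation_increment_AE\<close>), and all other
  steps are integrations over the plane and over the group of rotations.
\<close>

section \<open>Smooth bump functions\<close>

lemma partial_deriv_eqI:
  assumes "(f has_derivative D) (at x)"
  shows "partial_deriv i f x = D (axis i 1)"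
  using frechet_derivative_at[OF assms] by (simp add: partial_deriv_def)

lemma times_cont_diff_Suc_imp: "times_cont_diff (Suc k) f \<Longrightarrow> times_cont_diff k f"
proof (induction k arbitrary: f)
  case 0
  then have "\<And>x. f differentiable (at x)" by simp
  then show ?case
    by (simp add: continuous_on_eq_continuous_at differentiable_imp_continuous_within)
next
  case (Suc k)
  then have "\<And>x. f differentiable (at x)" "\<And>i. times_cont_diff (Suc k) (partial_deriv i f)"
    by simp_all
  with Suc.IH show ?case by simp
qed

lemma times_cont_diff_const [simp]: "times_cont_diff k (\<lambda>x::real^'n. c)"
proof (induction k arbitrary: c)
  case (Suc k)
  have "partial_deriv i (\<lambda>x::real^'n. c) = (\<lambda>x. 0)" for i
    by (rule ext, subst partial_deriv_eqI[where D = "\<lambda>h. 0"]) auto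
  with Suc show ?case by simp
qed simp

lemma times_cont_diff_add:
  assumes "times_cont_diff k f" "times_cont_diff k g"
  shows "times_cont_diff k (\<lambda>x. f x + g x)"
  using assms
proof (induction k arbitrary: f g)
  case (Suc k)
  have "partial_deriv i (\<lambda>x. f x + g x) = (\<lambda>x. partial_deriv i f x + partial_deriv i g x)" for i
  proof
    fix x
    have "((\<lambda>x. f x + g x) has_derivative
        (\<lambda>h. frechet_derivative f (at x) h + frechet_derivative g (at x) h)) (at x)"
      using Suc.prems by (intro has_derivative_add) (auto simp: frechet_derivative_works)
    from partial_deriv_eqI[OF this] show
      "partial_deriv i (\<lambda>x. f x + g x) x = partial_deriv i f x + partial_deriv i g x"
      by (simp add: partial_deriv_def)
  qed
  with Suc show ?case by auto
qed (auto intro: continuous_on_add)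

lemma times_cont_diff_mult:
  assumes "times_cont_diff k f" "times_cont_diff k g"
  shows "times_cont_diff k (\<lambda>x. f x * g x)"
  using assms
proof (induction k arbitrary: f g)
  case (Suc k)
  have "partial_deriv i (\<lambda>x. f x * g x) =
      (\<lambda>x. f x * partial_deriv i g x + partial_deriv i f x * g x)" for i
  proof
    fix x
    have "((\<lambda>x. f x * g x) has_derivative
        (\<lambda>h. f x * frechet_derivative g (at x) h + frechet_derivative f (at x) h * g x)) (at x)"
      using Suc.prems by (intro has_derivative_mult) (auto simp: frechet_derivative_works)
    from partial_deriv_eqI[OF this] show "partial_deriv i (\<lambda>x. f x * g x) x =
        f x * partial_deriv i g x + partial_deriv i f x * g x"
      by (simp add: partial_deriv_def)
  qed
  moreover have "times_cont_diff k f" "times_cont_diff k g"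
    using Suc.prems by (blast intro: times_cont_diff_Suc_imp)+
  moreover have "\<forall>x. f differentiable (at x)" "\<forall>x. g differentiable (at x)"
      "\<forall>i. times_cont_diff k (partial_deriv i f)" "\<forall>i. times_cont_diff k (partial_deriv i g)"
    using Suc.prems by auto
  ultimately show ?case
    by (simp add: times_cont_diff_add Suc.IH)
qed (auto intro: continuous_on_mult)

lemma times_cont_diff_prod:
  assumes "finite I" "\<And>i. i \<in> I \<Longrightarrow> times_cont_diff k (f i)"
  shows "times_cont_diff k (\<lambda>x. \<Prod>i\<in>I. f i x)"
  using assms by (induction I rule: finite_induct) (auto intro: times_cont_diff_mult)

text \<open>The powers of \<open>t\<close> are included because the derivatives of \<open>exp (- 1 / t)\<close> are linear
  combinations of these functions.\<close>
definition flat :: "nat \<Rightarrow> real \<Rightarrow> real" where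
  "flat k t = (if t \<le> 0 then 0 else exp (- (1 / t)) / t ^ k)"

lemma flat_tendsto_0: "(flat k \<longlongrightarrow> 0) (at 0)"
proof -
  have "((\<lambda>t. (1 / t) ^ k / exp (1 / t)) \<longlongrightarrow> (0::real)) (at_right 0)"
    using filterlim_compose[OF tendsto_power_div_exp_0 filterlim_inverse_at_top_right]
    by (simp add: inverse_eq_divide)
  moreover have "\<forall>\<^sub>F t in at_right 0. (1 / t) ^ k / exp (1 / t) = flat k t"
    using eventually_at_right_less[of 0]
    by eventually_elim (auto simp: flat_def exp_minus field_simps power_divide)
  ultimately have r: "(flat k \<longlongrightarrow> 0) (at_right 0)"
    by (rule Lim_transform_eventually)
  have "\<forall>\<^sub>F t in at_left 0. 0 = flat k t"
    by (auto simp: eventually_at_filter flat_def)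
  then have l: "(flat k \<longlongrightarrow> 0) (at_left 0)"
    by (rule Lim_transform_eventually[OF tendsto_const])
  show ?thesis
    using r l filterlim_split_at by blast
qed

lemma has_derivative_flat:
  "(flat k has_real_derivative (flat (k + 2) t - k * flat (k + 1) t)) (at t)"
proof (cases t "0::real" rule: linorder_cases)
  case less
  have "((\<lambda>t. 0) has_real_derivative (flat (k + 2) t - k * flat (k + 1) t)) (at t)"
    using less by (auto simp: flat_def)
  then show ?thesis
    by (rule DERIV_cong_ev[THEN iffD1, rotated -1])
      (use less in \<open>auto simp: flat_def eventually_nhds intro!: exI[of _ "{..<0}"]\<close>)
next
  case greater
  have "((\<lambda>t. exp (- (1 / t)) / t ^ k) has_real_derivative (flat (k + 2) t - k * flat (k + 1) t)) (at t)"
    using greater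
    apply (auto intro!: derivative_eq_intros simp: flat_def)
    apply (cases k)
     apply (auto simp: field_simps power2_eq_square)
    done
  then show ?thesis
    by (rule DERIV_cong_ev[THEN iffD1, rotated -1])
      (use greater in \<open>auto simp: flat_def eventually_nhds intro!: exI[of _ "{0<..}"]\<close>)
next
  case equal
  have "((\<lambda>h. flat k h / h) \<longlongrightarrow> 0) (at 0)"
  proof (rule Lim_transform_eventually[OF flat_tendsto_0[of "Suc k"]])
    show "\<forall>\<^sub>F h in at 0. flat (Suc k) h = flat k h / h"
      by (auto simp: flat_def eventually_at_filter)
  qed
  then show ?thesis
    using equal by (simp add: DERIV_def flat_def)
qed

lemma times_cont_diff_flat:
  "times_cont_diff m (\<lambda>x::real^'n. flat k (c + d * x $ i))"
proof (induction m arbitrary: k)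
  case 0
  have "continuous_on UNIV (flat k)"
    using DERIV_isCont[OF has_derivative_flat] by (simp add: continuous_on_eq_continuous_at)
  then show ?case
    unfolding times_cont_diff.simps
    by (rule continuous_on_compose2) (intro continuous_intros, simp)
next
  case (Suc m)
  have D: "((\<lambda>x::real^'n. flat k (c + d * x $ i)) has_derivative
     (\<lambda>h. (flat (k + 2) (c + d * x $ i) - k * flat (k + 1) (c + d * x $ i)) * (d * h $ i))) (at x)" for x
  proof -
    have "((\<lambda>x::real^'n. c + d * x $ i) has_derivative (\<lambda>h. d * h $ i)) (at x)"
      by (auto intro!: derivative_eq_intros bounded_linear.has_derivative[OF bounded_linear_vec_nth])
    from has_derivative_compose[OF this has_derivative_flat[of k "c + d * x $ i", unfolded has_field_derivative_def]]
    show ?thesis .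
  qed
  have "partial_deriv j (\<lambda>x::real^'n. flat k (c + d * x $ i)) =
      (\<lambda>x. (flat (k + 2) (c + d * x $ i) + (- real k) * flat (k + 1) (c + d * x $ i))
          * (d * axis j 1 $ i))" for j
    using partial_deriv_eqI[OF D, where i = j] by (auto simp: fun_eq_iff)
  moreover have "times_cont_diff m
      (\<lambda>x. (flat (k + 2) (c + d * x $ i) + (- real k) * flat (k + 1) (c + d * x $ i)) * (d * axis j 1 $ i))" for j
    by (intro times_cont_diff_add times_cont_diff_mult times_cont_diff_const Suc.IH)
  moreover have "(\<lambda>x::real^'n. flat k (c + d * x $ i)) differentiable (at x)" for x
    using D differentiableI by blast
  ultimately show ?case by (simp only: times_cont_diff.simps) blast
qed

text \<open>Products of one-dimensional bumps serve twice: on small boxes as mollifiers, and for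
  large \<open>n\<close> as approximations of the indicator function of a box.\<close>
definition bump :: "real \<Rightarrow> (real^'n) \<Rightarrow> (real^'n) \<Rightarrow> real^'n \<Rightarrow> real" where
  "bump n a b x = (\<Prod>i\<in>UNIV. flat 0 (n * (x $ i - a $ i)) * flat 0 (n * (b $ i - x $ i)))"

lemma bump_nonneg: "0 \<le> bump n a b x"
  by (auto simp: bump_def flat_def intro!: prod_nonneg)

lemma bump_le_1: "bump n a b x \<le> 1"
  by (auto simp: bump_def flat_def intro!: prod_le_1 mult_le_one)

lemma bump_pos_iff:
  assumes "n > 0" shows "0 < bump n a b x \<longleftrightarrow> x \<in> box a b"
proof
  assume *: "0 < bump n a b x"
  show "x \<in> box a b"
  proof (rule ccontr)
    assume "x \<notin> box a b"
    then have "\<exists>i. x $ i \<le> a $ i \<or> b $ i \<le> x $ i"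
      by (auto simp: mem_box_cart not_less)
    then obtain i where "x $ i \<le> a $ i \<or> b $ i \<le> x $ i" ..
    then have "flat 0 (n * (x $ i - a $ i)) * flat 0 (n * (b $ i - x $ i)) = 0"
      using assms by (auto simp: flat_def mult_le_0_iff)
    then have "bump n a b x = 0" unfolding bump_def by (intro prod_zero) auto
    with * show False by simp
  qed
next
  assume "x \<in> box a b"
  then show "0 < bump n a b x"
    using assms by (auto simp: bump_def flat_def mem_box_cart not_le mult_le_0_iff intro!: prod_pos)
qed

lemma bump_eq_0: "n > 0 \<Longrightarrow> x \<notin> box a b \<Longrightarrow> bump n a b x = 0"
  using bump_pos_iff[of n a b x] bump_nonneg[of n a b x] by auto

lemma test_function_bump:
  assumes "n > 0" shows "test_function (bump n a b)"
proof -
  have "times_cont_diff k (\<lambda>x. flat 0 ((- n * a $ i) + n * x $ i) * flat 0 (n * b $ i + (- n) * x $ i))" for k i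
    by (intro times_cont_diff_mult times_cont_diff_flat)
  then have "times_cont_diff k (bump n a b)" for k
    unfolding bump_def by (intro times_cont_diff_prod) (auto simp: algebra_simps)
  moreover have "closure {x. bump n a b x \<noteq> 0} \<subseteq> cbox a b"
    using bump_eq_0[OF assms] box_subset_cbox[of a b] by (intro closure_minimal) auto
  then have "compact (closure {x. bump n a b x \<noteq> 0})"
    using compact_cbox compact_closure bounded_cbox bounded_subset closure_subset by metis
  ultimately show ?thesis by (simp add: test_function_def)
qed

lemma bump_tendsto_indicator:
  "(\<lambda>m. bump (real (Suc m)) a b x) \<longlonglongrightarrow> indicator (box a b) x"
proof (cases "x \<in> box a b")
  case True
  have "(\<lambda>m. flat 0 (real (Suc m) * d)) \<longlonglongrightarrow> 1" if "d > 0" for d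
  proof -
    have "(\<lambda>m. exp (- (1 / (real (Suc m) * d)))) \<longlonglongrightarrow> exp (- 0)"
    proof (intro tendsto_intros)
      have "(\<lambda>m. (1 / d) * inverse (real (Suc m))) \<longlonglongrightarrow> (1 / d) * 0"
        by (intro tendsto_intros LIMSEQ_inverse_real_of_nat)
      then show "(\<lambda>m. 1 / (real (Suc m) * d)) \<longlonglongrightarrow> 0"
        by (simp add: field_simps)
    qed
    then show ?thesis using that by (simp add: flat_def mult_le_0_iff not_le)
  qed
  then have "(\<lambda>m. \<Prod>i\<in>UNIV. flat 0 (real (Suc m) * (x $ i - a $ i)) * flat 0 (real (Suc m) * (b $ i - x $ i)))
     \<longlonglongrightarrow> (\<Prod>i\<in>(UNIV::'a set). 1 * 1)"
    using True by (intro tendsto_intros) (auto simp: mem_box_cart)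
  then show ?thesis using True by (simp add: bump_def)
next
  case False
  then show ?thesis using bump_eq_0[of "real (Suc _)" x a b] by simp
qed

section \<open>Maps preserving Lebesgue measure\<close>

text \<open>Borel representatives make Fubini's theorem for products of Borel measures available.\<close>
lemma borel_measurable_lebesgue_version:
  fixes f :: "'a::euclidean_space \<Rightarrow> 'b::euclidean_space"
  assumes "f \<in> borel_measurable lebesgue"
  obtains f' where "f' \<in> borel_measurable borel" "AE x in lebesgue. f x = f' x"
proof -
  have "\<exists>g\<in>borel_measurable lborel. AE x in lborel. f x \<bullet> b = g x" for b
    using assms by (intro completion_ex_borel_measurable_real borel_measurable_inner) auto
  then obtain g where g: "\<And>b. g b \<in> borel_measurable lborel" "\<And>b. AE x in lborel. f x \<bullet> b = g b x"
    by metis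
  have "AE x in lborel. \<forall>b\<in>Basis. f x \<bullet> b = g b x"
    using g(2) by (intro AE_finite_allI) auto
  then have "AE x in lborel. f x = (\<Sum>b\<in>Basis. g b x *\<^sub>R b)"
    by eventually_elim (metis (no_types, lifting) euclidean_representation sum.cong)
  moreover have "(\<lambda>x. \<Sum>b\<in>Basis. g b x *\<^sub>R b) \<in> borel_measurable borel"
    using g(1) by auto
  ultimately show ?thesis
    using that AE_completion by blast
qed

definition lborel_preserving :: "('a::euclidean_space \<Rightarrow> 'a) \<Rightarrow> bool" where
  "lborel_preserving T \<longleftrightarrow> T \<in> borel \<rightarrow>\<^sub>M borel \<and> distr lborel borel T = lborel"

text \<open>Preimages of null sets under a map that preserves the Borel measure are null sets, so the
  map also preserves the completed measure.\<close>
lemma lborel_preserving_lebesgue: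
  assumes "lborel_preserving T"
  shows "T \<in> lebesgue \<rightarrow>\<^sub>M lebesgue" "distr lebesgue lebesgue T = lebesgue"
proof -
  have T: "T \<in> lborel \<rightarrow>\<^sub>M lborel" and d: "distr lborel lborel T = lborel"
    using assms by (auto simp: lborel_preserving_def cong: distr_cong)
  have T': "T \<in> lebesgue \<rightarrow>\<^sub>M lborel" using T by (rule measurable_completion)
  have d': "distr lebesgue lborel T = lborel" using distr_completion[OF T] d by simp
  show "T \<in> lebesgue \<rightarrow>\<^sub>M lebesgue"
    by (rule completion.measurable_completion2[OF T']) (simp add: d')
  show "distr lebesgue lebesgue T = lebesgue"
    using completion.completion_distr_eq[OF T'] d' by simp
qed

lemma
  assumes T: "lborel_preserving T"
  shows measurable_lborel_preserving:
      "f \<in> borel_measurable lebesgue \<Longrightarrow> (\<lambda>x. f (T x)) \<in> borel_measurable lebesgue"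
    and AE_lborel_preserving: "(AE x in lebesgue. P x) \<Longrightarrow> (AE x in lebesgue. P (T x))"
    and integrable_lborel_preserving:
      "integrable lebesgue f \<Longrightarrow> integrable lebesgue (\<lambda>x. f (T x) :: 'b::euclidean_space)"
    and integral_lborel_preserving:
      "f \<in> borel_measurable lebesgue \<Longrightarrow> (LINT x|lebesgue. f (T x) :: 'b) = (LINT x|lebesgue. f x)"
proof -
  note m = lborel_preserving_lebesgue[OF T]
  show "(\<lambda>x. f (T x)) \<in> borel_measurable lebesgue" if "f \<in> borel_measurable lebesgue"
    using measurable_compose[OF m(1) that] .
  show "AE x in lebesgue. P (T x)" if "AE x in lebesgue. P x"
    using AE_distrD[OF m(1), of P] that unfolding m(2) by simp
  show "integrable lebesgue (\<lambda>x. f (T x))" if "integrable lebesgue f" for f :: "'a \<Rightarrow> 'b"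
    using integrable_distr[OF m(1), of f] that m(2) by simp
  show "(LINT x|lebesgue. f (T x)) = (LINT x|lebesgue. f x)" if "f \<in> borel_measurable lebesgue" for f :: "'a \<Rightarrow> 'b"
    using integral_distr[OF m(1) that] m(2) by simp
qed

lemma lborel_preserving_plus: "lborel_preserving (\<lambda>x. x + a)"
proof -
  have "(\<lambda>x. x + a) = (+) a" by (auto simp: add.commute)
  then show ?thesis using lborel_distr_plus[of a] by (simp add: lborel_preserving_def)
qed

lemma lborel_preserving_reflect: "lborel_preserving (\<lambda>x. a - x)"
  using lborel_affine[of "-1" a] by (simp add: lborel_preserving_def density_1)

section \<open>Continuously differentiable functions and their gradients\<close>

lemma norm_axis: "norm (axis i x :: 'a::real_normed_vector^'n) = norm x"
proof -
  have "(norm (if j = i then x else 0))\<^sup>2 = (if j = i then (norm x)\<^sup>2 else 0)" for j by simp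
  then show ?thesis by (simp add: norm_vec_def axis_def L2_set_def)
qed

text \<open>The gradient is a second argument, so that closure properties come with explicit formulas
  for the gradients.\<close>
definition C1_field :: "(real^'n \<Rightarrow> complex) \<Rightarrow> (real^'n \<Rightarrow> complex^'n) \<Rightarrow> bool" where
  "C1_field \<phi> g \<longleftrightarrow> continuous_on UNIV g \<and>
     (\<forall>x. (\<phi> has_derivative (\<lambda>h. \<Sum>i\<in>UNIV. h $ i *\<^sub>R g x $ i)) (at x))"

definition C1c_field :: "(real^'n \<Rightarrow> complex) \<Rightarrow> (real^'n \<Rightarrow> complex^'n) \<Rightarrow> bool" where
  "C1c_field \<phi> g \<longleftrightarrow> C1_field \<phi> g \<and> (\<exists>R. \<forall>x. R \<le> norm x \<longrightarrow> \<phi> x = 0 \<and> g x = 0)"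

lemma C1_field_continuous:
  assumes "C1_field \<phi> g" shows "continuous_on UNIV \<phi>" "continuous_on UNIV (\<lambda>x. g x $ i)"
proof -
  have "isCont \<phi> x" for x
    using assms unfolding C1_field_def by (blast intro: has_derivative_continuous)
  then show "continuous_on UNIV \<phi>" by (simp add: continuous_on_eq_continuous_at)
  show "continuous_on UNIV (\<lambda>x. g x $ i)"
    using assms unfolding C1_field_def by (intro continuous_on_component) auto
qed

lemma C1_field_mult:
  assumes "C1_field \<phi> g" "C1_field \<psi> k"
  shows "C1_field (\<lambda>x. \<phi> x * \<psi> x) (\<lambda>x. \<chi> i. \<phi> x * k x $ i + g x $ i * \<psi> x)"
  unfolding C1_field_def
proof
  show "continuous_on UNIV (\<lambda>x. \<chi> i. \<phi> x * k x $ i + g x $ i * \<psi> x)"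
    by (intro continuous_on_vec_lambda continuous_on_add continuous_on_mult
        C1_field_continuous[OF assms(1)] C1_field_continuous[OF assms(2)])
  show "\<forall>x. ((\<lambda>x. \<phi> x * \<psi> x) has_derivative
          (\<lambda>h. \<Sum>i\<in>UNIV. h $ i *\<^sub>R (\<chi> i. \<phi> x * k x $ i + g x $ i * \<psi> x) $ i)) (at x)"
  proof
    fix x
    have "((\<lambda>x. \<phi> x * \<psi> x) has_derivative
        (\<lambda>h. \<phi> x * (\<Sum>i\<in>UNIV. h $ i *\<^sub>R k x $ i) + (\<Sum>i\<in>UNIV. h $ i *\<^sub>R g x $ i) * \<psi> x)) (at x)"
      using assms unfolding C1_field_def by (intro has_derivative_mult) auto
    then show "((\<lambda>x. \<phi> x * \<psi> x) has_derivative
          (\<lambda>h. \<Sum>i\<in>UNIV. h $ i *\<^sub>R (\<chi> i. \<phi> x * k x $ i + g x $ i * \<psi> x) $ i)) (at x)"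
      by (simp add: sum_distrib_left sum_distrib_right sum.distrib scaleR_right_distrib)
  qed
qed

lemma C1c_field_mult:
  assumes "C1_field \<phi> g" "C1c_field \<psi> k"
  shows "C1c_field (\<lambda>x. \<phi> x * \<psi> x) (\<lambda>x. \<chi> i. \<phi> x * k x $ i + g x $ i * \<psi> x)"
  using C1_field_mult[of \<phi> g \<psi> k] assms unfolding C1c_field_def
  by (auto simp: vec_eq_iff)

lemma C1_field_const: "C1_field (\<lambda>x. c) (\<lambda>x. 0)"
  by (auto simp: C1_field_def)

lemma C1_field_cnj:
  assumes "C1_field \<phi> g" shows "C1_field (\<lambda>x. cnj (\<phi> x)) (\<lambda>x. \<chi> i. cnj (g x $ i))"
  unfolding C1_field_def
proof (intro conjI allI)
  show "continuous_on UNIV (\<lambda>x. \<chi> i. cnj (g x $ i))"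
    by (intro continuous_on_vec_lambda continuous_on_cnj C1_field_continuous[OF assms])
  fix x
  have "((\<lambda>x. cnj (\<phi> x)) has_derivative (\<lambda>h. cnj (\<Sum>i\<in>UNIV. h $ i *\<^sub>R g x $ i))) (at x)"
    using assms unfolding C1_field_def by (intro has_derivative_cnj) auto
  then show "((\<lambda>x. cnj (\<phi> x)) has_derivative (\<lambda>h. \<Sum>i\<in>UNIV. h $ i *\<^sub>R (\<chi> i. cnj (g x $ i)) $ i)) (at x)"
    by simp
qed

lemma C1_field_translate:
  assumes "C1_field \<phi> g" shows "C1_field (\<lambda>x. \<phi> (x + a)) (\<lambda>x. g (x + a))"
  unfolding C1_field_def
proof (intro conjI allI)
  show "continuous_on UNIV (\<lambda>x. g (x + a))"
    using assms unfolding C1_field_def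
    by (auto intro!: continuous_on_compose2[of UNIV g] continuous_intros)
  fix x
  have "((\<lambda>x. x + a) has_derivative (\<lambda>h. h)) (at x)"
    by (auto intro!: derivative_eq_intros)
  from has_derivative_compose[OF this] show
    "((\<lambda>x. \<phi> (x + a)) has_derivative (\<lambda>h. \<Sum>i\<in>UNIV. h $ i *\<^sub>R g (x + a) $ i)) (at x)"
    using assms unfolding C1_field_def by blast
qed

lemma C1c_field_translate:
  assumes "C1c_field \<phi> g" shows "C1c_field (\<lambda>x. \<phi> (x + a)) (\<lambda>x. g (x + a))"
proof -
  obtain R where R: "\<And>x. R \<le> norm x \<Longrightarrow> \<phi> x = 0 \<and> g x = 0"
    using assms by (auto simp: C1c_field_def)
  have "R \<le> norm (x + a)" if "R + norm a \<le> norm x" for x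
    using that norm_triangle_ineq4[of "x + a" a] by simp
  with R assms show ?thesis
    by (auto simp: C1c_field_def C1_field_translate intro!: exI[of _ "R + norm a"])
qed

lemma C1c_field_test_function:
  assumes "test_function \<phi>"
  shows "C1c_field (\<lambda>x. of_real (\<phi> x)) (\<lambda>x. \<chi> i. of_real (partial_deriv i \<phi> x))"
proof -
  have "times_cont_diff 1 \<phi>" using assms by (auto simp: test_function_def)
  then have d: "\<And>x. \<phi> differentiable (at x)" and c: "\<And>i. continuous_on UNIV (partial_deriv i \<phi>)"
    by auto
  have D: "(\<phi> has_derivative (\<lambda>h. \<Sum>i\<in>UNIV. h $ i * partial_deriv i \<phi> x)) (at x)" for x
  proof -
    have "linear (frechet_derivative \<phi> (at x))"
      using d by (simp add: linear_frechet_derivative)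
    then have "frechet_derivative \<phi> (at x) h = (\<Sum>i\<in>UNIV. h $ i * partial_deriv i \<phi> x)" for h
      by (subst basis_expansion[of h, symmetric])
        (simp add: linear_sum linear_cmul partial_deriv_def scalar_mult_eq_scaleR)
    then have "frechet_derivative \<phi> (at x) = (\<lambda>h. \<Sum>i\<in>UNIV. h $ i * partial_deriv i \<phi> x)"
      by (rule ext)
    then show ?thesis using d[of x] by (simp add: frechet_derivative_works)
  qed
  have "((\<lambda>x. of_real (\<phi> x)) has_derivative (\<lambda>h. of_real (\<Sum>i\<in>UNIV. h $ i * partial_deriv i \<phi> x))) (at x)" for x
    by (intro has_derivative_of_real D)
  then have 1: "C1_field (\<lambda>x. of_real (\<phi> x)) (\<lambda>x. \<chi> i. of_real (partial_deriv i \<phi> x))"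
    using c unfolding C1_field_def
    by (auto intro!: continuous_on_vec_lambda continuous_intros simp: scaleR_conv_of_real)
  have "bounded (closure {x. \<phi> x \<noteq> 0})"
    using assms by (auto simp: test_function_def compact_imp_bounded)
  then have "bounded {x. \<phi> x \<noteq> 0}"
    by (rule bounded_subset) (rule closure_subset)
  then obtain R where R: "\<And>x. \<phi> x \<noteq> 0 \<Longrightarrow> norm x \<le> R"
    by (auto simp: bounded_iff)
  have "partial_deriv i \<phi> x = 0" if "norm x \<ge> R + 1" for i x
  proof -
    have "((\<lambda>x. 0) has_derivative (\<lambda>h. 0)) (at x)" by simp
    then have "(\<phi> has_derivative (\<lambda>h. 0)) (at x)"
    proof (rule has_derivative_transform_within_open[of _ _ _ UNIV "- cball 0 R"])
      show "x \<in> - cball 0 R" using that by simp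
    qed (use R in \<open>auto simp: not_le\<close>, use R in force)
    from partial_deriv_eqI[OF this] show ?thesis by simp
  qed
  moreover have "\<phi> x = 0" if "norm x \<ge> R + 1" for x
    using R[of x] that by force
  ultimately show ?thesis
    using 1 unfolding C1c_field_def by (auto intro!: exI[of _ "R + 1"] simp: vec_eq_iff)
qed

lemma C1c_field_bounded:
  assumes "C1c_field \<phi> g"
  obtains M where "M \<ge> 0" "\<And>x. norm (\<phi> x) \<le> M" "\<And>x. (\<Sum>i\<in>UNIV. norm (g x $ i)) \<le> M"
proof -
  obtain R where R: "\<And>x. R \<le> norm x \<Longrightarrow> \<phi> x = 0 \<and> g x = 0" and C: "C1_field \<phi> g"
    using assms by (auto simp: C1c_field_def)
  have "bounded ((\<lambda>x. norm (\<phi> x) + (\<Sum>i\<in>UNIV. norm (g x $ i))) ` cball 0 R)"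
    by (intro compact_imp_bounded compact_continuous_image continuous_on_add continuous_on_sum
        continuous_on_norm continuous_on_subset[OF C1_field_continuous(1)[OF C]]
        continuous_on_subset[OF C1_field_continuous(2)[OF C]]) auto
  then obtain M where M: "\<And>x. x \<in> cball 0 R \<Longrightarrow> norm (norm (\<phi> x) + (\<Sum>i\<in>UNIV. norm (g x $ i))) \<le> M"
    unfolding bounded_iff by blast
  have *: "norm (\<phi> x) + (\<Sum>i\<in>UNIV. norm (g x $ i)) \<le> \<bar>M\<bar>" for x
  proof (cases "R \<le> norm x")
    case False
    then show ?thesis using M[of x] by (auto intro: order_trans)
  qed (use R in auto)
  show ?thesis
  proof (rule that[of "\<bar>M\<bar>"])
    show "norm (\<phi> x) \<le> \<bar>M\<bar>" "(\<Sum>i\<in>UNIV. norm (g x $ i)) \<le> \<bar>M\<bar>" for x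
    proof -
      have "0 \<le> norm (\<phi> x)" "0 \<le> (\<Sum>i\<in>UNIV. norm (g x $ i))" by (auto intro: sum_nonneg)
      then show "norm (\<phi> x) \<le> \<bar>M\<bar>" "(\<Sum>i\<in>UNIV. norm (g x $ i)) \<le> \<bar>M\<bar>"
        using *[of x] by linarith+
    qed
  qed auto
qed

lemma C1c_field_lipschitz:
  assumes "C1c_field \<phi> g" "\<And>x. (\<Sum>i\<in>UNIV. norm (g x $ i)) \<le> M"
  shows "norm (\<phi> x - \<phi> y) \<le> M * norm (x - y)"
proof (rule differentiable_bound[of UNIV])
  show "(\<phi> has_derivative (\<lambda>h. \<Sum>i\<in>UNIV. h $ i *\<^sub>R g x $ i)) (at x within UNIV)" for x
    using assms by (auto simp: C1c_field_def C1_field_def)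
  show "onorm (\<lambda>h. \<Sum>i\<in>UNIV. h $ i *\<^sub>R g x $ i) \<le> M" for x
  proof (rule onorm_bound)
    have "0 \<le> (\<Sum>i\<in>UNIV. norm (g x $ i))" by (simp add: sum_nonneg)
    then show "0 \<le> M" using assms(2)[of x] by linarith
    fix h
    have "norm (\<Sum>i\<in>UNIV. h $ i *\<^sub>R g x $ i) \<le> (\<Sum>i\<in>UNIV. norm h * norm (g x $ i))"
      by (intro sum_norm_le) (auto intro!: mult_right_mono component_le_norm_cart)
    also have "\<dots> \<le> norm h * M"
      using assms(2)[of x] by (auto simp: sum_distrib_left[symmetric] intro!: mult_left_mono)
    finally show "norm (\<Sum>i\<in>UNIV. h $ i *\<^sub>R g x $ i) \<le> M * norm h"
      by (simp add: mult.commute)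
  qed
qed auto

lemma integrable_continuous_compact_support:
  fixes f :: "'a::euclidean_space \<Rightarrow> 'b::euclidean_space"
  assumes "continuous_on UNIV f" "\<And>x. R \<le> norm x \<Longrightarrow> f x = 0"
  shows "integrable lborel f"
proof -
  have "integrable lborel (\<lambda>x. indicator (cball 0 R) x *\<^sub>R f x)"
    by (rule borel_integrable_compact) (auto intro: continuous_on_subset[OF assms(1)])
  moreover have "(\<lambda>x. indicator (cball 0 R) x *\<^sub>R f x) = f"
    using assms(2) by (auto simp: indicator_def fun_eq_iff)
  ultimately show ?thesis by simp
qed

text \<open>The difference quotients of \<open>\<phi>\<close> have integral zero by translation invariance, and they
  converge boundedly to the partial derivative since \<open>\<phi>\<close> is Lipschitz continuous.\<close>
lemma integral_gradient_eq_0: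
  assumes "C1c_field \<phi> g"
  shows "(LINT x|lborel. g x $ i) = 0"
proof -
  obtain M where M: "M \<ge> 0" "\<And>x. norm (\<phi> x) \<le> M" "\<And>x. (\<Sum>i\<in>UNIV. norm (g x $ i)) \<le> M"
    using C1c_field_bounded[OF assms] by metis
  obtain R where R: "\<And>x. R \<le> norm x \<Longrightarrow> \<phi> x = 0 \<and> g x = 0" and C: "C1_field \<phi> g"
    using assms by (auto simp: C1c_field_def)
  note cont = C1_field_continuous[OF C]
  have [measurable]: "\<phi> \<in> borel_measurable borel" "(\<lambda>x. g x $ i) \<in> borel_measurable borel"
    using cont by (auto intro: borel_measurable_continuous_onI)
  have int: "integrable lborel \<phi>"
    using R by (intro integrable_continuous_compact_support[OF cont(1)]) auto
  define s where "s m x = real (Suc m) *\<^sub>R (\<phi> (x + axis i (inverse (real (Suc m)))) - \<phi> x)" for m x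
  have 1: "(\<lambda>m. s m x) \<longlonglongrightarrow> g x $ i" for x
  proof -
    have "((\<lambda>t. x + t *\<^sub>R axis i 1) has_derivative (\<lambda>t. t *\<^sub>R axis i 1)) (at 0)"
      by (auto intro!: derivative_eq_intros)
    moreover have "(\<phi> has_derivative (\<lambda>h. \<Sum>j\<in>UNIV. h $ j *\<^sub>R g x $ j)) (at (x + 0 *\<^sub>R axis i 1))"
      using C by (auto simp: C1_field_def)
    ultimately have "((\<lambda>t. \<phi> (x + t *\<^sub>R axis i 1)) has_derivative
        (\<lambda>t. \<Sum>j\<in>UNIV. (t *\<^sub>R axis i 1) $ j *\<^sub>R g x $ j)) (at 0)"
      by (rule has_derivative_compose)
    moreover have "(\<Sum>j\<in>UNIV. (t *\<^sub>R axis i (1::real)) $ j *\<^sub>R g x $ j) = t *\<^sub>R g x $ i" for t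
      by (simp add: axis_def if_distrib[of "\<lambda>c. c *\<^sub>R _"] if_distrib[of "\<lambda>c. t * c"] cong: if_cong)
    ultimately have "((\<lambda>t. \<phi> (x + t *\<^sub>R axis i 1)) has_derivative (\<lambda>t. t *\<^sub>R g x $ i)) (at 0)"
      by simp
    then have "(\<lambda>t. norm (\<phi> (x + t *\<^sub>R axis i 1) - \<phi> x - t *\<^sub>R g x $ i) / norm t) \<midarrow>0\<rightarrow> 0"
      by (simp add: has_derivative_at)
    then have "(\<lambda>t. norm ((\<phi> (x + t *\<^sub>R axis i 1) - \<phi> x) /\<^sub>R t - g x $ i)) \<midarrow>0\<rightarrow> 0"
    proof (rule Lim_transform_eventually)
      have "norm (d - t *\<^sub>R v) / norm t = norm (d /\<^sub>R t - v)" if "t \<noteq> 0" for t and d v :: complex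
      proof -
        have "d /\<^sub>R t - v = (d - t *\<^sub>R v) /\<^sub>R t" using that by (simp add: scaleR_diff_right)
        then show ?thesis by (simp add: divide_inverse mult.commute)
      qed
      then show "\<forall>\<^sub>F t in at 0. norm (\<phi> (x + t *\<^sub>R axis i 1) - \<phi> x - t *\<^sub>R g x $ i) / norm t =
          norm ((\<phi> (x + t *\<^sub>R axis i 1) - \<phi> x) /\<^sub>R t - g x $ i)"
        by (auto simp: eventually_at_filter)
    qed
    then have "(\<lambda>t. (\<phi> (x + t *\<^sub>R axis i 1) - \<phi> x) /\<^sub>R t) \<midarrow>0\<rightarrow> g x $ i"
      by (rule LIM_zero_cancel[OF tendsto_norm_zero_cancel])
    moreover have "filterlim (\<lambda>m. inverse (real (Suc m))) (at 0) sequentially"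
      unfolding filterlim_at
      by (intro conjI LIMSEQ_inverse_real_of_nat) auto
    ultimately have "(\<lambda>m. (\<phi> (x + inverse (real (Suc m)) *\<^sub>R axis i 1) - \<phi> x) /\<^sub>R inverse (real (Suc m)))
        \<longlonglongrightarrow> g x $ i"
      by (rule filterlim_compose)
    moreover have "t *\<^sub>R axis i (1::real) = axis i t" for t
      by (auto simp: axis_def vec_eq_iff)
    ultimately show ?thesis by (simp add: s_def)
  qed
  have 2: "norm (s m x) \<le> M * indicator (cball 0 (R + 1)) x" for m x
  proof -
    have le1: "inverse (real (Suc m)) \<le> 1" by (simp add: inverse_le_1_iff)
    have "norm (\<phi> (x + axis i (inverse (real (Suc m)))) - \<phi> x) \<le> M * inverse (real (Suc m))"
      using C1c_field_lipschitz[OF assms M(3), of "x + axis i (inverse (real (Suc m)))" x]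
      by (simp add: norm_axis)
    then have "norm (s m x) \<le> real (Suc m) * (M * inverse (real (Suc m)))"
      unfolding s_def norm_scaleR by (intro mult_mono) auto
    moreover have "real (Suc m) * (M * inverse (real (Suc m))) = M"
      by (simp del: of_nat_Suc)
    ultimately have b: "norm (s m x) \<le> M" by (simp only:)
    show ?thesis
    proof (cases "norm x \<le> R + 1")
      case False
      have "norm x \<le> norm (x + axis i (inverse (real (Suc m)))) + norm (axis i (inverse (real (Suc m))) :: real^'a)"
        using norm_triangle_ineq4[of "x + axis i (inverse (real (Suc m)))" "axis i (inverse (real (Suc m)))"] by simp
      then have "R \<le> norm (x + axis i (inverse (real (Suc m))))"
        using False le1 by (simp add: norm_axis)
      then have "s m x = 0" using R False by (simp add: s_def)
      with False show ?thesis by simp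
    qed (use b in simp)
  qed
  have 3: "(LINT x|lborel. s m x) = 0" for m
  proof -
    have "integrable lebesgue \<phi>" using int by (simp add: integrable_completion)
    note I = integrable_lborel_preserving[OF lborel_preserving_plus this]
      integral_lborel_preserving[OF lborel_preserving_plus borel_measurable_integrable[OF this]]
    show ?thesis
      unfolding s_def using I int
      by (simp add: integral_completion integrable_completion)
  qed
  have "(\<lambda>m. LINT x|lborel. s m x) \<longlonglongrightarrow> (LINT x|lborel. g x $ i)"
  proof (rule integral_dominated_convergence)
    show "integrable lborel (\<lambda>x. M * indicator (cball 0 (R + 1)) x)"
      by (intro integrable_mult_right integrable_real_indicator) (auto simp: emeasure_lborel_cball_finite[unfolded infinity_ennreal_def])
    show "s m \<in> borel_measurable lborel" for m unfolding s_def by measurable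
  qed (use 1 2 in auto)
  with 3 show ?thesis by (simp add: LIMSEQ_const_iff)
qed

section \<open>Locally integrable functions\<close>

lemma L1_loc_measurable:
  fixes f :: "real^'n \<Rightarrow> 'b::euclidean_space"
  assumes "f \<in> L1_loc" shows "f \<in> borel_measurable lebesgue"
proof -
  have "(\<lambda>x. indicator (cball 0 (real m)) x *\<^sub>R f x) \<in> borel_measurable lebesgue" for m
    using assms unfolding L1_loc_def set_integrable_def
    by (intro borel_measurable_integrable[of lebesgue]) auto
  moreover have "(\<lambda>m. indicator (cball 0 (real m)) x *\<^sub>R f x) \<longlonglongrightarrow> f x" for x
  proof (rule tendsto_eventually)
    show "\<forall>\<^sub>F m in sequentially. indicator (cball 0 (real m)) x *\<^sub>R f x = f x"
      using eventually_ge_at_top[of "nat \<lceil>norm x\<rceil>"] by eventually_elim auto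
  qed
  ultimately show ?thesis
    by (rule borel_measurable_LIMSEQ_metric)
qed

lemma L1_loc_iff_cball:
  fixes f :: "real^'n \<Rightarrow> 'b::euclidean_space"
  shows "f \<in> L1_loc \<longleftrightarrow> f \<in> borel_measurable lebesgue \<and>
    (\<forall>R. integrable lebesgue (\<lambda>x. indicator (cball 0 R) x *\<^sub>R f x))"
proof
  assume "f \<in> L1_loc"
  then show "f \<in> borel_measurable lebesgue \<and>
    (\<forall>R. integrable lebesgue (\<lambda>x. indicator (cball 0 R) x *\<^sub>R f x))"
    using L1_loc_measurable by (auto simp: L1_loc_def set_integrable_def)
next
  assume *: "f \<in> borel_measurable lebesgue \<and>
    (\<forall>R. integrable lebesgue (\<lambda>x. indicator (cball 0 R) x *\<^sub>R f x))"
  show "f \<in> L1_loc"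
    unfolding L1_loc_def set_integrable_def
  proof (intro CollectI allI impI)
    fix K :: "(real^'n) set" assume K: "compact K"
    then have "bounded K" by (rule compact_imp_bounded)
    then obtain R where R: "\<And>x. x \<in> K \<Longrightarrow> norm x \<le> R"
      by (auto simp: bounded_iff)
    have "K \<in> sets lebesgue" using K by (simp add: borel_compact)
    then show "integrable lebesgue (\<lambda>x. indicator K x *\<^sub>R f x)"
      using * by (intro Bochner_Integration.integrable_bound[OF spec[OF conjunct2[OF *], of R]])
        (auto simp: indicator_def intro!: borel_measurable_scaleR dest: R)
  qed
qed

lemma integrable_L1_loc_times_bounded:
  fixes f :: "real^'n \<Rightarrow> complex"
  assumes "f \<in> L1_loc" "k \<in> borel_measurable lebesgue" "\<And>x. norm (k x) \<le> M" "\<And>x. R \<le> norm x \<Longrightarrow> k x = 0"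
  shows "integrable lebesgue (\<lambda>x. f x * k x)"
proof (rule Bochner_Integration.integrable_bound)
  show "integrable lebesgue (\<lambda>x. M *\<^sub>R (indicator (cball 0 R) x *\<^sub>R f x))"
    using assms(1) unfolding L1_loc_iff_cball by (intro integrable_scaleR_right) auto
  show "(\<lambda>x. f x * k x) \<in> borel_measurable lebesgue"
    using L1_loc_measurable[OF assms(1)] assms(2) by (rule borel_measurable_times)
  show "AE x in lebesgue. norm (f x * k x) \<le> norm (M *\<^sub>R (indicator (cball 0 R) x *\<^sub>R f x))"
  proof (rule AE_I2)
    fix x
    have "norm (f x * k x) \<le> norm (f x) * \<bar>M\<bar>"
      using assms(3)[of x] by (auto simp: norm_mult intro!: mult_left_mono)
    then show "norm (f x * k x) \<le> norm (M *\<^sub>R (indicator (cball 0 R) x *\<^sub>R f x))"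
      using assms(4)[of x] by (cases "R \<le> norm x") (auto simp: indicator_def mult.commute)
  qed
qed

lemma L1_loc_component:
  fixes G :: "real^'n \<Rightarrow> complex^'n"
  assumes "G \<in> L1_loc" shows "(\<lambda>x. G x $ i) \<in> L1_loc"
proof -
  have "bounded_linear (\<lambda>v::complex^'n. v $ i)" by (rule bounded_linear_vec_nth)
  then have "integrable lebesgue (\<lambda>x. (indicator (cball 0 R) x *\<^sub>R G x) $ i)" for R
    by (rule integrable_bounded_linear) (use assms in \<open>auto simp: L1_loc_iff_cball\<close>)
  moreover have "(\<lambda>x. G x $ i) \<in> borel_measurable lebesgue"
    by (rule measurable_compose[OF L1_loc_measurable[OF assms]])
      (intro borel_measurable_continuous_onI continuous_intros)
  ultimately show ?thesis by (simp add: L1_loc_iff_cball)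
qed

lemma L1_loc_vec_lambda:
  fixes G :: "'n::finite \<Rightarrow> real^'n \<Rightarrow> complex"
  assumes "\<And>i. G i \<in> L1_loc" shows "(\<lambda>x. \<chi> i. G i x) \<in> L1_loc"
proof -
  have eq: "(\<chi> i. c i) = (\<Sum>i\<in>UNIV. axis i (c i))" for c :: "'n \<Rightarrow> complex"
    by (simp add: vec_eq_iff axis_def if_distrib cong: if_cong)
  have ax: "bounded_linear (\<lambda>z::complex. axis i z :: complex^'n)" for i
    by (intro bounded_linear_intro[of _ 1]) (auto simp: axis_def vec_eq_iff norm_axis[unfolded axis_def])
  have "integrable lebesgue (\<lambda>x. indicator (cball 0 R) x *\<^sub>R (\<chi> i. G i x))" for R
  proof -
    have "integrable lebesgue (\<lambda>x. \<Sum>i\<in>UNIV. axis i (indicator (cball 0 R) x *\<^sub>R G i x) :: complex^'n)"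
      using assms by (intro Bochner_Integration.integrable_sum integrable_bounded_linear[OF ax])
        (auto simp: L1_loc_iff_cball)
    moreover have "(\<Sum>i\<in>UNIV. axis i (indicator (cball 0 R) x *\<^sub>R G i x) :: complex^'n) =
        indicator (cball 0 R) x *\<^sub>R (\<chi> i. G i x)" for x
      by (subst eq[symmetric]) (simp add: vec_eq_iff)
    ultimately show ?thesis by simp
  qed
  moreover have "(\<lambda>x. \<chi> i. G i x) \<in> borel_measurable lebesgue"
  proof -
    have "(\<lambda>x. \<Sum>i\<in>UNIV. axis i (G i x) :: complex^'n) \<in> borel_measurable lebesgue"
      using assms L1_loc_measurable
      by (intro borel_measurable_sum measurable_compose[OF L1_loc_measurable[OF assms]]
          borel_measurable_continuous_onI linear_continuous_on ax)
    then show ?thesis by (simp add: eq)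
  qed
  ultimately show ?thesis by (simp add: L1_loc_iff_cball)
qed

lemma L1_loc_cong_AE:
  fixes f :: "real^'n \<Rightarrow> 'b::euclidean_space"
  assumes "f \<in> L1_loc" "AE x in lebesgue. f x = g x" "g \<in> borel_measurable lebesgue"
  shows "g \<in> L1_loc"
  unfolding L1_loc_iff_cball
proof (intro conjI allI)
  fix R
  have "integrable lebesgue (\<lambda>x. indicator (cball 0 R) x *\<^sub>R f x)"
    using assms by (auto simp: L1_loc_iff_cball)
  moreover have "AE x in lebesgue. indicator (cball 0 R) x *\<^sub>R f x = indicator (cball 0 R) x *\<^sub>R g x"
    using assms(2) by eventually_elim simp
  ultimately show "integrable lebesgue (\<lambda>x. indicator (cball 0 R) x *\<^sub>R g x)"
    using assms(3) L1_loc_measurable[OF assms(1)]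
    by (subst integrable_cong_AE[symmetric]) (auto intro!: borel_measurable_scaleR borel_measurable_indicator)
qed (fact assms)

lemma L1_loc_borel_version:
  fixes f :: "real^'n \<Rightarrow> complex"
  assumes "f \<in> L1_loc"
  obtains f' where "f' \<in> borel_measurable borel" "AE x in lebesgue. f x = f' x" "f' \<in> L1_loc"
    "\<And>R. integrable lborel (\<lambda>x. indicator (cball 0 R) x *\<^sub>R f' x)"
proof -
  obtain f' where f': "f' \<in> borel_measurable borel" "AE x in lebesgue. f x = f' x"
    by (rule borel_measurable_lebesgue_version[OF L1_loc_measurable[OF assms]]) (rule that)
  then have L: "f' \<in> L1_loc"
    using L1_loc_cong_AE[OF assms f'(2)] by (simp add: measurable_completion)
  then have "integrable lebesgue (\<lambda>x. indicator (cball 0 R) x *\<^sub>R f' x)" for R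
    by (auto simp: L1_loc_iff_cball)
  then have "integrable lborel (\<lambda>x. indicator (cball 0 R) x *\<^sub>R f' x)" for R
    using f'(1) by (subst integrable_completion[symmetric])
      (auto intro!: borel_measurable_scaleR borel_measurable_indicator)
  then show ?thesis by (rule that[OF f' L])
qed

lemma integrable_lborel_pair_tensor:
  fixes a :: "'a::euclidean_space \<Rightarrow> real" and b :: "'b::euclidean_space \<Rightarrow> real"
  assumes "integrable lborel a" "integrable lborel b"
  shows "integrable (lborel \<Otimes>\<^sub>M lborel) (\<lambda>(x, y). a x * b y)"
proof (rule lborel_pair.Fubini_integrable)
  have [measurable]: "a \<in> borel_measurable lborel" "b \<in> borel_measurable lborel"
    using assms by auto
  show "(\<lambda>(x, y). a x * b y) \<in> borel_measurable (lborel \<Otimes>\<^sub>M lborel)" by measurable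
  show "integrable lborel (\<lambda>x. LINT y|lborel. norm (case (x, y) of (x, y) \<Rightarrow> a x * b y))"
    using assms by (simp add: abs_mult)
  show "AE x in lborel. integrable lborel (\<lambda>y. case (x, y) of (x, y) \<Rightarrow> a x * b y)"
    using assms by simp
qed

text \<open>The supports of \<open>k\<close> and \<open>\<phi>\<close> confine \<open>x\<close> to a ball, so the integrand is dominated by a
  product of integrable functions of \<open>x\<close> and of \<open>z\<close>.\<close>
lemma lborel_Fubini_convolution:
  fixes f :: "real^'n \<Rightarrow> complex" and k \<phi> :: "real^'n \<Rightarrow> complex"
  assumes [measurable]: "f \<in> borel_measurable borel"
    and f: "\<And>R. integrable lborel (\<lambda>x. indicator (cball 0 R) x *\<^sub>R f x)"
    and k: "continuous_on UNIV k" "\<And>x. norm (k x) \<le> K" "\<And>x. R \<le> norm x \<Longrightarrow> k x = 0"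
    and \<phi>: "continuous_on UNIV \<phi>" "\<And>x. norm (\<phi> x) \<le> M" "\<And>x. R \<le> norm x \<Longrightarrow> \<phi> x = 0"
  shows "(LINT z|lborel. (LINT x|lborel. f x * k (x - z)) * \<phi> z) =
    (LINT x|lborel. f x * (LINT z|lborel. k (x - z) * \<phi> z))"
proof -
  have [measurable]: "k \<in> borel_measurable borel" "\<phi> \<in> borel_measurable borel"
    using k \<phi> by (auto intro: borel_measurable_continuous_onI)
  have "integrable (lborel \<Otimes>\<^sub>M lborel) (\<lambda>(x, z). f x * k (x - z) * \<phi> z)"
  proof (rule Bochner_Integration.integrable_bound)
    show "integrable (lborel \<Otimes>\<^sub>M lborel)
        (\<lambda>(x, z). norm (indicator (cball 0 (R + R)) x *\<^sub>R f x) * (K * M * indicator (cball 0 R) z))"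
      using f by (intro integrable_lborel_pair_tensor integrable_norm integrable_mult_right
          integrable_real_indicator) (auto simp: emeasure_lborel_cball_finite[unfolded infinity_ennreal_def])
    show "(\<lambda>(x, z). f x * k (x - z) * \<phi> z) \<in> borel_measurable (lborel \<Otimes>\<^sub>M lborel)"
      by measurable
    have "norm (f x * k (x - z) * \<phi> z) \<le>
        norm (norm (indicator (cball 0 (R + R)) x *\<^sub>R f x) * (K * M * indicator (cball 0 R) z))" for x z
    proof (cases "k (x - z) = 0 \<or> \<phi> z = 0")
      case False
      then have "norm (x - z) < R" "norm z < R" using k(3) \<phi>(3) by (meson not_le)+
      moreover from this have "norm x < R + R" using norm_triangle_sub[of x z] by simp
      moreover have "norm (k (x - z)) * norm (\<phi> z) \<le> \<bar>K * M\<bar>"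
        using k(2)[of "x - z"] \<phi>(2)[of z] unfolding abs_mult by (intro mult_mono) auto
      ultimately show ?thesis
        by (auto simp: norm_mult mult.assoc abs_mult[of "norm (f x)"] intro!: mult_left_mono)
    qed auto
    then show "AE p in lborel \<Otimes>\<^sub>M lborel. norm (case p of (x, z) \<Rightarrow> f x * k (x - z) * \<phi> z) \<le>
        norm (case p of (x, z) \<Rightarrow> norm (indicator (cball 0 (R + R)) x *\<^sub>R f x) * (K * M * indicator (cball 0 R) z))"
      by (auto simp del: real_norm_def)
  qed
  note F = lborel_pair.Fubini_integral[OF this]
  have 1: "(LINT x|lborel. f x * k (x - z)) * \<phi> z = (LINT x|lborel. f x * k (x - z) * \<phi> z)" for z
    by (rule integral_mult_left_zero[symmetric])
  have 2: "f x * (LINT z|lborel. k (x - z) * \<phi> z) = (LINT z|lborel. f x * k (x - z) * \<phi> z)" for x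
    unfolding mult.assoc by (rule integral_mult_right_zero[symmetric])
  show ?thesis unfolding 1 2 by (rule F)
qed

section \<open>Weak gradients tested with functions of class \<open>C^1\<close>\<close>

lemma C1c_field_bump:
  assumes "n > 0"
  shows "C1c_field (\<lambda>x. of_real (bump n a b x)) (\<lambda>x. \<chi> i. of_real (partial_deriv i (bump n a b) x))"
  using test_function_bump[OF assms] by (rule C1c_field_test_function)

lemma bump_translate: "bump n a b (x - z) = bump n (a + z) (b + z) x"
  by (simp add: bump_def algebra_simps)

text \<open>The weak identity for the test functions \<open>x \<mapsto> \<eta> (x - z)\<close>, multiplied by \<open>\<phi> z\<close> and
  integrated over \<open>z\<close>, becomes an identity for the convolution of \<open>\<eta>\<close> and \<open>\<phi>\<close>. An integration
  by parts in \<open>z\<close> moves the derivative from \<open>\<eta>\<close> to \<open>\<phi>\<close>.\<close>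
lemma weak_gradient_mollified:
  assumes f: "has_weak_gradient f G" and \<phi>: "C1c_field \<phi> g"
    and \<eta>_def: "\<eta> = bump 1 a b"
  shows "(LINT x|lebesgue. f x * (LINT z|lborel. of_real (\<eta> (x - z)) * g z $ i)) =
    - (LINT x|lebesgue. G x $ i * (LINT z|lborel. of_real (\<eta> (x - z)) * \<phi> z))"
proof -
  have fL: "f \<in> L1_loc" and GL: "(\<lambda>x. G x $ i) \<in> L1_loc"
    using f L1_loc_component by (auto simp: has_weak_gradient_def)
  obtain f' where [measurable]: "f' \<in> borel_measurable borel" and f'ae: "AE x in lebesgue. f x = f' x"
    and "f' \<in> L1_loc" and f': "\<And>R. integrable lborel (\<lambda>x. indicator (cball 0 R) x *\<^sub>R f' x)"
    by (rule L1_loc_borel_version[OF fL]) (rule that)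
  obtain G' where [measurable]: "G' \<in> borel_measurable borel" and G'ae: "AE x in lebesgue. G x $ i = G' x"
    and "G' \<in> L1_loc" and G': "\<And>R. integrable lborel (\<lambda>x. indicator (cball 0 R) x *\<^sub>R G' x)"
    by (rule L1_loc_borel_version[OF GL]) (rule that)
  define e :: "real^'a \<Rightarrow> complex" where "e x = of_real (\<eta> x)" for x
  define de :: "real^'a \<Rightarrow> complex" where "de x = of_real (partial_deriv i \<eta> x)" for x
  define De :: "real^'a \<Rightarrow> complex^'a" where "De x = (\<chi> i. of_real (partial_deriv i \<eta> x))" for x
  have eC: "C1c_field e De"
    unfolding e_def[abs_def] De_def[abs_def] \<eta>_def by (rule C1c_field_bump) simp
  have De: "De x $ i = de x" for x by (simp add: De_def de_def)
  obtain K where K: "\<And>x. norm (e x) \<le> K" "\<And>x. (\<Sum>i\<in>UNIV. norm (De x $ i)) \<le> K"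
    using C1c_field_bounded[OF eC] by metis
  obtain M where M: "\<And>x. norm (\<phi> x) \<le> M" "\<And>x. (\<Sum>i\<in>UNIV. norm (g x $ i)) \<le> M"
    using C1c_field_bounded[OF \<phi>] by metis
  have K2: "norm (de x) \<le> K" for x
    using K(2)[of x] member_le_sum[of i UNIV "\<lambda>i. norm (De x $ i)"] by (simp add: De)
  obtain R1 where R1: "\<And>x. R1 \<le> norm x \<Longrightarrow> e x = 0 \<and> De x = 0" and eC1: "C1_field e De"
    using eC by (auto simp: C1c_field_def)
  obtain R2 where R2: "\<And>x. R2 \<le> norm x \<Longrightarrow> \<phi> x = 0 \<and> g x = 0" and \<phi>C1: "C1_field \<phi> g"
    using \<phi> by (auto simp: C1c_field_def)
  define R where "R = max R1 R2"
  have R: "e x = 0" "de x = 0" "\<phi> x = 0" if "R \<le> norm x" for x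
    using that R1[of x] R2[of x] De[of x] by (auto simp: R_def)
  note cont = C1_field_continuous[OF eC1] C1_field_continuous[OF \<phi>C1]
  have contde: "continuous_on UNIV de" using cont(2)[of i] by (simp add: De)
  have [measurable]: "e \<in> borel_measurable borel" "de \<in> borel_measurable borel" "\<phi> \<in> borel_measurable borel"
    using cont contde by (auto intro: borel_measurable_continuous_onI)
  have test: "(LINT x|lborel. f' x * de (x - z)) = - (LINT x|lborel. G' x * e (x - z))" for z
  proof -
    have tr: "\<eta> (x - z) = bump 1 (a + z) (b + z) x" for x
      by (simp add: \<eta>_def bump_translate)
    have "times_cont_diff (Suc 0) \<eta>"
      using test_function_bump[of 1 a b] unfolding test_function_def \<eta>_def by simp
    then have d: "(\<eta> has_derivative frechet_derivative \<eta> (at x)) (at x)" for x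
      by (simp add: frechet_derivative_works[symmetric])
    have "((\<lambda>x. \<eta> (x - z)) has_derivative frechet_derivative \<eta> (at (x - z))) (at x)" for x
    proof -
      have "((\<lambda>x. x - z) has_derivative (\<lambda>h. h)) (at x)"
        by (auto intro!: derivative_eq_intros)
      from has_derivative_compose[OF this d] show ?thesis .
    qed
    then have "partial_deriv i (\<lambda>x. \<eta> (x - z)) x = partial_deriv i \<eta> (x - z)" for x
      by (rule partial_deriv_eqI[THEN trans]) (simp add: partial_deriv_def)
    then have pd: "partial_deriv i (bump 1 (a + z) (b + z)) x = partial_deriv i \<eta> (x - z)" for x
      by (simp add: tr)
    have [measurable]: "(\<lambda>x. de (x - z)) \<in> borel_measurable lebesgue"
        "(\<lambda>x. e (x - z)) \<in> borel_measurable lebesgue" "f' \<in> borel_measurable lebesgue"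
        "G' \<in> borel_measurable lebesgue"
      by (rule measurable_completion; measurable)+
    have "(LINT x|lebesgue. f x * de (x - z)) = - (LINT x|lebesgue. G x $ i * e (x - z))"
      using f test_function_bump[of 1 "a + z" "b + z"] unfolding has_weak_gradient_def
      by (auto simp: e_def de_def tr pd[symmetric])
    moreover have "(LINT x|lebesgue. f x * de (x - z)) = (LINT x|lebesgue. f' x * de (x - z))"
      using f'ae L1_loc_measurable[OF fL] by (intro integral_cong_AE) auto
    moreover have "(LINT x|lebesgue. G x $ i * e (x - z)) = (LINT x|lebesgue. G' x * e (x - z))"
      using G'ae L1_loc_measurable[OF GL] by (intro integral_cong_AE) auto
    ultimately show ?thesis by (simp add: integral_completion)
  qed
  have parts: "(LINT z|lborel. de (x - z) * \<phi> z) = (LINT z|lborel. e (x - z) * g z $ i)" for x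
  proof -
    have reflect: "C1_field (\<lambda>z. e (x - z)) (\<lambda>z. - De (x - z))"
      unfolding C1_field_def
    proof (intro conjI allI)
      show "continuous_on UNIV (\<lambda>z. - De (x - z))"
        using eC1 unfolding C1_field_def
        by (intro continuous_on_minus continuous_on_compose2[of UNIV De UNIV "\<lambda>z. x - z"]) (auto intro!: continuous_intros)
      fix z
      have "((\<lambda>z. x - z) has_derivative (\<lambda>h. - h)) (at z)"
        by (auto intro!: derivative_eq_intros)
      moreover have "(e has_derivative (\<lambda>h. \<Sum>i\<in>UNIV. h $ i *\<^sub>R De (x - z) $ i)) (at (x - z))"
        using eC1 by (auto simp: C1_field_def)
      ultimately have "((\<lambda>z. e (x - z)) has_derivative (\<lambda>h. \<Sum>i\<in>UNIV. (- h) $ i *\<^sub>R De (x - z) $ i)) (at z)"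
        by (rule has_derivative_compose)
      then show "((\<lambda>z. e (x - z)) has_derivative (\<lambda>h. \<Sum>i\<in>UNIV. h $ i *\<^sub>R (- De (x - z)) $ i)) (at z)"
        by simp
    qed
    have "(LINT z|lborel. e (x - z) * g z $ i - de (x - z) * \<phi> z) = 0"
      using integral_gradient_eq_0[OF C1c_field_mult[OF reflect \<phi>], of i] by (simp add: De)
    moreover have "integrable lborel (\<lambda>z. e (x - z) * g z $ i)" "integrable lborel (\<lambda>z. de (x - z) * \<phi> z)"
      using R2
      by (auto intro!: integrable_continuous_compact_support[where R = R2] continuous_on_mult cont(3,4)
          continuous_on_compose2[OF cont(1), of UNIV "\<lambda>z. x - z"]
          continuous_on_compose2[OF contde, of UNIV "\<lambda>z. x - z"] continuous_on_diff continuous_on_const continuous_on_id)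
    ultimately show ?thesis by simp
  qed
  have swap1: "(LINT z|lborel. (LINT x|lborel. f' x * de (x - z)) * \<phi> z) =
      (LINT x|lborel. f' x * (LINT z|lborel. de (x - z) * \<phi> z))"
    by (rule lborel_Fubini_convolution[OF _ f' contde K2 _ cont(3) M(1), of R]) (use R in auto)
  have swap2: "(LINT z|lborel. (LINT x|lborel. G' x * e (x - z)) * \<phi> z) =
      (LINT x|lborel. G' x * (LINT z|lborel. e (x - z) * \<phi> z))"
    by (rule lborel_Fubini_convolution[OF _ G' cont(1) K(1) _ cont(3) M(1), of R]) (use R in auto)
  have [measurable]: "(\<lambda>x. g x $ i) \<in> borel_measurable borel"
    using cont(4) by (auto intro: borel_measurable_continuous_onI)
  have mm: "(\<lambda>x. LINT z|lborel. e (x - z) * g z $ i) \<in> borel_measurable borel"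
      "(\<lambda>x. LINT z|lborel. e (x - z) * \<phi> z) \<in> borel_measurable borel"
    by measurable
  have [measurable]: "(\<lambda>x. LINT z|lborel. e (x - z) * g z $ i) \<in> borel_measurable lebesgue"
      "(\<lambda>x. LINT z|lborel. e (x - z) * \<phi> z) \<in> borel_measurable lebesgue"
      "f' \<in> borel_measurable lebesgue" "G' \<in> borel_measurable lebesgue"
    using mm by (auto intro: measurable_completion)
  have "(LINT x|lebesgue. f x * (LINT z|lborel. e (x - z) * g z $ i)) =
      (LINT x|lebesgue. f' x * (LINT z|lborel. e (x - z) * g z $ i))"
    using f'ae L1_loc_measurable[OF fL] mm by (intro integral_cong_AE) auto
  also have "\<dots> = (LINT x|lborel. f' x * (LINT z|lborel. e (x - z) * g z $ i))"
    using mm by (simp add: integral_completion)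
  also have "\<dots> = - (LINT x|lborel. G' x * (LINT z|lborel. e (x - z) * \<phi> z))"
    using swap1 swap2 test parts by simp
  also have "(LINT x|lborel. G' x * (LINT z|lborel. e (x - z) * \<phi> z)) =
      (LINT x|lebesgue. G' x * (LINT z|lborel. e (x - z) * \<phi> z))"
    using mm by (simp add: integral_completion)
  also have "\<dots> = (LINT x|lebesgue. G x $ i * (LINT z|lborel. e (x - z) * \<phi> z))"
    using G'ae L1_loc_measurable[OF GL] mm by (intro integral_cong_AE) auto
  finally show ?thesis by (simp add: e_def)
qed

lemma integral_bump_pos:
  assumes "box a b \<noteq> {}"
  shows "0 < (LINT x|lborel. bump 1 a b x)"
proof -
  have C: "C1c_field (\<lambda>x. complex_of_real (bump 1 a b x)) (\<lambda>x. \<chi> i. of_real (partial_deriv i (bump 1 a b) x))"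
    by (rule C1c_field_bump) simp
  have "continuous_on UNIV (\<lambda>x. Re (complex_of_real (bump 1 a b x)))"
    using C by (intro continuous_on_Re C1_field_continuous(1)) (auto simp: C1c_field_def)
  then have cont: "continuous_on UNIV (bump 1 a b)" by simp
  then have [measurable]: "bump 1 a b \<in> borel_measurable borel"
    by (rule borel_measurable_continuous_onI)
  obtain R where R: "\<And>x. R \<le> norm x \<Longrightarrow> complex_of_real (bump 1 a b x) = 0"
    using C by (auto simp: C1c_field_def)
  then have int: "integrable lborel (bump 1 a b)"
    by (intro integrable_continuous_compact_support[OF cont]) auto
  have "(LINT x|lborel. bump 1 a b x) \<noteq> 0"
  proof
    assume "(LINT x|lborel. bump 1 a b x) = 0"
    then have "AE x in lborel. bump 1 a b x = 0"
      using integral_nonneg_eq_0_iff_AE[OF int AE_I2[OF bump_nonneg]] by simp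
    then have "AE x in lborel. x \<notin> box a b"
      by eventually_elim (use bump_pos_iff[of 1 a b] in force)
    then have "emeasure lborel (box a b) = 0"
      by (subst (asm) AE_iff_measurable[of "box a b"]) auto
    moreover have "emeasure lborel (box a b) > 0"
      using assms by (auto simp: emeasure_lborel_box_eq box_ne_empty less_imp_le inner_diff_left intro!: prod_pos)
    ultimately show False by simp
  qed
  moreover have "0 \<le> (LINT x|lborel. bump 1 a b x)"
    by (intro integral_nonneg_AE) (auto simp: bump_nonneg)
  ultimately show ?thesis by simp
qed

definition corner :: "nat \<Rightarrow> real^'n" where
  "corner m = (\<chi> i. inverse (real (Suc m)))"

definition mollify :: "nat \<Rightarrow> (real^'n \<Rightarrow> complex) \<Rightarrow> real^'n \<Rightarrow> complex" where
  "mollify m \<phi> x = (LINT z|lborel. of_real (bump 1 (- corner m) (corner m) (x - z)) * \<phi> z) /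
     of_real (LINT y|lborel. bump 1 (- corner m) (corner m :: real^'n) y)"

lemma box_corner: "y \<in> box (- corner m) (corner m) \<Longrightarrow> norm (y :: real^'n) \<le> real CARD('n) * inverse (real (Suc m))"
proof -
  assume y: "y \<in> box (- corner m) (corner m)"
  then have "- inverse (real (Suc m)) < y $ i \<and> y $ i < inverse (real (Suc m))" for i
    by (simp add: mem_box_cart corner_def del: of_nat_Suc)
  then have "\<bar>y $ i\<bar> \<le> inverse (real (Suc m))" for i
    unfolding abs_le_iff by (metis less_imp_le minus_le_iff)
  then have "(\<Sum>i\<in>UNIV. \<bar>y $ i\<bar>) \<le> (\<Sum>i\<in>(UNIV::'n set). inverse (real (Suc m)))"
    by (intro sum_mono) auto
  then show ?thesis using norm_le_l1_cart[of y] by simp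
qed

text \<open>A weighted mean of values that are \<open>e\<close>-close to \<open>c\<close> is \<open>e\<close>-close to \<open>c\<close>. Convergence,
  bounds and supports of mollified functions are all instances of this.\<close>
lemma mollify_close:
  fixes \<phi> :: "real^'n \<Rightarrow> complex"
  assumes cont: "continuous_on UNIV \<phi>" and supp: "\<And>x. R \<le> norm x \<Longrightarrow> \<phi> x = 0"
    and close: "\<And>z. norm (x - z) \<le> real CARD('n) * inverse (real (Suc m)) \<Longrightarrow> norm (\<phi> z - c) \<le> e"
  shows "norm (mollify m \<phi> x - c) \<le> e"
proof -
  define \<eta> where "\<eta> = bump 1 (- corner m) (corner m :: real^'n)"
  define \<kappa> where "\<kappa> = (LINT y|lborel. \<eta> y)"
  have "(0 :: real^'n) \<in> box (- corner m) (corner m)"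
    by (simp add: mem_box_cart corner_def)
  then have \<kappa>: "\<kappa> > 0" unfolding \<kappa>_def \<eta>_def by (intro integral_bump_pos) blast
  have C: "C1c_field (\<lambda>x. complex_of_real (\<eta> x)) (\<lambda>x. \<chi> i. of_real (partial_deriv i \<eta> x))"
    unfolding \<eta>_def by (rule C1c_field_bump) simp
  have "continuous_on UNIV (\<lambda>x. Re (complex_of_real (\<eta> x)))"
    using C by (intro continuous_on_Re C1_field_continuous(1)) (auto simp: C1c_field_def)
  then have c\<eta>: "continuous_on UNIV \<eta>" by simp
  then have cz: "continuous_on UNIV (\<lambda>z. \<eta> (x - z))"
    by (rule continuous_on_compose2) (auto intro!: continuous_intros)
  obtain R1 where R1: "\<And>x. R1 \<le> norm x \<Longrightarrow> complex_of_real (\<eta> x) = 0"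
    using C by (auto simp: C1c_field_def)
  have "R1 \<le> norm (x - z)" if "R1 + norm x \<le> norm z" for z
    using that norm_triangle_sub[of z x] by (simp add: norm_minus_commute)
  then have int: "integrable lborel (\<lambda>z. \<eta> (x - z))"
    using R1 by (intro integrable_continuous_compact_support[OF cz, of "R1 + norm x"]) auto
  have int\<eta>: "integrable lborel \<eta>"
    using R1 by (intro integrable_continuous_compact_support[OF c\<eta>, of R1]) auto
  have \<kappa>_eq: "(LINT z|lborel. \<eta> (x - z)) = \<kappa>"
  proof -
    have "(LINT z|lebesgue. \<eta> (x - z)) = (LINT z|lebesgue. \<eta> z)"
      using int\<eta> by (intro integral_lborel_preserving[OF lborel_preserving_reflect])
        (auto intro: measurable_completion)
    then show ?thesis using int int\<eta> unfolding \<kappa>_def by (simp add: integral_completion)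
  qed
  have int1: "integrable lborel (\<lambda>z. of_real (\<eta> (x - z)) * \<phi> z)"
    using supp by (intro integrable_continuous_compact_support[of _ R] continuous_on_mult
        continuous_on_of_real cz cont) auto
  have int2: "integrable lborel (\<lambda>z. of_real (\<eta> (x - z)) * c)"
    using int by (intro integrable_mult_left) (auto simp: integrable_of_real)
  have "mollify m \<phi> x - c = ((LINT z|lborel. of_real (\<eta> (x - z)) * \<phi> z) - of_real \<kappa> * c) / of_real \<kappa>"
    using \<kappa> by (simp add: mollify_def \<eta>_def[symmetric] \<kappa>_def[symmetric] field_simps)
  also have "of_real \<kappa> * c = (LINT z|lborel. of_real (\<eta> (x - z)) * c)"
    by (simp add: \<kappa>_eq[symmetric] integral_complex_of_real)
  also have "(LINT z|lborel. of_real (\<eta> (x - z)) * \<phi> z) - (LINT z|lborel. of_real (\<eta> (x - z)) * c) =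
      (LINT z|lborel. of_real (\<eta> (x - z)) * (\<phi> z - c))"
    using int1 int2 by (simp add: right_diff_distrib)
  finally have "norm (mollify m \<phi> x - c) = norm (LINT z|lborel. of_real (\<eta> (x - z)) * (\<phi> z - c)) / \<kappa>"
    using \<kappa> by (simp add: norm_divide)
  moreover have "norm (LINT z|lborel. of_real (\<eta> (x - z)) * (\<phi> z - c)) \<le> (LINT z|lborel. \<eta> (x - z) * e)"
  proof (rule order_trans[OF integral_norm_bound integral_mono], rule integrable_norm)
    show "integrable lborel (\<lambda>z. of_real (\<eta> (x - z)) * (\<phi> z - c))"
      using int1 int2 by (simp add: right_diff_distrib)
    show "integrable lborel (\<lambda>z. \<eta> (x - z) * e)" using int by simp
    fix z
    have nn: "0 \<le> \<eta> (x - z)" by (simp add: \<eta>_def bump_nonneg)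
    show "norm (of_real (\<eta> (x - z)) * (\<phi> z - c)) \<le> \<eta> (x - z) * e"
    proof (cases "\<eta> (x - z) = 0")
      case False
      then have "x - z \<in> box (- corner m) (corner m)"
        using bump_eq_0[of 1 "x - z" "- corner m" "corner m"] by (auto simp: \<eta>_def)
      from close[OF box_corner[OF this]] nn show ?thesis
        by (simp add: norm_mult mult_left_mono)
    qed simp
  qed
  moreover have b: "(LINT z|lborel. \<eta> (x - z) * e) = \<kappa> * e" by (simp add: \<kappa>_eq)
  ultimately show ?thesis unfolding b using \<kappa> by (simp add: divide_le_eq mult.commute[of e])
qed

lemma mollify_tendsto:
  fixes \<phi> :: "real^'n \<Rightarrow> complex"
  assumes cont: "continuous_on UNIV \<phi>" and supp: "\<And>x. R \<le> norm x \<Longrightarrow> \<phi> x = 0"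
  shows "(\<lambda>m. mollify m \<phi> x) \<longlonglongrightarrow> \<phi> x"
proof (rule metric_LIMSEQ_I)
  fix r :: real assume r: "0 < r"
  have "isCont \<phi> x" using cont by (simp add: continuous_on_eq_continuous_at)
  then obtain d where d: "d > 0" "\<And>z. norm (z - x) < d \<Longrightarrow> norm (\<phi> z - \<phi> x) < r / 2"
    using r unfolding continuous_at_eps_delta by (metis dist_norm half_gt_zero)
  have "(\<lambda>m. real CARD('n) * inverse (real (Suc m))) \<longlonglongrightarrow> real CARD('n) * 0"
    by (intro tendsto_intros LIMSEQ_inverse_real_of_nat)
  then have "\<forall>\<^sub>F m in sequentially. real CARD('n) * inverse (real (Suc m)) < d"
    using d(1) by (intro order_tendstoD(2)) auto
  then obtain N where N: "\<And>m. m \<ge> N \<Longrightarrow> real CARD('n) * inverse (real (Suc m)) < d"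
    unfolding eventually_sequentially by blast
  show "\<exists>no. \<forall>n\<ge>no. dist (mollify n \<phi> x) (\<phi> x) < r"
  proof (intro exI allI impI)
    fix m assume "N \<le> m"
    then have "norm (mollify m \<phi> x - \<phi> x) \<le> r / 2"
    proof (intro mollify_close[OF cont supp])
      fix z assume "norm (x - z) \<le> real CARD('n) * inverse (real (Suc m))"
      then have "norm (z - x) < d" using N[OF \<open>N \<le> m\<close>] by (simp add: norm_minus_commute)
      then show "norm (\<phi> z - \<phi> x) \<le> r / 2" using d(2) by (simp add: less_imp_le)
    qed
    then show "dist (mollify m \<phi> x) (\<phi> x) < r" using r by (simp add: dist_norm)
  qed
qed

lemma mollify_bound:
  fixes \<phi> :: "real^'n \<Rightarrow> complex"
  assumes cont: "continuous_on UNIV \<phi>" and supp: "\<And>x. R \<le> norm x \<Longrightarrow> \<phi> x = 0"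
    and M: "\<And>x. norm (\<phi> x) \<le> M"
  shows "norm (mollify m \<phi> x) \<le> M" "R + real CARD('n) \<le> norm x \<Longrightarrow> mollify m \<phi> x = 0"
proof -
  show "norm (mollify m \<phi> x) \<le> M"
    using mollify_close[OF cont supp, where x = x and m = m and c = 0 and e = M] M by simp
  assume R: "R + real CARD('n) \<le> norm x"
  have "norm (mollify m \<phi> x - 0) \<le> 0"
  proof (rule mollify_close[OF cont supp])
    fix z assume z: "norm (x - z) \<le> real CARD('n) * inverse (real (Suc m))"
    have "real CARD('n) * inverse (real (Suc m)) \<le> real CARD('n) * 1"
      by (intro mult_left_mono) (auto simp: inverse_le_1_iff)
    then have "norm (x - z) \<le> real CARD('n)" using z by linarith
    then have "R \<le> norm z" using R norm_triangle_sub[of x z] by simp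
    then show "norm (\<phi> z - 0) \<le> 0" by (simp add: supp)
  qed
  then show "mollify m \<phi> x = 0" by simp
qed

lemma borel_measurable_mollify:
  assumes "continuous_on UNIV \<phi>" shows "mollify m \<phi> \<in> borel_measurable borel"
proof -
  have C: "C1c_field (\<lambda>x. complex_of_real (bump 1 a b x)) (\<lambda>x. \<chi> i. of_real (partial_deriv i (bump 1 a b) x))" for a b :: "real^'a"
    by (rule C1c_field_bump) simp
  have "(\<lambda>x. complex_of_real (bump 1 a b x)) \<in> borel_measurable borel" for a b :: "real^'a"
    using C[of a b] by (intro borel_measurable_continuous_onI C1_field_continuous(1)) (auto simp: C1c_field_def)
  note [measurable] = this borel_measurable_continuous_onI[OF assms]
  show ?thesis unfolding mollify_def[abs_def] by measurable
qed

theorem weak_gradient_C1c: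
  assumes f: "has_weak_gradient f G" and \<phi>: "C1c_field \<phi> g"
  shows "(LINT x|lebesgue. f x * g x $ i) = - (LINT x|lebesgue. G x $ i * \<phi> x)"
proof -
  have fL: "f \<in> L1_loc" and GL: "(\<lambda>x. G x $ i) \<in> L1_loc"
    using f L1_loc_component by (auto simp: has_weak_gradient_def)
  obtain R where R: "\<And>x. R \<le> norm x \<Longrightarrow> \<phi> x = 0 \<and> g x = 0" and C: "C1_field \<phi> g"
    using \<phi> by (auto simp: C1c_field_def)
  note cont = C1_field_continuous[OF C]
  obtain M where M: "\<And>x. norm (\<phi> x) \<le> M" "\<And>x. (\<Sum>i\<in>UNIV. norm (g x $ i)) \<le> M"
    using C1c_field_bounded[OF \<phi>] by metis
  have Mi: "norm (g x $ i) \<le> M" for x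
    using M(2)[of x] member_le_sum[of i UNIV "\<lambda>i. norm (g x $ i)"] by simp
  have lim: "(\<lambda>m. LINT x|lebesgue. f x * mollify m \<phi> x) \<longlonglongrightarrow> (LINT x|lebesgue. f x * \<phi> x)"
    if fL: "f \<in> L1_loc" and cont: "continuous_on UNIV \<phi>" and M: "\<And>x. norm (\<phi> x) \<le> M"
      and R: "\<And>x. R \<le> norm x \<Longrightarrow> \<phi> x = 0" for f \<phi> :: "real^'a \<Rightarrow> complex"
  proof (rule integral_dominated_convergence)
    have [measurable]: "f \<in> borel_measurable lebesgue" "\<phi> \<in> borel_measurable lebesgue"
        "\<And>m. mollify m \<phi> \<in> borel_measurable lebesgue"
      using L1_loc_measurable[OF fL] borel_measurable_mollify[OF cont] borel_measurable_continuous_onI[OF cont]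
      by (auto intro: measurable_completion)
    define w where "w x = complex_of_real (M * indicator (cball 0 (R + real CARD('a))) x)" for x :: "real^'a"
    have [measurable]: "w \<in> borel_measurable lebesgue"
      unfolding w_def
      by (intro measurable_compose[OF _ borel_measurable_of_real] borel_measurable_times borel_measurable_indicator) auto
    have "integrable lebesgue (\<lambda>x. f x * w x)"
      by (rule integrable_L1_loc_times_bounded[OF fL _, of _ "\<bar>M\<bar>" "R + real CARD('a) + 1"])
        (fact, auto simp: w_def indicator_def norm_mult)
    then show "integrable lebesgue (\<lambda>x. norm (f x * w x))" by (rule integrable_norm)
    show "AE x in lebesgue. norm (f x * mollify m \<phi> x) \<le> norm (f x * w x)" for m
    proof (rule AE_I2)
      fix x
      have "norm (mollify m \<phi> x) \<le> norm (w x)"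
      proof (cases "norm x \<le> R + real CARD('a)")
        case True
        then have "norm (w x) = \<bar>M\<bar>" by (simp add: w_def)
        then show ?thesis using mollify_bound(1)[where R = R, OF cont R M, where m = m and x = x] by simp
      next
        case False
        then show ?thesis using mollify_bound(2)[where R = R, OF cont R M, where m = m and x = x] by simp
      qed
      then show "norm (f x * mollify m \<phi> x) \<le> norm (f x * w x)"
        by (simp add: norm_mult mult_left_mono)
    qed
    show "AE x in lebesgue. (\<lambda>m. f x * mollify m \<phi> x) \<longlonglongrightarrow> f x * \<phi> x"
      by (intro AE_I2 tendsto_mult tendsto_const mollify_tendsto[OF cont R])
    show "(\<lambda>x. f x * \<phi> x) \<in> borel_measurable lebesgue"
        "\<And>m. (\<lambda>x. f x * mollify m \<phi> x) \<in> borel_measurable lebesgue"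
      by measurable
  qed
  have eq: "(LINT x|lebesgue. f x * mollify m (\<lambda>x. g x $ i) x) =
      - (LINT x|lebesgue. G x $ i * mollify m \<phi> x)" for m
    using weak_gradient_mollified[OF f \<phi> refl, where a = "- corner m" and b = "corner m" and i = i]
    by (simp add: mollify_def divide_inverse mult.assoc[symmetric])
  have "(\<lambda>m. LINT x|lebesgue. f x * mollify m (\<lambda>x. g x $ i) x) \<longlonglongrightarrow> (LINT x|lebesgue. f x * g x $ i)"
    by (rule lim[OF fL cont(2) Mi]) (use R in simp)
  moreover have "(\<lambda>m. LINT x|lebesgue. G x $ i * mollify m \<phi> x) \<longlonglongrightarrow> (LINT x|lebesgue. G x $ i * \<phi> x)"
    by (rule lim[OF GL cont(1) M(1)]) (use R in simp)
  ultimately show ?thesis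
    unfolding eq using tendsto_minus LIMSEQ_unique by blast
qed

section \<open>Uniqueness and calculus of weak gradients\<close>

text \<open>Bumps converge boundedly to indicator functions of boxes. Hence the integrals of \<open>f\<close>
  over all boxes vanish, and Lebesgue differentiation gives the claim.\<close>
lemma AE_eq_0_if_test_integrals_0:
  fixes f :: "real^'n \<Rightarrow> complex"
  assumes fL: "f \<in> L1_loc"
    and f0: "\<And>\<phi>. test_function \<phi> \<Longrightarrow> (LINT x|lebesgue. f x * of_real (\<phi> x)) = 0"
  shows "AE x in lebesgue. f x = 0"
proof -
  have box: "(LINT x|lebesgue. indicator (box a b) x *\<^sub>R f x) = 0" for a b :: "real^'n"
  proof -
    obtain R where R: "\<And>x. x \<in> box a b \<Longrightarrow> norm x \<le> R"
      using bounded_box[of a b] by (auto simp: bounded_iff)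
    have bm: "bump (real (Suc m)) a b \<in> borel_measurable lebesgue" for m
    proof -
      have "C1c_field (\<lambda>x. complex_of_real (bump (real (Suc m)) a b x))
          (\<lambda>x. \<chi> i. of_real (partial_deriv i (bump (real (Suc m)) a b) x))"
        by (rule C1c_field_bump) simp
      then have "continuous_on UNIV (\<lambda>x. Re (complex_of_real (bump (real (Suc m)) a b x)))"
        by (intro continuous_on_Re C1_field_continuous(1)) (auto simp: C1c_field_def)
      then have "(\<lambda>x. bump (real (Suc m)) a b x) \<in> borel_measurable borel"
        by (intro borel_measurable_continuous_onI) simp
      then show ?thesis by (auto intro: measurable_completion)
    qed
    note [measurable] = bm L1_loc_measurable[OF fL]
    have "(\<lambda>m. LINT x|lebesgue. f x * of_real (bump (real (Suc m)) a b x)) \<longlonglongrightarrow>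
        (LINT x|lebesgue. f x * of_real (indicator (box a b) x))"
    proof (rule integral_dominated_convergence)
      show "integrable lebesgue (\<lambda>x. norm (f x * of_real (indicator (box a b) x)))"
      proof (intro integrable_norm integrable_L1_loc_times_bounded[OF fL, of _ 1 "R + 1"])
        show "(\<lambda>x. complex_of_real (indicator (box a b) x)) \<in> borel_measurable lebesgue"
          by (intro measurable_compose[OF _ borel_measurable_of_real] borel_measurable_indicator) auto
      qed (auto simp: indicator_def dest: R)
      show "AE x in lebesgue. norm (f x * of_real (bump (real (Suc m)) a b x)) \<le>
          norm (f x * of_real (indicator (box a b) x))" for m
        using bump_le_1[of "real (Suc m)" a b] bump_nonneg[of "real (Suc m)" a b]
          bump_eq_0[of "real (Suc m)" _ a b]
        by (intro AE_I2) (auto simp: norm_mult indicator_def simp del: of_nat_Suc intro!: mult_left_le)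
      show "AE x in lebesgue. (\<lambda>m. f x * of_real (bump (real (Suc m)) a b x)) \<longlonglongrightarrow>
          f x * of_real (indicator (box a b) x)"
        by (intro AE_I2 tendsto_intros bump_tendsto_indicator)
      have "(\<lambda>x. complex_of_real (indicator (box a b) x)) \<in> borel_measurable lebesgue"
        by (intro measurable_compose[OF _ borel_measurable_of_real] borel_measurable_indicator) auto
      then show "(\<lambda>x. f x * complex_of_real (indicator (box a b) x)) \<in> borel_measurable lebesgue"
        by (intro borel_measurable_times) auto
      show "(\<lambda>x. f x * complex_of_real (bump (real (Suc m)) a b x)) \<in> borel_measurable lebesgue" for m
        by (intro borel_measurable_times measurable_compose[OF _ borel_measurable_of_real] bm) auto
    qed
    moreover have "(LINT x|lebesgue. f x * of_real (bump (real (Suc m)) a b x)) = 0" for m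
      by (rule f0[OF test_function_bump]) simp
    ultimately have "(LINT x|lebesgue. f x * of_real (indicator (box a b) x)) = 0"
      by (simp add: LIMSEQ_const_iff)
    then show ?thesis by (simp add: scaleR_conv_of_real mult.commute)
  qed
  have cb: "f absolutely_integrable_on cbox a b" for a b
    using fL by (auto simp: L1_loc_def)
  have cbox: "integral (cbox a b) f = 0" for a b :: "real^'n"
  proof -
    have "f absolutely_integrable_on box a b"
      by (rule set_integrable_subset[OF cb[of a b]]) (auto simp: box_subset_cbox)
    then have "integral (box a b) f = (LINT x:box a b|lebesgue. f x)"
      by (simp add: set_lebesgue_integral_eq_integral)
    also have "\<dots> = 0" using box by (simp add: set_lebesgue_integral_def)
    finally show ?thesis by (simp add: integral_open_interval)
  qed
  obtain N where N: "negligible N"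
    "\<And>x e. \<lbrakk>x \<notin> N; 0 < e\<rbrakk> \<Longrightarrow> \<exists>d>0. \<forall>h. 0 < h \<and> h < d \<longrightarrow>
        norm (integral (cbox x (x + h *\<^sub>R One)) f /\<^sub>R h ^ DIM(real^'n) - f x) < e"
    by (rule integrable_ccontinuous_explicit[of f])
      (use cb set_lebesgue_integral_eq_integral(1) in blast)+
  have "f x = 0" if xN: "x \<notin> N" for x
  proof (rule ccontr)
    assume "f x \<noteq> 0"
    then obtain d where d: "d > 0" "\<forall>h. 0 < h \<and> h < d \<longrightarrow>
        norm (integral (cbox x (x + h *\<^sub>R One)) f /\<^sub>R h ^ DIM(real^'n) - f x) < norm (f x)"
      using N(2)[OF xN, of "norm (f x)"] by auto
    then show False using cbox spec[OF d(2), of "d / 2"] by simp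
  qed
  moreover have "N \<in> null_sets lebesgue" using N(1) by (simp add: negligible_iff_null_sets)
  ultimately show ?thesis
    by (intro AE_I'[of N]) auto
qed

theorem has_weak_gradient_unique:
  assumes "has_weak_gradient f G" "has_weak_gradient f G'"
  shows "AE x in lebesgue. G x = G' x"
proof -
  have "AE x in lebesgue. G x $ i - G' x $ i = 0" for i
  proof (rule AE_eq_0_if_test_integrals_0)
    have L: "(\<lambda>x. G x $ i) \<in> L1_loc" "(\<lambda>x. G' x $ i) \<in> L1_loc"
      using assms L1_loc_component by (auto simp: has_weak_gradient_def)
    then show "(\<lambda>x. G x $ i - G' x $ i) \<in> L1_loc"
      by (auto simp: L1_loc_def intro: set_integral_diff)
    fix \<phi> :: "real^'a \<Rightarrow> real" assume \<phi>: "test_function \<phi>"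
    then have C: "C1c_field (\<lambda>x. complex_of_real (\<phi> x)) (\<lambda>x. \<chi> i. of_real (partial_deriv i \<phi> x))"
      by (rule C1c_field_test_function)
    obtain M where M: "\<And>x. norm (complex_of_real (\<phi> x)) \<le> M"
      using C1c_field_bounded[OF C] by metis
    obtain R where R: "\<And>x. R \<le> norm x \<Longrightarrow> complex_of_real (\<phi> x) = 0"
      using C by (auto simp: C1c_field_def)
    have "(\<lambda>x. complex_of_real (\<phi> x)) \<in> borel_measurable borel"
      using C by (intro borel_measurable_continuous_onI C1_field_continuous(1)) (auto simp: C1c_field_def)
    then have "(\<lambda>x. complex_of_real (\<phi> x)) \<in> borel_measurable lebesgue"
      by (auto intro: measurable_completion)
    then have "integrable lebesgue (\<lambda>x. G x $ i * of_real (\<phi> x))" "integrable lebesgue (\<lambda>x. G' x $ i * of_real (\<phi> x))"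
      by (intro integrable_L1_loc_times_bounded[OF L(1), of _ M R] integrable_L1_loc_times_bounded[OF L(2), of _ M R] M R; simp)+
    moreover have "(LINT x|lebesgue. G x $ i * of_real (\<phi> x)) = (LINT x|lebesgue. G' x $ i * of_real (\<phi> x))"
    proof -
      have "(LINT x|lebesgue. f x * of_real (partial_deriv i \<phi> x)) = - (LINT x|lebesgue. G x $ i * of_real (\<phi> x))"
        using assms(1) \<phi> unfolding has_weak_gradient_def by blast
      moreover have "(LINT x|lebesgue. f x * of_real (partial_deriv i \<phi> x)) = - (LINT x|lebesgue. G' x $ i * of_real (\<phi> x))"
        using assms(2) \<phi> unfolding has_weak_gradient_def by blast
      ultimately show ?thesis by simp
    qed
    ultimately show "(LINT x|lebesgue. (G x $ i - G' x $ i) * of_real (\<phi> x)) = 0"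
      by (simp add: left_diff_distrib)
  qed
  then have "AE x in lebesgue. \<forall>i\<in>UNIV. G x $ i - G' x $ i = 0"
    by (intro AE_finite_allI) auto
  then show ?thesis by eventually_elim (simp add: vec_eq_iff)
qed

lemma weak_gradient_AE:
  assumes "has_weak_gradient f G"
  shows "has_weak_gradient f (weak_gradient f)" "AE x in lebesgue. weak_gradient f x = G x"
proof -
  show 1: "has_weak_gradient f (weak_gradient f)"
    unfolding weak_gradient_def using someI_ex[of "has_weak_gradient f"] assms by blast
  show "AE x in lebesgue. weak_gradient f x = G x"
    using has_weak_gradient_unique[OF 1 assms] .
qed

lemma C1_field_borel:
  assumes "C1_field v g"
  shows "v \<in> borel_measurable lebesgue" "(\<lambda>x. g x $ i) \<in> borel_measurable lebesgue"
  using C1_field_continuous[OF assms]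
  by (auto intro!: measurable_completion borel_measurable_continuous_onI)

lemma L1_loc_times_continuous:
  fixes f :: "real^'n \<Rightarrow> complex"
  assumes "f \<in> L1_loc" "continuous_on UNIV v"
  shows "(\<lambda>x. f x * v x) \<in> L1_loc"
  unfolding L1_loc_iff_cball
proof (intro conjI allI)
  have [measurable]: "v \<in> borel_measurable lebesgue"
    using assms(2) by (auto intro!: measurable_completion borel_measurable_continuous_onI)
  note [measurable] = L1_loc_measurable[OF assms(1)]
  show "(\<lambda>x. f x * v x) \<in> borel_measurable lebesgue" by measurable
  fix R :: real
  have "bounded (v ` cball 0 R)"
    by (intro compact_imp_bounded compact_continuous_image continuous_on_subset[OF assms(2)]) auto
  then obtain M where "\<forall>x\<in>cball 0 R. norm (v x) \<le> M"
    by (auto simp: bounded_iff)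
  then have M: "\<And>x. norm x \<le> R \<Longrightarrow> norm (v x) \<le> M" by simp
  define w where "w x = (if norm x \<le> R then v x else 0)" for x
  have w: "w = (\<lambda>x. indicator (cball 0 R) x *\<^sub>R v x)" by (auto simp: w_def fun_eq_iff)
  have "integrable lebesgue (\<lambda>x. f x * w x)"
  proof (rule integrable_L1_loc_times_bounded[OF assms(1), of _ "\<bar>M\<bar>" "R + 1"])
    show "w \<in> borel_measurable lebesgue"
      unfolding w by (intro borel_measurable_scaleR borel_measurable_indicator) auto
    show "norm (w x) \<le> \<bar>M\<bar>" for x using M[of x] by (auto simp: w_def)
  qed (auto simp: w_def)
  then show "integrable lebesgue (\<lambda>x. indicator (cball 0 R) x *\<^sub>R (f x * v x))"
    by (simp add: w)
qed

lemma integrable_L1_loc_times_continuous: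
  fixes h k :: "real^'n \<Rightarrow> complex"
  assumes hL: "h \<in> L1_loc" and kc: "continuous_on UNIV k" and k0: "\<And>x. R \<le> norm x \<Longrightarrow> k x = 0"
  shows "integrable lebesgue (\<lambda>x. h x * k x)"
proof -
  have "bounded (k ` cball 0 R)"
    by (intro compact_imp_bounded compact_continuous_image continuous_on_subset[OF kc]) auto
  then obtain M where "\<forall>x\<in>cball 0 R. norm (k x) \<le> M"
    by (auto simp: bounded_iff)
  then have M: "\<And>x. norm x \<le> R \<Longrightarrow> norm (k x) \<le> M" by simp
  show ?thesis
  proof (rule integrable_L1_loc_times_bounded[OF hL _ _ k0])
    show "k \<in> borel_measurable lebesgue"
      using kc by (auto intro!: measurable_completion borel_measurable_continuous_onI)
    show "norm (k x) \<le> \<bar>M\<bar>" for x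
      using M[of x] k0[of x] by (cases "norm x \<le> R") auto
  qed
qed

lemma L1_loc_add:
  fixes f :: "real^'n \<Rightarrow> complex"
  shows "f \<in> L1_loc \<Longrightarrow> g \<in> L1_loc \<Longrightarrow> (\<lambda>x. f x + g x) \<in> L1_loc"
  by (auto simp: L1_loc_def)

text \<open>For a test function \<open>\<phi>\<close> the product \<open>v * \<phi>\<close> is only of class \<open>C^1\<close>; the extended class
  of test functions admits it.\<close>
theorem has_weak_gradient_mult_C1:
  assumes f: "has_weak_gradient f G" and v: "C1_field v Dv"
  shows "has_weak_gradient (\<lambda>x. f x * v x) (\<lambda>x. \<chi> i. G x $ i * v x + f x * Dv x $ i)"
  unfolding has_weak_gradient_def
proof (intro conjI allI impI)
  note cont = C1_field_continuous[OF v]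
  have fL: "f \<in> L1_loc" and GL: "(\<lambda>x. G x $ i) \<in> L1_loc" for i
    using f L1_loc_component by (auto simp: has_weak_gradient_def)
  show "(\<lambda>x. f x * v x) \<in> L1_loc"
    by (rule L1_loc_times_continuous[OF fL cont(1)])
  show "(\<lambda>x. \<chi> i. G x $ i * v x + f x * Dv x $ i) \<in> L1_loc"
    by (intro L1_loc_vec_lambda L1_loc_add L1_loc_times_continuous fL GL cont)
  fix \<phi> :: "real^'a \<Rightarrow> real" and i assume "test_function \<phi>"
  then have C: "C1c_field (\<lambda>x. complex_of_real (\<phi> x)) (\<lambda>x. \<chi> i. of_real (partial_deriv i \<phi> x))"
    by (rule C1c_field_test_function)
  obtain R where R: "\<And>x. R \<le> norm x \<Longrightarrow> complex_of_real (\<phi> x) = 0 \<and> (\<chi> i. complex_of_real (partial_deriv i \<phi> x)) = 0"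
    and C1: "C1_field (\<lambda>x. complex_of_real (\<phi> x)) (\<lambda>x. \<chi> i. of_real (partial_deriv i \<phi> x))"
    using C by (auto simp: C1c_field_def)
  have R': "\<phi> x = 0" "partial_deriv i \<phi> x = 0" if "R \<le> norm x" for x
    using R[OF that] by (auto simp: vec_eq_iff)
  have c\<phi>: "continuous_on UNIV (\<lambda>x. complex_of_real (\<phi> x))"
      "continuous_on UNIV (\<lambda>x. complex_of_real (partial_deriv i \<phi> x))"
    using C1_field_continuous(1)[OF C1] C1_field_continuous(2)[OF C1, of i] by simp_all
  note int = integrable_L1_loc_times_continuous[where R = R]
  have "(LINT x|lebesgue. f x * (v x * of_real (partial_deriv i \<phi> x) + Dv x $ i * of_real (\<phi> x))) =
      - (LINT x|lebesgue. G x $ i * (v x * of_real (\<phi> x)))"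
    using weak_gradient_C1c[OF f C1c_field_mult[OF v C], of i] by simp
  moreover have "(LINT x|lebesgue. f x * (v x * of_real (partial_deriv i \<phi> x) + Dv x $ i * of_real (\<phi> x))) =
      (LINT x|lebesgue. f x * v x * of_real (partial_deriv i \<phi> x)) + (LINT x|lebesgue. f x * Dv x $ i * of_real (\<phi> x))"
    using int[OF fL continuous_on_mult[OF cont(1) c\<phi>(2)]] int[OF fL continuous_on_mult[OF cont(2) c\<phi>(1)], of i] R'
    by (simp add: distrib_left mult.assoc)
  moreover have "(LINT x|lebesgue. (G x $ i * v x + f x * Dv x $ i) * of_real (\<phi> x)) =
      (LINT x|lebesgue. G x $ i * (v x * of_real (\<phi> x))) + (LINT x|lebesgue. f x * Dv x $ i * of_real (\<phi> x))"
    using int[OF GL continuous_on_mult[OF cont(1) c\<phi>(1)]] int[OF fL continuous_on_mult[OF cont(2) c\<phi>(1)], of i] R'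
    by (simp add: distrib_right mult.assoc)
  ultimately show "(LINT x|lebesgue. f x * v x * of_real (partial_deriv i \<phi> x)) =
      - (LINT x|lebesgue. (\<chi> i. G x $ i * v x + f x * Dv x $ i) $ i * of_real (\<phi> x))"
    by (simp add: algebra_simps eq_neg_iff_add_eq_0)
qed

lemma has_weak_gradient_const: "has_weak_gradient (\<lambda>x::real^'n. c) (\<lambda>x. 0)"
  unfolding has_weak_gradient_def
proof (intro conjI allI impI)
  have "integrable lborel (\<lambda>x. indicator (cball 0 R) x *\<^sub>R c)" for R :: real and c :: "'b::euclidean_space"
    by (rule borel_integrable_compact) auto
  then have "integrable lebesgue (\<lambda>x. indicator (cball 0 R) x *\<^sub>R c)" for R :: real and c :: "'b::euclidean_space"
    by (subst integrable_completion) (auto intro!: borel_measurable_scaleR borel_measurable_indicator)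
  then show "(\<lambda>x::real^'n. c) \<in> L1_loc" "(\<lambda>x::real^'n. 0 :: complex^'n) \<in> L1_loc"
    unfolding L1_loc_iff_cball by auto
  fix \<phi> :: "real^'n \<Rightarrow> real" and i assume "test_function \<phi>"
  then have C: "C1c_field (\<lambda>x. complex_of_real (\<phi> x)) (\<lambda>x. \<chi> i. of_real (partial_deriv i \<phi> x))"
    by (rule C1c_field_test_function)
  have "continuous_on UNIV (\<lambda>x. (\<chi> i. complex_of_real (partial_deriv i \<phi> x)) $ i)"
    using C by (intro C1_field_continuous(2)) (auto simp: C1c_field_def)
  then have "continuous_on UNIV (partial_deriv i \<phi>)" by simp
  then have [measurable]: "partial_deriv i \<phi> \<in> borel_measurable borel"
    by (rule borel_measurable_continuous_onI)
  have "(LINT x|lebesgue. complex_of_real (partial_deriv i \<phi> x)) = 0"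
    using integral_gradient_eq_0[OF C, of i] by (simp add: integral_completion)
  then have "(LINT x|lebesgue. c * complex_of_real (partial_deriv i \<phi> x)) = 0"
    by (subst integral_mult_right_zero) simp
  then show "(LINT x|lebesgue. c * complex_of_real (partial_deriv i \<phi> x)) =
        - (LINT x|lebesgue. (0 :: complex^'n) $ i * complex_of_real (\<phi> x))"
    by simp
qed

lemma has_weak_gradient_C1:
  assumes "C1_field v Dv" shows "has_weak_gradient v Dv"
  using has_weak_gradient_mult_C1[OF has_weak_gradient_const[of 1] assms] by simp

lemma L1_loc_translate:
  fixes f :: "real^'n \<Rightarrow> 'b::euclidean_space"
  assumes "f \<in> L1_loc" shows "(\<lambda>x. f (x + a)) \<in> L1_loc"
  unfolding L1_loc_iff_cball
proof (intro conjI allI)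
  note T = lborel_preserving_plus[of a]
  show m: "(\<lambda>x. f (x + a)) \<in> borel_measurable lebesgue"
    by (rule measurable_lborel_preserving[OF T L1_loc_measurable[OF assms]])
  fix R :: real
  have "integrable lebesgue (\<lambda>x. indicator (cball 0 (R + norm a)) (x + a) *\<^sub>R f (x + a))"
    using assms by (intro integrable_lborel_preserving[OF T, of "\<lambda>x. indicator (cball 0 (R + norm a)) x *\<^sub>R f x"])
      (auto simp: L1_loc_iff_cball)
  then show "integrable lebesgue (\<lambda>x. indicator (cball 0 R) x *\<^sub>R f (x + a))"
  proof (rule Bochner_Integration.integrable_bound)
    show "(\<lambda>x. indicator (cball 0 R) x *\<^sub>R f (x + a)) \<in> borel_measurable lebesgue"
      by (intro borel_measurable_scaleR borel_measurable_indicator m) auto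
    show "AE x in lebesgue. norm (indicator (cball 0 R) x *\<^sub>R f (x + a)) \<le>
        norm (indicator (cball 0 (R + norm a)) (x + a) *\<^sub>R f (x + a))"
    proof (rule AE_I2)
      fix x
      have "norm (x + a) \<le> norm x + norm a" by (rule norm_triangle_ineq)
      then show "norm (indicator (cball 0 R) x *\<^sub>R f (x + a)) \<le>
          norm (indicator (cball 0 (R + norm a)) (x + a) *\<^sub>R f (x + a))"
        by (auto simp: indicator_def)
    qed
  qed
qed

lemma has_weak_gradient_translate:
  assumes f: "has_weak_gradient f G"
  shows "has_weak_gradient (\<lambda>x. f (x + a)) (\<lambda>x. G (x + a))"
  unfolding has_weak_gradient_def
proof (intro conjI allI impI)
  have fL: "f \<in> L1_loc" and GL: "G \<in> L1_loc"
    using f by (auto simp: has_weak_gradient_def)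
  show "(\<lambda>x. f (x + a)) \<in> L1_loc" "(\<lambda>x. G (x + a)) \<in> L1_loc"
    using fL GL by (auto intro: L1_loc_translate)
  fix \<phi> :: "real^'a \<Rightarrow> real" and i assume "test_function \<phi>"
  then have "C1c_field (\<lambda>x. complex_of_real (\<phi> x)) (\<lambda>x. \<chi> i. of_real (partial_deriv i \<phi> x))"
    by (rule C1c_field_test_function)
  from C1c_field_translate[OF this, of "- a"]
  have C: "C1c_field (\<lambda>x. complex_of_real (\<phi> (x - a))) (\<lambda>x. \<chi> i. of_real (partial_deriv i \<phi> (x - a)))"
    by simp
  then have C1: "C1_field (\<lambda>x. complex_of_real (\<phi> (x - a))) (\<lambda>x. \<chi> i. of_real (partial_deriv i \<phi> (x - a)))"
    by (auto simp: C1c_field_def)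
  note [measurable] = C1_field_borel(1)[OF C1] C1_field_borel(2)[OF C1, of i, simplified]
    L1_loc_measurable[OF fL] L1_loc_measurable[OF L1_loc_component[OF GL, of i]]
  have "(LINT x|lebesgue. f (x + a) * of_real (partial_deriv i \<phi> ((x + a) - a))) =
      (LINT x|lebesgue. f x * of_real (partial_deriv i \<phi> (x - a)))"
    by (rule integral_lborel_preserving[OF lborel_preserving_plus]) measurable
  moreover have "(LINT x|lebesgue. G (x + a) $ i * of_real (\<phi> ((x + a) - a))) =
      (LINT x|lebesgue. G x $ i * of_real (\<phi> (x - a)))"
    by (rule integral_lborel_preserving[OF lborel_preserving_plus]) measurable
  ultimately show "(LINT x|lebesgue. f (x + a) * of_real (partial_deriv i \<phi> x)) =
      - (LINT x|lebesgue. G (x + a) $ i * of_real (\<phi> x))"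
    using weak_gradient_C1c[OF f C, of i] by simp
qed

lemma has_weak_gradient_cmult:
  assumes "has_weak_gradient f G"
  shows "has_weak_gradient (\<lambda>x. c * f x) (\<lambda>x. \<chi> i. c * G x $ i)"
  using has_weak_gradient_mult_C1[OF assms C1_field_const[of c]] by (simp add: mult.commute)

section \<open>The vortex profile\<close>

text \<open>If \<open>u\<close> were negative somewhere, its minimum would be attained in the interior, since \<open>u\<close>
  is nonnegative at both ends. There \<open>u' = 0\<close>, and as \<open>u'\<close> decreases strictly at this point,
  \<open>u\<close> would be smaller a little further to the right.\<close>
lemma minimum_principle:
  fixes u u' :: "real \<Rightarrow> real"
  assumes cont: "continuous_on {a..} u" and ua: "0 \<le> u a" and lim: "(u \<longlongrightarrow> l) at_top" "0 \<le> l"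
    and d1: "\<And>r. a < r \<Longrightarrow> (u has_real_derivative u' r) (at r)"
    and d2: "\<And>r. a < r \<Longrightarrow> u r < 0 \<Longrightarrow> u' r = 0 \<Longrightarrow> \<exists>d<0. (u' has_real_derivative d) (at r)"
    and r: "a \<le> r"
  shows "0 \<le> u r"
proof (rule ccontr)
  assume neg: "\<not> 0 \<le> u r"
  have "\<forall>\<^sub>F x in at_top. u r < u x"
    using lim neg by (intro order_tendstoD(1)) auto
  then obtain b where b: "\<And>x. b \<le> x \<Longrightarrow> u r < u x"
    by (auto simp: eventually_at_top_linorder)
  define c where "c = max (b + 1) (r + 1)"
  have "continuous_on {a..c} u" using cont by (rule continuous_on_subset) auto
  then obtain m where m: "m \<in> {a..c}" "\<And>x. x \<in> {a..c} \<Longrightarrow> u m \<le> u x"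
    using continuous_attains_inf[of "{a..c}" u] r by (force simp: c_def)
  have um: "u m \<le> u r" using m(2)[of r] r by (auto simp: c_def)
  moreover have "u r < u c" by (rule b) (simp add: c_def)
  ultimately have "m \<noteq> a" "m \<noteq> c" using ua neg by auto
  then have am: "a < m" "m < c" using m by auto
  have u'm: "u' m = 0"
  proof (rule DERIV_local_min[OF d1[OF am(1)]])
    show "0 < min (m - a) (c - m)" using am by simp
    show "\<forall>y. \<bar>m - y\<bar> < min (m - a) (c - m) \<longrightarrow> u m \<le> u y"
      using m(2) by (auto simp: abs_less_iff)
  qed
  obtain d where d: "d < 0" "(u' has_real_derivative d) (at m)"
    using d2[OF am(1) _ u'm] um neg by auto
  obtain e where e: "e > 0" "\<And>h. 0 < h \<Longrightarrow> h < e \<Longrightarrow> u' (m + h) < u' m"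
    using DERIV_neg_dec_right[OF d(2) d(1)] by auto
  define h where "h = min (e / 2) ((c - m) / 2)"
  have h: "0 < h" "h < e" "m + h < c" using e am by (auto simp: h_def min_def field_simps)
  have "u (m + h) < u m"
  proof (rule DERIV_neg_imp_decreasing_open[of m "m + h" u])
    show "continuous_on {m..m + h} u"
      using cont am by (auto intro: continuous_on_subset)
    show "\<exists>y. (u has_real_derivative y) (at x) \<and> y < 0" if "m < x" "x < m + h" for x
      using d1[of x] e(2)[of "x - m"] that am h u'm by auto
  qed (use h in auto)
  with m(2)[of "m + h"] h am show False by auto
qed

locale vortex_ode =
  fixes \<rho> \<rho>' \<rho>'' :: "real \<Rightarrow> real"
  assumes cont: "continuous_on {0..} \<rho>" and zero: "\<rho> 0 = 0" and lim: "(\<rho> \<longlongrightarrow> 1) at_top"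
    and D1: "\<And>r. r > 0 \<Longrightarrow> (\<rho> has_real_derivative \<rho>' r) (at r)"
    and D2: "\<And>r. r > 0 \<Longrightarrow> (\<rho>' has_real_derivative \<rho>'' r) (at r)"
    and ode: "\<And>r. r > 0 \<Longrightarrow> \<rho>'' r + \<rho>' r / r - \<rho> r / r\<^sup>2 + \<rho> r * (1 - (\<rho> r)\<^sup>2) = 0"
begin

text \<open>At a point with \<open>\<rho>' = 0\<close> and \<open>\<rho> > 1\<close> the equation gives \<open>\<rho>'' > 0\<close>, and it gives
  \<open>\<rho>'' < 0\<close> where \<open>\<rho>' = 0\<close> and \<open>\<rho> < -1\<close>. The minimum principle excludes both.\<close>
lemma abs_le_1:
  assumes "0 \<le> r" shows "\<bar>\<rho> r\<bar> \<le> 1"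
proof -
  have "0 \<le> 1 - \<rho> r"
  proof (rule minimum_principle[of 0 "\<lambda>r. 1 - \<rho> r" 0 "\<lambda>r. - \<rho>' r"])
    show "continuous_on {0..} (\<lambda>r. 1 - \<rho> r)" using cont by (intro continuous_intros)
    show "((\<lambda>r. 1 - \<rho> r) \<longlongrightarrow> 0) at_top" using tendsto_diff[OF tendsto_const[of 1] lim] by simp
    show "((\<lambda>r. 1 - \<rho> r) has_real_derivative - \<rho>' r) (at r)" if "0 < r" for r
      using D1[OF that] by (auto intro!: derivative_eq_intros)
    show "\<exists>d<0. ((\<lambda>r. - \<rho>' r) has_real_derivative d) (at r)"
      if "0 < r" "1 - \<rho> r < 0" "- \<rho>' r = 0" for r
    proof (intro exI conjI)
      show "((\<lambda>r. - \<rho>' r) has_real_derivative - \<rho>'' r) (at r)"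
        using D2[OF that(1)] by (auto intro!: derivative_eq_intros)
      have "1 < (\<rho> r)\<^sup>2" using that by (simp add: one_less_power)
      then have "\<rho> r * (1 - (\<rho> r)\<^sup>2) < 0" using that by (simp add: mult_pos_neg)
      moreover have "\<rho> r / r\<^sup>2 > 0" using that by simp
      moreover have "\<rho>'' r = \<rho> r / r\<^sup>2 - \<rho> r * (1 - (\<rho> r)\<^sup>2)"
        using ode[OF that(1)] that(3) by simp
      ultimately show "- \<rho>'' r < 0" by linarith
    qed
  qed (use zero assms in auto)
  moreover have "0 \<le> 1 + \<rho> r"
  proof (rule minimum_principle[of 0 "\<lambda>r. 1 + \<rho> r" 2 "\<lambda>r. \<rho>' r"])
    show "continuous_on {0..} (\<lambda>r. 1 + \<rho> r)" using cont by (intro continuous_intros)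
    show "((\<lambda>r. 1 + \<rho> r) \<longlongrightarrow> 2) at_top" using tendsto_add[OF tendsto_const[of 1] lim] by simp
    show "((\<lambda>r. 1 + \<rho> r) has_real_derivative \<rho>' r) (at r)" if "0 < r" for r
      using D1[OF that] by (auto intro!: derivative_eq_intros)
    show "\<exists>d<0. (\<rho>' has_real_derivative d) (at r)"
      if "0 < r" "1 + \<rho> r < 0" "\<rho>' r = 0" for r
    proof (intro exI conjI)
      show "(\<rho>' has_real_derivative \<rho>'' r) (at r)" using D2[OF that(1)] .
      have "1 < (- \<rho> r)\<^sup>2" using that by (intro one_less_power) auto
      then have "\<rho> r * (1 - (\<rho> r)\<^sup>2) > 0" using that by (simp add: mult_neg_neg)
      moreover have "\<rho> r / r\<^sup>2 < 0" using that by (simp add: divide_neg_pos)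
      moreover have "\<rho>'' r = \<rho> r / r\<^sup>2 - \<rho> r * (1 - (\<rho> r)\<^sup>2)"
        using ode[OF that(1)] that(3) by simp
      ultimately show "\<rho>'' r < 0" by linarith
    qed
  qed (use zero assms in auto)
  ultimately show ?thesis by simp
qed

text \<open>The function \<open>w = 1 - \<rho>\<close> satisfies \<open>w'' + w' / r - \<rho> (1 + \<rho>) w = - \<rho> / r^2\<close>. Where
  \<open>\<rho> > 1 / 2\<close>, the zeroth order term dominates, and \<open>A / r^2\<close> is a supersolution for large \<open>A\<close>
  and \<open>r\<close>.\<close>
lemma one_minus_le: "\<exists>C. \<forall>r\<ge>1. \<bar>1 - \<rho> r\<bar> \<le> C / r\<^sup>2"
proof -
  have "\<forall>\<^sub>F r in at_top. 1 / 2 < \<rho> r"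
    using lim by (rule order_tendstoD) simp
  then obtain b where b: "\<And>r. b \<le> r \<Longrightarrow> 1 / 2 < \<rho> r"
    by (auto simp: eventually_at_top_linorder)
  define R where "R = max 4 b"
  have R: "R \<ge> 4" "\<And>r. R \<le> r \<Longrightarrow> 1 / 2 < \<rho> r" using b by (auto simp: R_def)
  \<comment> \<open>At the left end point \<open>A / R\<^sup>2 = 2\<close> is at least \<open>1 - \<rho>\<close>, as \<open>|\<rho>| \<le> 1\<close>.\<close>
  define A where "A = 2 * R\<^sup>2"
  have A: "A \<ge> 2 * 4\<^sup>2" using R(1) unfolding A_def by (intro mult_left_mono power_mono) auto
  define u where "u r = A / r\<^sup>2 - (1 - \<rho> r)" for r
  define u' where "u' r = - 2 * A / r^3 + \<rho>' r" for r
  have main: "0 \<le> u r" if "R \<le> r" for r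
  proof (rule minimum_principle[of R u 0 u'])
    show "continuous_on {R..} u"
      unfolding u_def using cont R(1) by (intro continuous_intros) (auto intro: continuous_on_subset)
    have "A / R\<^sup>2 = 2" using R(1) by (simp add: A_def)
    then show "0 \<le> u R" using R(2)[of R] by (simp add: u_def)
    have "((\<lambda>r::real. A / r\<^sup>2) \<longlongrightarrow> 0) at_top"
      by (rule real_tendsto_divide_at_top[OF tendsto_const])
        (auto intro!: filterlim_pow_at_top filterlim_ident)
    from tendsto_diff[OF this tendsto_diff[OF tendsto_const[of 1] lim]]
    show "(u \<longlongrightarrow> 0) at_top" by (simp add: u_def[abs_def])
    fix r assume r: "R < r"
    then have r0: "r > 0" using R by simp
    show "(u has_real_derivative u' r) (at r)"
      unfolding u_def u'_def using D1[OF r0] r0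
      by (auto intro!: derivative_eq_intros simp: field_simps power2_eq_square power3_eq_cube)
    assume neg: "u r < 0" and u'0: "u' r = 0"
    show "\<exists>d<0. (u' has_real_derivative d) (at r)"
    proof (intro exI conjI)
      show "(u' has_real_derivative 6 * A / r^4 + \<rho>'' r) (at r)"
        unfolding u'_def using D2[OF r0] r0
        by (auto intro!: derivative_eq_intros simp: field_simps eval_nat_numeral)
      define w where "w = 1 - \<rho> r"
      have \<rho>r: "\<rho> r = 1 - w" by (simp add: w_def)
      have w: "A / r\<^sup>2 < w" using neg by (simp add: u_def w_def)
      have w2: "w < 1 / 2" using R(2)[of r] r by (simp add: w_def)
      have "0 < A / r\<^sup>2" using A r0 by simp
      then have w0: "0 < w" using w by linarith
      have \<rho>'r: "\<rho>' r = 2 * A / r^3" using u'0 by (simp add: u'_def)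
      have "\<rho>'' r = - (\<rho>' r / r) + \<rho> r / r\<^sup>2 - \<rho> r * (1 - (\<rho> r)\<^sup>2)" using ode[OF r0] by simp
      also have "\<rho>' r / r = 2 * A / r^4" using r0 by (simp add: \<rho>'r eval_nat_numeral)
      also have "\<rho> r * (1 - (\<rho> r)\<^sup>2) = w * ((1 - w) * (2 - w))"
        by (simp add: \<rho>r power2_eq_square algebra_simps)
      finally have e: "6 * A / r^4 + \<rho>'' r = 4 * A / r^4 + \<rho> r / r\<^sup>2 - w * ((1 - w) * (2 - w))"
        by simp
      have "3 / 4 \<le> (1 - w) * (2 - w)"
      proof -
        have "(1 / 2) * (3 / 2) \<le> (1 - w) * (2 - w)" using w2 w0 by (intro mult_mono) auto
        then show ?thesis by simp
      qed
      then have "w * (3 / 4) \<le> w * ((1 - w) * (2 - w))" using w0 by (intro mult_left_mono) auto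
      moreover have "A / r\<^sup>2 * (3 / 4) < w * (3 / 4)" using w by simp
      moreover have "\<rho> r / r\<^sup>2 \<le> 1 / r\<^sup>2" using w0 by (intro divide_right_mono) (auto simp: \<rho>r)
      moreover have "4 * A / r^4 \<le> A / r\<^sup>2 * (1 / 4)"
      proof -
        have "4 * 4 \<le> r * r" using r R(1) by (intro mult_mono) auto
        then have "A / r\<^sup>2 * (4 / r\<^sup>2) \<le> A / r\<^sup>2 * (1 / 4)"
          using A r0 by (intro mult_left_mono) (auto simp: field_simps power2_eq_square)
        then show ?thesis by (simp add: power_add[of r 2 2, simplified] mult.commute)
      qed
      moreover have "1 / r\<^sup>2 \<le> A / r\<^sup>2 * (1 / 4)"
        using A divide_right_mono[of 1 "A / 4" "r\<^sup>2"] by simp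
      moreover have "0 < A / r\<^sup>2" using A r0 by simp
      moreover have "p + s - z < 0" if "w * (3 / 4) \<le> z" "T * (3 / 4) < w * (3 / 4)" "s \<le> t"
          "p \<le> T * (1 / 4)" "t \<le> T * (1 / 4)" "0 < T" for p s z t T :: real
        using that by linarith
      ultimately show "6 * A / r^4 + \<rho>'' r < 0" unfolding e by blast
    qed
  qed (use that in auto)
  show ?thesis
  proof (intro exI allI impI)
    fix r :: real assume r: "1 \<le> r"
    have \<rho>1: "\<bar>\<rho> r\<bar> \<le> 1" using abs_le_1[of r] r by simp
    show "\<bar>1 - \<rho> r\<bar> \<le> A / r\<^sup>2"
    proof (cases "R \<le> r")
      case True
      then show ?thesis using main[OF True] \<rho>1 by (simp add: u_def)
    next
      case False
      then have "r\<^sup>2 \<le> R\<^sup>2" using r by (intro power_mono) auto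
      then have "2 \<le> A / r\<^sup>2" using r by (simp add: A_def field_simps)
      then show ?thesis using \<rho>1 by simp
    qed
  qed
qed

text \<open>By the decay of \<open>1 - \<rho>\<close> and the mean value theorem, \<open>\<rho>'\<close> is of order \<open>1 / r^2\<close> at some
  point \<open>\<xi>\<close> between \<open>r\<close> and \<open>r + 1\<close>. The equation bounds \<open>(r \<rho>')' = \<rho>' + r \<rho>''\<close> by
  \<open>O (1 / r)\<close>, and this carries the estimate from \<open>\<xi>\<close> to \<open>r\<close>.\<close>
lemma deriv_le: "\<exists>C. \<forall>r\<ge>1. \<bar>\<rho>' r\<bar> \<le> C / r\<^sup>2"
proof -
  obtain C where C: "\<And>r. r \<ge> 1 \<Longrightarrow> \<bar>1 - \<rho> r\<bar> \<le> C / r\<^sup>2" using one_minus_le by blast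
  have C0: "0 \<le> C" using C[of 1] by simp
  show ?thesis
  proof (intro exI allI impI)
    fix r :: real assume r: "1 \<le> r"
    obtain \<xi> where \<xi>: "r < \<xi>" "\<xi> < r + 1" "\<rho> (r + 1) - \<rho> r = (r + 1 - r) * \<rho>' \<xi>"
      using MVT2[of r "r + 1" \<rho> \<rho>'] D1 r by auto
    have "\<bar>\<rho>' \<xi>\<bar> \<le> \<bar>1 - \<rho> (r + 1)\<bar> + \<bar>1 - \<rho> r\<bar>" using \<xi>(3) by simp
    also have "\<dots> \<le> C / (r + 1)\<^sup>2 + C / r\<^sup>2" using C r by (intro add_mono) auto
    also have "C / (r + 1)\<^sup>2 \<le> C / r\<^sup>2" using C0 r by (intro divide_left_mono power_mono mult_pos_pos) auto
    finally have \<rho>'\<xi>: "\<bar>\<rho>' \<xi>\<bar> \<le> 2 * C / r\<^sup>2" by simp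
    have "\<exists>\<zeta>. r < \<zeta> \<and> \<zeta> < \<xi> \<and> \<xi> * \<rho>' \<xi> - r * \<rho>' r = (\<xi> - r) * (\<rho>' \<zeta> + \<zeta> * \<rho>'' \<zeta>)"
      by (rule MVT2[of r \<xi> "\<lambda>r. r * \<rho>' r" "\<lambda>r. \<rho>' r + r * \<rho>'' r"])
        (use \<xi> r in \<open>auto intro!: derivative_eq_intros D2\<close>)
    then obtain \<zeta> where \<zeta>: "r < \<zeta>" "\<zeta> < \<xi>" "\<xi> * \<rho>' \<xi> - r * \<rho>' r = (\<xi> - r) * (\<rho>' \<zeta> + \<zeta> * \<rho>'' \<zeta>)"
      by blast
    have \<zeta>1: "\<zeta> \<ge> 1" "\<zeta> > 0" using \<zeta> r by auto
    have \<rho>\<zeta>: "\<bar>\<rho> \<zeta>\<bar> \<le> 1" using abs_le_1 \<zeta>1 by simp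
    have "\<rho>' \<zeta> + \<zeta> * \<rho>'' \<zeta> = \<zeta> * (\<rho>'' \<zeta> + \<rho>' \<zeta> / \<zeta>)" using \<zeta>1 by (simp add: field_simps)
    also have "\<rho>'' \<zeta> + \<rho>' \<zeta> / \<zeta> = \<rho> \<zeta> / \<zeta>\<^sup>2 - \<rho> \<zeta> * (1 - (\<rho> \<zeta>)\<^sup>2)" using ode[OF \<zeta>1(2)] by simp
    also have "\<dots> = \<rho> \<zeta> / \<zeta>\<^sup>2 - \<rho> \<zeta> * (1 + \<rho> \<zeta>) * (1 - \<rho> \<zeta>)"
      by (simp add: power2_eq_square algebra_simps)
    finally have "\<bar>\<rho>' \<zeta> + \<zeta> * \<rho>'' \<zeta>\<bar> = \<zeta> * \<bar>\<rho> \<zeta> / \<zeta>\<^sup>2 - \<rho> \<zeta> * (1 + \<rho> \<zeta>) * (1 - \<rho> \<zeta>)\<bar>"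
      using \<zeta>1 by (simp add: abs_mult)
    also have "\<dots> \<le> \<zeta> * (1 / \<zeta>\<^sup>2 + 2 * (C / \<zeta>\<^sup>2))"
    proof (intro mult_left_mono)
      have "\<bar>\<rho> \<zeta> / \<zeta>\<^sup>2\<bar> \<le> 1 / \<zeta>\<^sup>2" using \<rho>\<zeta> by (simp add: abs_divide divide_right_mono)
      moreover have "\<bar>\<rho> \<zeta> * (1 + \<rho> \<zeta>) * (1 - \<rho> \<zeta>)\<bar> \<le> (1 * 2) * (C / \<zeta>\<^sup>2)"
        unfolding abs_mult using \<rho>\<zeta> C[OF \<zeta>1(1)] C0 by (intro mult_mono) auto
      ultimately show "\<bar>\<rho> \<zeta> / \<zeta>\<^sup>2 - \<rho> \<zeta> * (1 + \<rho> \<zeta>) * (1 - \<rho> \<zeta>)\<bar> \<le> 1 / \<zeta>\<^sup>2 + 2 * (C / \<zeta>\<^sup>2)"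
        by linarith
    qed (use \<zeta>1 in auto)
    also have "\<dots> = (1 + 2 * C) / \<zeta>" using \<zeta>1 by (simp add: field_simps power2_eq_square)
    also have "\<dots> \<le> (1 + 2 * C) / r" using C0 \<zeta> r by (intro divide_left_mono mult_pos_pos) auto
    finally have B: "\<bar>\<rho>' \<zeta> + \<zeta> * \<rho>'' \<zeta>\<bar> \<le> (1 + 2 * C) / r" .
    have "r * \<bar>\<rho>' r\<bar> = \<bar>r * \<rho>' r\<bar>" using r by (simp add: abs_mult)
    also have "\<dots> \<le> \<bar>\<xi> * \<rho>' \<xi>\<bar> + \<bar>(\<xi> - r) * (\<rho>' \<zeta> + \<zeta> * \<rho>'' \<zeta>)\<bar>" using \<zeta>(3) by linarith
    also have "\<dots> \<le> (2 * r) * (2 * C / r\<^sup>2) + 1 * ((1 + 2 * C) / r)"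
      unfolding abs_mult using \<xi> r B \<rho>'\<xi> C0 by (intro add_mono mult_mono) auto
    also have "\<dots> = (1 + 6 * C) / r" using r by (simp add: field_simps power2_eq_square)
    finally show "\<bar>\<rho>' r\<bar> \<le> (1 + 6 * C) / r\<^sup>2" using r by (simp add: field_simps power2_eq_square)
  qed
qed

text \<open>The equation reads \<open>((r \<rho>)' / r)' = - \<rho> (1 - \<rho>^2)\<close>, so \<open>k = (r \<rho>)' / r\<close> is Lipschitz
  continuous and has a limit \<open>l\<close> at 0. Integrating \<open>(r \<rho>)' = r k\<close> from 0 yields
  \<open>\<rho> / r \<rightarrow> l / 2\<close>; continuity at 0 excludes the singular solutions of order \<open>1 / r\<close>.\<close>
lemma limits_at_0: "\<exists>c. ((\<lambda>r. \<rho> r / r) \<longlongrightarrow> c) (at_right 0) \<and> (\<rho>' \<longlongrightarrow> c) (at_right 0)"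
proof -
  define k where "k r = \<rho>' r + \<rho> r / r" for r
  have Dk: "(k has_real_derivative - (\<rho> r * (1 - (\<rho> r)\<^sup>2))) (at r)" if "r > 0" for r
  proof -
    have "(k has_real_derivative \<rho>'' r + (\<rho>' r * r - \<rho> r) / (r * r)) (at r)"
      unfolding k_def using that D1[OF that] D2[OF that] by (auto intro!: derivative_eq_intros)
    moreover have "(\<rho>' r * r - \<rho> r) / (r * r) = \<rho>' r / r - \<rho> r / r\<^sup>2"
      using that by (simp add: field_simps power2_eq_square)
    moreover have "\<rho>'' r + (\<rho>' r / r - \<rho> r / r\<^sup>2) = - (\<rho> r * (1 - (\<rho> r)\<^sup>2))"
      using ode[OF that] by linarith
    ultimately show ?thesis by (simp only:)
  qed
  have lip: "\<bar>k r - k s\<bar> \<le> \<bar>r - s\<bar>" if "r > 0" "s > 0" for r s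
  proof -
    have "\<bar>k r - k s\<bar> \<le> 1 * \<bar>r - s\<bar>"
    proof (rule field_differentiable_bound[of "{0<..}" k "\<lambda>r. - (\<rho> r * (1 - (\<rho> r)\<^sup>2))" 1, simplified real_norm_def])
      show "(k has_field_derivative - (\<rho> z * (1 - (\<rho> z)\<^sup>2))) (at z within {0<..})" if "z \<in> {0<..}" for z
        using Dk[of z] that by (auto intro: has_field_derivative_at_within)
      show "\<bar>- (\<rho> z * (1 - (\<rho> z)\<^sup>2))\<bar> \<le> 1" if "z \<in> {0<..}" for z
      proof -
        have "\<bar>\<rho> z\<bar> \<le> 1" using that abs_le_1[of z] by simp
        moreover have "(\<rho> z)\<^sup>2 \<le> 1" using calculation by (simp add: abs_square_le_1)
        ultimately have "\<bar>\<rho> z\<bar> * \<bar>1 - (\<rho> z)\<^sup>2\<bar> \<le> 1 * 1" by (intro mult_mono) auto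
        then show ?thesis by (simp add: abs_mult)
      qed
    qed (use that in auto)
    then show ?thesis by simp
  qed
  have "uniformly_continuous_on {0<..1::real} k"
    unfolding uniformly_continuous_on_def
  proof (intro allI impI)
    fix e :: real assume "0 < e"
    then show "\<exists>d>0. \<forall>x\<in>{0<..1}. \<forall>x'\<in>{0<..1}. dist x' x < d \<longrightarrow> dist (k x') (k x) < e"
      by (intro exI[of _ e]) (auto simp: dist_real_def intro!: le_less_trans[OF lip])
  qed
  then obtain l where l: "(k \<longlongrightarrow> l) (at 0 within {0<..1})"
    by (rule uniformly_continuous_on_extension_at_closure[of _ k 0]) (auto simp: closure_greaterThanAtMost)
  have "at 0 within {0<..1::real} = at_right 0"
    by (rule at_within_nhd[of _ "{..<1}"]) auto
  with l have l: "(k \<longlongrightarrow> l) (at_right 0)" by simp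
  have kl: "\<bar>k r - l\<bar> \<le> r" if "r > 0" for r
  proof (rule tendsto_le[of "at_right 0"])
    show "((\<lambda>s. \<bar>k r - k s\<bar>) \<longlongrightarrow> \<bar>k r - l\<bar>) (at_right 0)" by (intro tendsto_intros l)
    show "((\<lambda>s. \<bar>r - s\<bar>) \<longlongrightarrow> r) (at_right 0)"
      using that by (auto intro!: tendsto_eq_intros)
    show "\<forall>\<^sub>F s in at_right 0. \<bar>k r - k s\<bar> \<le> \<bar>r - s\<bar>"
      using eventually_at_right_less[of 0] by eventually_elim (use lip that in auto)
  qed simp
  have est: "\<bar>\<rho> r / r - l / 2\<bar> \<le> r" if r: "r > 0" for r
  proof -
    \<comment> \<open>\<open>F' s = s (k s - l)\<close> is of order \<open>s\<^sup>2\<close>, so that \<open>F\<close> is of order \<open>s\<^sup>3\<close>.\<close>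
    define F where "F s = s * \<rho> s - l * s\<^sup>2 / 2" for s
    have contF: "continuous_on {0..r} F"
      unfolding F_def by (intro continuous_intros continuous_on_subset[OF cont]) auto
    have DF: "(F has_real_derivative s * (k s - l)) (at s)" if "s > 0" for s
      unfolding F_def k_def using that D1[OF that]
      by (auto intro!: derivative_eq_intros simp: field_simps)
    obtain d z where z: "0 < z" "z < r" "(F has_real_derivative d) (at z)" "F r - F 0 = (r - 0) * d"
      using MVT[of 0 r F] contF DF r by (auto simp: real_differentiable_def)
    have "d = z * (k z - l)" using DERIV_unique[OF z(3) DF[OF z(1)]] by simp
    then have "\<bar>F r\<bar> = r * (z * \<bar>k z - l\<bar>)" using z that by (simp add: F_def abs_mult)
    also have "\<dots> \<le> r * (r * r)" using kl[OF z(1)] z that by (intro mult_left_mono mult_mono) auto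
    finally have "\<bar>F r\<bar> / r\<^sup>2 \<le> r" using that by (simp add: field_simps power2_eq_square)
    moreover have "\<bar>\<rho> r / r - l / 2\<bar> = \<bar>F r\<bar> / r\<^sup>2"
    proof -
      have "\<rho> r / r - l / 2 = F r / r\<^sup>2" using that by (simp add: F_def field_simps power2_eq_square)
      then show ?thesis by (simp add: abs_divide)
    qed
    ultimately show ?thesis by simp
  qed
  have lim1: "((\<lambda>r. \<rho> r / r) \<longlongrightarrow> l / 2) (at_right 0)"
  proof (rule LIM_zero_cancel, rule Lim_null_comparison)
    show "\<forall>\<^sub>F r in at_right 0. norm (\<rho> r / r - l / 2) \<le> r"
      using eventually_at_right_less[of 0] by eventually_elim (use est in auto)
    show "((\<lambda>r. r) \<longlongrightarrow> 0) (at_right (0::real))" by (auto intro!: tendsto_eq_intros)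
  qed
  have "((\<lambda>r. k r - \<rho> r / r) \<longlongrightarrow> l - l / 2) (at_right 0)"
    by (intro tendsto_diff l lim1)
  then have "(\<rho>' \<longlongrightarrow> l / 2) (at_right 0)" by (simp add: k_def)
  with lim1 show ?thesis by blast
qed

end

section \<open>The vortex as a map of class \<open>C^1\<close>\<close>

text \<open>This is the order of decay of \<open>|grad V|^2\<close> and of \<open>1 - |V|^2\<close>. It is not integrable on
  the plane, but its square is.\<close>
definition weight :: "real^2 \<Rightarrow> real" where
  "weight x = 1 / (1 + (norm x)\<^sup>2)"

lemma weight_pos: "0 < weight x" and weight_le_1: "weight x \<le> 1"
  by (auto simp: weight_def add_pos_nonneg)

lemma continuous_on_weight: "continuous_on UNIV weight"
proof -
  have "1 + (norm x)\<^sup>2 \<noteq> 0" for x :: "real^2"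
    using zero_le_power2[of "norm x"] by linarith
  then show ?thesis unfolding weight_def by (auto intro!: continuous_intros)
qed

lemma inverse_norm_sq_le_weight: "1 \<le> norm x \<Longrightarrow> 1 / (norm x)\<^sup>2 \<le> 2 * weight x"
proof -
  assume "1 \<le> norm x"
  then have "1 \<le> (norm x)\<^sup>2" by simp
  moreover have "1 / s \<le> 2 * (1 / (1 + s))" if "1 \<le> s" for s :: real
    using that by (simp add: field_simps)
  ultimately show ?thesis unfolding weight_def by blast
qed

text \<open>By compactness an estimate between continuous functions has to be checked only far out.\<close>
lemma bounded_by_continuous:
  fixes f g :: "real^'n \<Rightarrow> real"
  assumes f: "continuous_on UNIV f" and g: "continuous_on UNIV g" "\<And>x. 0 < g x"
    and far: "\<And>x. R \<le> norm x \<Longrightarrow> f x \<le> C * g x"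
  shows "\<exists>C. \<forall>x. f x \<le> C * g x"
proof -
  have "g x \<noteq> 0" for x using g(2)[of x] by simp
  then have "continuous_on UNIV (\<lambda>x. f x / g x)"
    using f g by (intro continuous_on_divide) auto
  then have "bounded ((\<lambda>x. f x / g x) ` cball 0 R)"
    by (intro compact_imp_bounded compact_continuous_image) (auto intro: continuous_on_subset)
  then obtain M where M: "\<forall>x\<in>cball 0 R. norm (f x / g x) \<le> M"
    by (auto simp: bounded_iff)
  have "f x \<le> max C M * g x" for x
  proof (cases "R \<le> norm x")
    case True
    have "C * g x \<le> max C M * g x" using g(2)[of x] by (intro mult_right_mono) auto
    then show ?thesis using far[OF True] by simp
  next
    case False
    then have "\<bar>f x / g x\<bar> \<le> M" using M by auto
    then have "f x / g x \<le> M" by linarith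
    then have "f x \<le> M * g x" using g(2)[of x] by (simp add: divide_le_eq)
    also have "\<dots> \<le> max C M * g x" using g(2)[of x] by (intro mult_right_mono) auto
    finally show ?thesis .
  qed
  then show ?thesis by blast
qed

definition to_complex :: "real^2 \<Rightarrow> complex" where
  "to_complex x = Complex (x $ 1) (x $ 2)"

text \<open>The velocity of the rotation flow at \<open>x\<close>; the gradient of the polar angle is
  \<open>perp x / |x|^2\<close>.\<close>
definition perp :: "real^2 \<Rightarrow> real^2" where
  "perp x = vector [- x $ 2, x $ 1]"

lemma perp_simps [simp]: "perp x $ 1 = - x $ 2" "perp x $ 2 = x $ 1"
  by (simp_all add: perp_def)

lemma norm_sq_2: "(norm (x :: real^2))\<^sup>2 = (x $ 1)\<^sup>2 + (x $ 2)\<^sup>2"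
  by (simp add: norm_vec_def L2_set_def sum_2)

lemma norm_sq_2_complex: "(norm (x :: complex^2))\<^sup>2 = (norm (x $ 1))\<^sup>2 + (norm (x $ 2))\<^sup>2"
  by (simp add: norm_vec_def L2_set_def sum_2)

lemma norm_to_complex [simp]: "norm (to_complex x) = norm x"
  by (simp add: to_complex_def complex_norm norm_vec_def L2_set_def sum_2)

lemma to_complex_eq_0_iff [simp]: "to_complex x = 0 \<longleftrightarrow> x = 0"
  using norm_to_complex[of x] by (metis norm_eq_zero)

lemma to_complex_add: "to_complex (x + y) = to_complex x + to_complex y"
  by (simp add: to_complex_def complex_eq_iff)

lemma bounded_linear_to_complex: "bounded_linear to_complex"
  by (intro bounded_linear_intro[of _ 1]) (auto simp: to_complex_add, simp add: to_complex_def complex_eq_iff)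

lemma abs_perp_le: "\<bar>perp x $ i\<bar> \<le> norm x"
  using component_le_norm_cart[of x 1] component_le_norm_cart[of x 2] exhaust_2[of i] by auto

context vortex_ode
begin

lemma vortex_eq: "vortex \<rho> x = of_real (\<rho> (norm x) / norm x) * to_complex x"
proof (cases "x = 0")
  case False
  then have "cis (Arg (to_complex x)) = sgn (to_complex x)" by (simp add: cis_Arg)
  then show ?thesis
    by (simp add: vortex_def to_complex_def[symmetric] sgn_div_norm scaleR_conv_of_real divide_inverse)
qed (simp add: vortex_def zero)

lemma norm_vortex: "norm (vortex \<rho> x) = \<bar>\<rho> (norm x)\<bar>"
  by (simp add: vortex_def norm_mult)

text \<open>The derivative of the profile at 0.\<close>
definition slope :: real where
  "slope = (SOME c. ((\<lambda>r. \<rho> r / r) \<longlongrightarrow> c) (at_right 0) \<and> (\<rho>' \<longlongrightarrow> c) (at_right 0))"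

lemma slope_limits: "((\<lambda>r. \<rho> r / r) \<longlongrightarrow> slope) (at_right 0)" "(\<rho>' \<longlongrightarrow> slope) (at_right 0)"
  using someI_ex[OF limits_at_0] unfolding slope_def by auto

text \<open>The sum of a radial part \<open>\<rho>'\<close> and an angular part \<open>\<i> V grad \<theta>\<close>; the value at 0 is the
  gradient of \<open>slope * (x\<^sub>1 + \<i> x\<^sub>2)\<close>.\<close>
definition vortex_grad :: "real^2 \<Rightarrow> complex^2" where
  "vortex_grad x = (\<chi> i. if x = 0 then of_real slope * (if i = 1 then 1 else \<i>)
     else of_real (\<rho>' (norm x) * x $ i / (norm x)\<^sup>2) * to_complex x
       + \<i> * of_real (perp x $ i / (norm x)\<^sup>2) * vortex \<rho> x)"

text \<open>In this form the singularity of the angular part at the origin is absorbed by the bounded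
  factor \<open>\<rho> / r\<close>.\<close>
lemma angular_part:
  assumes "x \<noteq> 0"
  shows "\<i> * of_real (perp x $ i / (norm x)\<^sup>2) * vortex \<rho> x =
    of_real (\<rho> (norm x) / norm x) * ((if i = 1 then 1 else \<i>) - of_real (x $ i / (norm x)\<^sup>2) * to_complex x)"
proof -
  have n0: "(norm x)\<^sup>2 \<noteq> 0" using assms by simp
  have "\<i> * of_real (perp x $ i) * to_complex x =
      of_real ((norm x)\<^sup>2) * (if i = 1 then 1 else \<i>) - of_real (x $ i) * to_complex x"
    using exhaust_2[of i] norm_sq_2[of x] by (auto simp: to_complex_def complex_eq_iff power2_eq_square algebra_simps)
  then have "\<i> * of_real (perp x $ i / (norm x)\<^sup>2) * to_complex x =
      (if i = 1 then 1 else \<i>) - of_real (x $ i / (norm x)\<^sup>2) * to_complex x"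
    using n0 by (simp add: field_simps del: of_real_power)
  then show ?thesis unfolding vortex_eq by (simp only: mult_ac) (metis mult.left_commute)
qed

lemma norm_vortex_grad_minus_le:
  assumes "x \<noteq> 0"
  shows "norm (vortex_grad x $ i - of_real slope * (if i = 1 then 1 else \<i>)) \<le>
    \<bar>\<rho>' (norm x) - slope\<bar> + 2 * \<bar>\<rho> (norm x) / norm x - slope\<bar>"
proof -
  define q where "q = of_real (x $ i / (norm x)\<^sup>2) * to_complex x"
  define u :: complex where "u = (if i = 1 then 1 else \<i>)"
  have q: "norm q \<le> 1"
  proof -
    have "norm q = \<bar>x $ i\<bar> / norm x" using assms by (simp add: q_def norm_mult norm_divide power2_eq_square abs_divide)
    then show ?thesis using component_le_norm_cart[of x i] assms by (simp add: divide_le_eq_1)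
  qed
  have "vortex_grad x $ i - of_real slope * u =
      of_real (\<rho>' (norm x)) * q + of_real (\<rho> (norm x) / norm x) * (u - q) - of_real slope * u"
    using assms angular_part[OF assms, of i] by (simp add: vortex_grad_def q_def u_def mult.assoc)
  also have "\<dots> = of_real (\<rho>' (norm x) - slope) * q + of_real (\<rho> (norm x) / norm x - slope) * (u - q)"
    by (simp add: algebra_simps)
  also have "norm \<dots> \<le> \<bar>\<rho>' (norm x) - slope\<bar> * norm q + \<bar>\<rho> (norm x) / norm x - slope\<bar> * norm (u - q)"
    by (rule order_trans[OF norm_triangle_ineq]) (simp add: norm_mult del: of_real_diff)
  also have "\<dots> \<le> \<bar>\<rho>' (norm x) - slope\<bar> * 1 + \<bar>\<rho> (norm x) / norm x - slope\<bar> * 2"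
  proof (intro add_mono mult_left_mono)
    have "norm u = 1" by (simp add: u_def)
    then show "norm (u - q) \<le> 2" using norm_triangle_ineq4[of u q] q by simp
  qed (use q in auto)
  finally show ?thesis by (simp add: u_def)
qed

lemma norm_at_0_at_right: "filterlim norm (at_right 0) (at (0 :: real^2))"
  unfolding filterlim_at
proof
  show "\<forall>\<^sub>F x in at (0 :: real^2). norm x \<in> {0<..} \<and> norm x \<noteq> 0"
    by (auto simp: eventually_at_filter)
  show "(norm \<longlongrightarrow> 0) (at (0 :: real^2))"
    using tendsto_norm[OF tendsto_ident_at[of 0 UNIV]] by simp
qed

lemma continuous_vortex_grad: "continuous_on UNIV vortex_grad"
proof -
  have "continuous_on UNIV (\<lambda>x. vortex_grad x $ i)" for i
    unfolding continuous_on_eq_continuous_at[OF open_UNIV]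
  proof
    fix x :: "real^2"
    show "isCont (\<lambda>x. vortex_grad x $ i) x"
    proof (cases "x = 0")
      case True
      have "((\<lambda>x. \<bar>\<rho>' (norm x) - slope\<bar> + 2 * \<bar>\<rho> (norm x) / norm x - slope\<bar>) \<longlongrightarrow> \<bar>slope - slope\<bar> + 2 * \<bar>slope - slope\<bar>) (at (0 :: real^2))"
        by (intro tendsto_intros filterlim_compose[OF slope_limits(1) norm_at_0_at_right]
            filterlim_compose[OF slope_limits(2) norm_at_0_at_right])
      then have lim: "((\<lambda>x. \<bar>\<rho>' (norm x) - slope\<bar> + 2 * \<bar>\<rho> (norm x) / norm x - slope\<bar>) \<longlongrightarrow> 0) (at (0 :: real^2))"
        by simp
      have "\<forall>\<^sub>F x in at 0. norm (vortex_grad x $ i - of_real slope * (if i = 1 then 1 else \<i>)) \<le>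
          \<bar>\<rho>' (norm x) - slope\<bar> + 2 * \<bar>\<rho> (norm x) / norm x - slope\<bar>"
        unfolding eventually_at_filter by (intro always_eventually allI impI norm_vortex_grad_minus_le)
      from Lim_null_comparison[OF this lim]
      have "((\<lambda>x. vortex_grad x $ i - of_real slope * (if i = 1 then 1 else \<i>)) \<longlongrightarrow> 0) (at 0)" .
      then have "((\<lambda>x. vortex_grad x $ i) \<longlongrightarrow> of_real slope * (if i = 1 then 1 else \<i>)) (at 0)"
        by (rule LIM_zero_cancel)
      then show ?thesis using True by (simp add: isCont_def vortex_grad_def)
    next
      case False
      have c1: "isCont (\<lambda>x. \<rho>' (norm x)) x" "isCont (\<lambda>x. \<rho> (norm x)) x"
      proof -
        have n: "isCont norm x" by (rule isCont_norm[OF continuous_ident])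
        show "isCont (\<lambda>x. \<rho>' (norm x)) x"
          by (rule isCont_o2[OF n DERIV_isCont[OF D2]]) (use False in simp)
        show "isCont (\<lambda>x. \<rho> (norm x)) x"
          by (rule isCont_o2[OF n DERIV_isCont[OF D1]]) (use False in simp)
      qed
      have c2: "isCont to_complex x"
        by (rule linear_continuous_at[OF bounded_linear_to_complex])
      have "isCont (\<lambda>x. of_real (\<rho>' (norm x) * x $ i / (norm x)\<^sup>2) * to_complex x + of_real (\<rho> (norm x) / norm x) * ((if i = 1 then 1 else \<i>) - of_real (x $ i / (norm x)\<^sup>2) * to_complex x)) x"
        using False by (intro continuous_intros c1 c2) auto
      moreover have "\<forall>\<^sub>F y in nhds x. vortex_grad y $ i = of_real (\<rho>' (norm y) * y $ i / (norm y)\<^sup>2) * to_complex y + of_real (\<rho> (norm y) / norm y) * ((if i = 1 then 1 else \<i>) - of_real (y $ i / (norm y)\<^sup>2) * to_complex y)"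
        unfolding eventually_nhds using False
        by (intro exI[of _ "- {0}"]) (auto simp: vortex_grad_def angular_part simp del: of_real_divide of_real_mult)
      ultimately show ?thesis
        by (subst isCont_cong)
    qed
  qed
  then have "continuous_on UNIV (\<lambda>x. \<chi> i. vortex_grad x $ i)"
    by (rule continuous_on_vec_lambda)
  then show ?thesis by simp
qed

lemma has_derivative_vortex:
  "(vortex \<rho> has_derivative (\<lambda>h. \<Sum>i\<in>UNIV. h $ i *\<^sub>R vortex_grad x $ i)) (at x)"
proof (cases "x = 0")
  case True
  have D: "(\<lambda>h. \<Sum>i\<in>UNIV. h $ i *\<^sub>R vortex_grad x $ i) = (\<lambda>h. of_real slope * to_complex h)"
    using True by (auto simp: fun_eq_iff vortex_grad_def sum_2 to_complex_def complex_eq_iff)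
  have "((\<lambda>h. \<bar>\<rho> (norm h) / norm h - slope\<bar>) \<longlongrightarrow> \<bar>slope - slope\<bar>) (at (0 :: real^2))"
    by (intro tendsto_intros filterlim_compose[OF slope_limits(1) norm_at_0_at_right])
  then have "((\<lambda>h. \<bar>\<rho> (norm h) / norm h - slope\<bar>) \<longlongrightarrow> 0) (at (0 :: real^2))" by simp
  then have "((\<lambda>h. norm (vortex \<rho> (0 + h) - vortex \<rho> 0 - of_real slope * to_complex h) / norm h) \<longlongrightarrow> 0) (at 0)"
  proof (rule Lim_transform_eventually)
    have "\<bar>\<rho> (norm h) / norm h - slope\<bar> = norm (vortex \<rho> (0 + h) - vortex \<rho> 0 - of_real slope * to_complex h) / norm h"
      if "h \<noteq> 0" for h :: "real^2"
    proof -
      have v0: "vortex \<rho> 0 = 0" by (simp add: vortex_def zero)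
      have "vortex \<rho> h - of_real slope * to_complex h = of_real (\<rho> (norm h) / norm h - slope) * to_complex h"
        unfolding vortex_eq by (simp add: algebra_simps)
      then have "norm (vortex \<rho> h - of_real slope * to_complex h) = \<bar>\<rho> (norm h) / norm h - slope\<bar> * norm h"
        by (simp only: norm_mult norm_of_real norm_to_complex)
      then show ?thesis using that v0 by simp
    qed
    then show "\<forall>\<^sub>F h in at 0. \<bar>\<rho> (norm h) / norm h - slope\<bar> =
        norm (vortex \<rho> (0 + h) - vortex \<rho> 0 - of_real slope * to_complex h) / norm h"
      by (auto simp: eventually_at_filter)
  qed
  moreover have "bounded_linear (\<lambda>h. of_real slope * to_complex h)"
    by (intro bounded_linear_const_mult bounded_linear_to_complex)
  ultimately show ?thesis unfolding D using True by (simp add: has_derivative_at)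
next
  case False
  define r where "r = norm x"
  have r: "r > 0" using False by (simp add: r_def)
  define f' where "f' = (\<rho>' r * r - \<rho> r) / (r * r)"
  have "((\<lambda>r. \<rho> r / r) has_real_derivative f') (at r)"
    unfolding f'_def using D1[OF r] r by (auto intro!: derivative_eq_intros)
  then have "((\<lambda>r. \<rho> r / r) has_derivative (\<lambda>h. f' * h)) (at (norm x))"
    by (simp add: has_field_derivative_def r_def)
  from has_derivative_compose[OF has_derivative_norm[OF False] this]
  have "((\<lambda>x. \<rho> (norm x) / norm x) has_derivative (\<lambda>h. f' * (h \<bullet> sgn x))) (at x)"
    by (simp add: inner_commute)
  from has_derivative_mult[OF has_derivative_of_real[OF this] bounded_linear.has_derivative[OF bounded_linear_to_complex has_derivative_ident]]
  have "(vortex \<rho> has_derivative (\<lambda>h. of_real (\<rho> r / r) * to_complex h + of_real (f' * (h \<bullet> sgn x)) * to_complex x)) (at x)"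
    unfolding vortex_eq[abs_def] by (simp add: r_def)
  moreover have "of_real (\<rho> r / r) * to_complex h + of_real (f' * (h \<bullet> sgn x)) * to_complex x =
      (\<Sum>i\<in>UNIV. h $ i *\<^sub>R vortex_grad x $ i)" for h
  proof -
    define s where "s = x $ 1 * h $ 1 + x $ 2 * h $ 2"
    have sgn: "h \<bullet> sgn x = s / r"
      using r by (simp add: inner_vec_def sum_2 sgn_div_norm r_def s_def field_simps)
    have f's: "f' * (s / r) = \<rho>' r * s / r\<^sup>2 - (\<rho> r / r) * (s / r\<^sup>2)"
      using r by (simp add: f'_def field_simps power2_eq_square)
    have g: "vortex_grad x $ i = of_real (\<rho>' r / r\<^sup>2) * of_real (x $ i) * to_complex x +
        of_real (\<rho> r / r) * ((if i = 1 then 1 else \<i>) - of_real (x $ i) * of_real (1 / r\<^sup>2) * to_complex x)" for i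
      using False angular_part[OF False, of i] by (simp add: vortex_grad_def r_def)
    have hc: "to_complex h = of_real (h $ 1) + of_real (h $ 2) * \<i>"
      by (simp add: to_complex_def complex_eq_iff)
    have "(\<Sum>i\<in>UNIV. h $ i *\<^sub>R vortex_grad x $ i) =
      of_real (\<rho>' r / r\<^sup>2) * of_real s * to_complex x + of_real (\<rho> r / r) * (to_complex h - of_real s * of_real (1 / r\<^sup>2) * to_complex x)"
      unfolding g sum_2 hc s_def scaleR_conv_of_real by (simp add: algebra_simps)
    also have "\<dots> = of_real (\<rho> r / r) * to_complex h + of_real (f' * (h \<bullet> sgn x)) * to_complex x"
      unfolding sgn f's by (simp add: algebra_simps)
    finally show ?thesis by simp
  qed
  ultimately show ?thesis by simp
qed

lemma C1_field_vortex: "C1_field (vortex \<rho>) vortex_grad"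
  using continuous_vortex_grad has_derivative_vortex by (simp add: C1_field_def)

end

section \<open>Decay of the vortex at infinity\<close>

text \<open>The analysis of the energy rests on these properties alone: \<open>Dv\<close> is \<open>\<i> v grad \<theta>\<close> up to
  order \<open>|x|^-2\<close>, and a translation changes \<open>v\<close> and \<open>Dv\<close> by quantities of orders \<open>|x|^-1\<close> and
  \<open>|x|^-2\<close>.\<close>
locale vortex_like =
  fixes v :: "real^2 \<Rightarrow> complex" and Dv :: "real^2 \<Rightarrow> complex^2"
  assumes C1: "C1_field v Dv"
    and norm_le_1: "norm (v x) \<le> 1"
    and defect: "\<exists>C. \<forall>x. 1 - (norm (v x))\<^sup>2 \<le> C * weight x"
    and Dv_angular: "\<exists>C. \<forall>x i. 1 \<le> norm x \<longrightarrow>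
      norm (Dv x $ i - \<i> * of_real (perp x $ i / (norm x)\<^sup>2) * v x) \<le> C * weight x"
    and Dv_bound: "\<exists>C. \<forall>x. (norm (Dv x))\<^sup>2 \<le> C * weight x"
    and shift: "\<And>a. \<exists>C. \<forall>x. (norm (v (x + a) - v x))\<^sup>2 \<le> C * weight x"
    and Dv_shift: "\<And>a. \<exists>C. \<forall>x. (norm (Dv (x + a) - Dv x))\<^sup>2 \<le> C * (weight x)\<^sup>2"

lemma norm_shift_ge: 
  assumes "2 + 2 * norm a \<le> norm x"
  shows "norm x / 2 \<le> norm (x + a)" "1 \<le> norm (x + a)" "1 \<le> norm x"
proof -
  have "norm x \<le> norm (x + a) + norm a" using norm_triangle_ineq4[of "x + a" a] by simp
  with assms norm_ge_zero[of a] show "norm x / 2 \<le> norm (x + a)" "1 \<le> norm (x + a)" by linarith+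
  show "1 \<le> norm x" using assms norm_ge_zero[of a] by linarith
qed

context vortex_ode
begin

lemma far_estimates:
  obtains K where "K \<ge> 0" "\<And>r. 1 \<le> r \<Longrightarrow> \<bar>1 - \<rho> r\<bar> \<le> K / r\<^sup>2" "\<And>r. 1 \<le> r \<Longrightarrow> \<bar>\<rho>' r\<bar> \<le> K / r\<^sup>2"
proof -
  obtain C where C: "\<And>r. r \<ge> 1 \<Longrightarrow> \<bar>1 - \<rho> r\<bar> \<le> C / r\<^sup>2" using one_minus_le by blast
  obtain D where D: "\<And>r. r \<ge> 1 \<Longrightarrow> \<bar>\<rho>' r\<bar> \<le> D / r\<^sup>2" using deriv_le by blast
  show ?thesis
  proof (rule that[of "max C D"])
    show "0 \<le> max C D" using C[of 1] by simp
    fix r :: real assume r: "1 \<le> r"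
    have "C / r\<^sup>2 \<le> max C D / r\<^sup>2" "D / r\<^sup>2 \<le> max C D / r\<^sup>2" by (auto intro: divide_right_mono)
    then show "\<bar>1 - \<rho> r\<bar> \<le> max C D / r\<^sup>2" "\<bar>\<rho>' r\<bar> \<le> max C D / r\<^sup>2"
      using C[OF r] D[OF r] by linarith+
  qed
qed

lemma vortex_grad_angular:
  assumes K: "\<And>r. 1 \<le> r \<Longrightarrow> \<bar>\<rho>' r\<bar> \<le> K / r\<^sup>2" and x: "1 \<le> norm x"
  shows "norm (vortex_grad x $ i - \<i> * of_real (perp x $ i / (norm x)\<^sup>2) * vortex \<rho> x) \<le> K / (norm x)\<^sup>2"
proof -
  have x0: "x \<noteq> 0" using x by auto
  have "norm (vortex_grad x $ i - \<i> * of_real (perp x $ i / (norm x)\<^sup>2) * vortex \<rho> x) =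
      \<bar>\<rho>' (norm x)\<bar> * (\<bar>x $ i\<bar> / norm x)"
    using x0 by (simp add: vortex_grad_def norm_mult norm_divide power2_eq_square)
  also have "\<dots> \<le> \<bar>\<rho>' (norm x)\<bar> * 1"
    using x0 component_le_norm_cart[of x i] by (intro mult_left_mono) (auto simp: divide_le_eq_1)
  finally show ?thesis using K[OF x] by simp
qed

text \<open>Both values are \<open>O (|x|^-2)\<close>-close to the unit vectors in the directions of \<open>x + a\<close> and
  \<open>x\<close>, whose distance is at most \<open>2 |a| / |x|\<close>.\<close>
lemma vortex_shift_far:
  assumes K0: "0 \<le> K" and K: "\<And>r. 1 \<le> r \<Longrightarrow> \<bar>1 - \<rho> r\<bar> \<le> K / r\<^sup>2" and x: "2 + 2 * norm a \<le> norm x"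
  shows "norm (vortex \<rho> (x + a) - vortex \<rho> x) \<le> (5 * K + 2 * norm a) / norm x"
proof -
  define y where "y = x + a"
  note ge = norm_shift_ge[OF x, folded y_def]
  have unit: "norm (vortex \<rho> z - to_complex z / norm z) \<le> K / (norm z)\<^sup>2" if z: "1 \<le> norm z" for z
  proof -
    have "vortex \<rho> z - to_complex z / norm z = of_real ((\<rho> (norm z) - 1) / norm z) * to_complex z"
      unfolding vortex_eq by (simp add: diff_divide_distrib left_diff_distrib)
    then have "norm (vortex \<rho> z - to_complex z / norm z) = \<bar>\<rho> (norm z) - 1\<bar> / norm z * norm z"
      by (simp only: norm_mult norm_of_real norm_to_complex abs_divide abs_norm_cancel)
    also have "\<dots> = \<bar>1 - \<rho> (norm z)\<bar>" using z by (cases "z = 0") auto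
    finally show ?thesis using K[OF z] by simp
  qed
  have ty: "to_complex y = to_complex x + to_complex a" by (simp add: y_def to_complex_add)
  have rx: "norm x > 0" "norm y > 0" using ge by linarith+
  have "to_complex y / norm y - to_complex x / norm x =
      to_complex a / norm x + to_complex y * of_real ((norm x - norm y) / (norm x * norm y))"
    using rx unfolding ty by (simp add: field_simps)
  then have "norm (to_complex y / norm y - to_complex x / norm x) \<le>
      norm (to_complex a / norm x) + norm (to_complex y * of_real ((norm x - norm y) / (norm x * norm y)))"
    by (simp only: norm_triangle_ineq)
  also have "\<dots> = norm a / norm x + \<bar>norm x - norm y\<bar> / norm x"
    using rx by (simp only: norm_mult norm_divide norm_of_real norm_to_complex abs_divide abs_mult abs_norm_cancel) simp
  also have "\<dots> \<le> norm a / norm x + norm a / norm x"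
    using norm_triangle_ineq3[of x y] rx by (intro add_left_mono divide_right_mono) (auto simp: y_def)
  finally have 1: "norm (to_complex y / norm y - to_complex x / norm x) \<le> 2 * norm a / norm x" by simp
  have "1 * norm x \<le> norm x * norm x" using ge by (intro mult_right_mono) auto
  then have 2: "K / (norm x)\<^sup>2 \<le> K / norm x"
    unfolding power2_eq_square using K0 rx by (intro divide_left_mono) auto
  have "(norm x / 2)\<^sup>2 \<le> (norm y)\<^sup>2" using ge by (intro power_mono) auto
  then have "K / (norm y)\<^sup>2 \<le> K / (norm x / 2)\<^sup>2" using K0 rx by (intro divide_left_mono) auto
  also have "\<dots> = 4 * (K / (norm x)\<^sup>2)" by (simp add: power2_eq_square)
  finally have 3: "K / (norm y)\<^sup>2 \<le> 4 * (K / norm x)" using 2 by simp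
  have tri: "norm (p + q - s) \<le> norm p + norm q + norm s" for p q s :: complex
    using norm_triangle_ineq4[of "p + q" s] norm_triangle_ineq[of p q] by linarith
  have "norm (vortex \<rho> y - vortex \<rho> x) \<le> norm (vortex \<rho> y - to_complex y / norm y) +
      norm (to_complex y / norm y - to_complex x / norm x) + norm (vortex \<rho> x - to_complex x / norm x)"
    using tri[of "vortex \<rho> y - to_complex y / norm y" "to_complex y / norm y - to_complex x / norm x"
        "vortex \<rho> x - to_complex x / norm x"] by simp
  also have "\<dots> \<le> 4 * (K / norm x) + 2 * norm a / norm x + K / norm x"
    using unit[OF ge(2)] unit[OF ge(3)] 1 2 3 by linarith
  also have "\<dots> = (5 * K + 2 * norm a) / norm x" by (simp add: add_divide_distrib)
  finally show ?thesis by (simp add: y_def)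
qed

text \<open>The inversion \<open>x / |x|^2\<close> is \<open>1 / cnj z\<close> in complex notation, and it satisfies
  \<open>|x / |x|^2 - y / |y|^2| = |x - y| / (|x| |y|)\<close>.\<close>
lemma perp_shift:
  assumes "x \<noteq> 0" "y \<noteq> 0"
  shows "\<bar>perp y $ i / (norm y)\<^sup>2 - perp x $ i / (norm x)\<^sup>2\<bar> \<le> norm (y - x) / (norm x * norm y)"
proof -
  define Z where "Z z = inverse (cnj (to_complex z))" for z
  have Z: "Re (Z z) = z $ 1 / (norm z)\<^sup>2" "Im (Z z) = z $ 2 / (norm z)\<^sup>2" for z
    by (simp_all add: Z_def to_complex_def norm_sq_2)
  have "Z y - Z x = - (inverse (cnj (to_complex y)) * cnj (to_complex y - to_complex x) * inverse (cnj (to_complex x)))"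
    using assms unfolding Z_def by (subst inverse_diff_inverse) auto
  moreover have "to_complex y - to_complex x = to_complex (y - x)"
    by (simp add: to_complex_def complex_eq_iff)
  ultimately have "norm (Z y - Z x) = norm (y - x) / (norm x * norm y)"
    using assms by (simp add: norm_mult norm_inverse divide_inverse mult_ac del: complex_cnj_diff)
  moreover have "\<bar>Re (Z y - Z x)\<bar> \<le> norm (Z y - Z x)" "\<bar>Im (Z y - Z x)\<bar> \<le> norm (Z y - Z x)"
    by (rule abs_Re_le_cmod abs_Im_le_cmod)+
  ultimately show ?thesis
    using exhaust_2[of i] by (auto simp: Z abs_minus_commute)
qed

text \<open>The radial parts are of order \<open>|x|^-2\<close> themselves. In the angular part the factor
  \<open>grad \<theta>\<close>, of order \<open>|x|^-1\<close>, and the bounded factor \<open>V\<close> change by orders \<open>|x|^-2\<close> and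
  \<open>|x|^-1\<close>.\<close>
lemma vortex_grad_shift_far:
  assumes K0: "0 \<le> K" and K: "\<And>r. 1 \<le> r \<Longrightarrow> \<bar>1 - \<rho> r\<bar> \<le> K / r\<^sup>2" "\<And>r. 1 \<le> r \<Longrightarrow> \<bar>\<rho>' r\<bar> \<le> K / r\<^sup>2"
    and x: "2 + 2 * norm a \<le> norm x"
  shows "norm (vortex_grad (x + a) $ i - vortex_grad x $ i) \<le> (15 * K + 6 * norm a) / (norm x)\<^sup>2"
proof -
  define y where "y = x + a"
  note ge = norm_shift_ge[OF x, folded y_def]
  have rx: "norm x > 0" "norm y > 0" using ge by linarith+
  define p where "p z = perp z $ i / (norm z)\<^sup>2" for z
  define E where "E z = vortex_grad z $ i - \<i> * of_real (p z) * vortex \<rho> z" for z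
  have Ex: "norm (E x) \<le> K / (norm x)\<^sup>2" and Ey: "norm (E y) \<le> K / (norm y)\<^sup>2"
    unfolding E_def p_def using vortex_grad_angular[OF K(2)] ge by blast+
  have "(norm x / 2)\<^sup>2 \<le> (norm y)\<^sup>2" using ge by (intro power_mono) auto
  then have "K / (norm y)\<^sup>2 \<le> K / (norm x / 2)\<^sup>2" using K0 rx by (intro divide_left_mono) auto
  also have "\<dots> = 4 * K / (norm x)\<^sup>2" by (simp add: power2_eq_square)
  finally have Ey: "norm (E y) \<le> 4 * K / (norm x)\<^sup>2" using Ey by simp
  have py: "\<bar>p y\<bar> \<le> 2 / norm x"
  proof -
    have "\<bar>p y\<bar> \<le> norm y / (norm y)\<^sup>2"
      unfolding p_def abs_divide using abs_perp_le[of y i] by (simp add: divide_right_mono)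
    also have "\<dots> = 1 / norm y" by (simp add: power2_eq_square)
    also have "\<dots> \<le> 2 / norm x" using ge rx by (simp add: field_simps)
    finally show ?thesis .
  qed
  have "\<bar>p y - p x\<bar> \<le> norm a / (norm x * norm y)"
    using perp_shift[of x y i] rx by (auto simp: p_def y_def)
  also have "\<dots> \<le> norm a / (norm x * (norm x / 2))"
    using ge rx by (intro divide_left_mono mult_left_mono) auto
  finally have pd: "\<bar>p y - p x\<bar> \<le> 2 * norm a / (norm x)\<^sup>2" by (simp add: power2_eq_square mult.commute)
  have vd: "norm (vortex \<rho> y - vortex \<rho> x) \<le> (5 * K + 2 * norm a) / norm x"
    using vortex_shift_far[OF K0 K(1) x] by (simp add: y_def)
  have v1: "norm (vortex \<rho> x) \<le> 1" using abs_le_1[of "norm x"] by (simp add: norm_vortex)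
  have "vortex_grad y $ i - vortex_grad x $ i = (E y - E x) +
      (\<i> * of_real (p y) * (vortex \<rho> y - vortex \<rho> x) + \<i> * of_real (p y - p x) * vortex \<rho> x)"
    by (simp add: E_def algebra_simps)
  also have "norm \<dots> \<le> (norm (E y) + norm (E x)) +
      (norm (\<i> * of_real (p y) * (vortex \<rho> y - vortex \<rho> x)) + norm (\<i> * of_real (p y - p x) * vortex \<rho> x))"
    by (intro order_trans[OF norm_triangle_ineq] add_mono norm_triangle_ineq4 norm_triangle_ineq)
  also have "\<dots> = (norm (E y) + norm (E x)) + (\<bar>p y\<bar> * norm (vortex \<rho> y - vortex \<rho> x) + \<bar>p y - p x\<bar> * norm (vortex \<rho> x))"
    by (simp add: norm_mult del: of_real_diff)
  also have "\<dots> \<le> (4 * K / (norm x)\<^sup>2 + K / (norm x)\<^sup>2) +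
      (2 / norm x * ((5 * K + 2 * norm a) / norm x) + 2 * norm a / (norm x)\<^sup>2 * 1)"
    using Ex Ey py pd vd v1 by (intro add_mono mult_mono) auto
  also have "\<dots> = (15 * K + 6 * norm a) / (norm x)\<^sup>2"
    by (simp add: power2_eq_square add_divide_distrib algebra_simps)
  finally show ?thesis by (simp add: y_def)
qed

lemma vortex_like_vortex: "vortex_like (vortex \<rho>) vortex_grad"
proof
  obtain K where K0: "K \<ge> 0" and K1: "\<And>r. 1 \<le> r \<Longrightarrow> \<bar>1 - \<rho> r\<bar> \<le> K / r\<^sup>2"
    and K2: "\<And>r. 1 \<le> r \<Longrightarrow> \<bar>\<rho>' r\<bar> \<le> K / r\<^sup>2"
    using far_estimates by metis
  show C1: "C1_field (vortex \<rho>) vortex_grad" by (rule C1_field_vortex)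
  note cv = C1_field_continuous(1)[OF C1] and cD = C1[unfolded C1_field_def, THEN conjunct1]
  show le1: "norm (vortex \<rho> x) \<le> 1" for x
    using abs_le_1[of "norm x"] by (simp add: norm_vortex)
  have far_weight: "B / (norm x)\<^sup>2 \<le> (2 * B) * weight x" if "0 \<le> B" "1 \<le> norm x" for B x
    using mult_left_mono[OF inverse_norm_sq_le_weight[OF that(2)] that(1)] by simp
  show "\<exists>C. \<forall>x. 1 - (norm (vortex \<rho> x))\<^sup>2 \<le> C * weight x"
  proof (rule bounded_by_continuous)
    show "continuous_on UNIV (\<lambda>x. 1 - (norm (vortex \<rho> x))\<^sup>2)" by (intro continuous_intros cv)
    fix x :: "real^2" assume x: "1 \<le> norm x"
    have "1 - (norm (vortex \<rho> x))\<^sup>2 = (1 - \<rho> (norm x)) * (1 + \<rho> (norm x))"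
      by (simp add: norm_vortex power2_eq_square algebra_simps)
    also have "\<dots> \<le> (K / (norm x)\<^sup>2) * 2"
      using K1[OF x] abs_le_1[of "norm x"] by (intro mult_mono) auto
    also have "\<dots> \<le> (2 * (K * 2)) * weight x" using far_weight[of "K * 2" x] K0 x by simp
    finally show "1 - (norm (vortex \<rho> x))\<^sup>2 \<le> (2 * (K * 2)) * weight x" .
  qed (rule continuous_on_weight, rule weight_pos)
  have ang: "norm (vortex_grad x $ i - \<i> * of_real (perp x $ i / (norm x)\<^sup>2) * vortex \<rho> x) \<le> 2 * K * weight x"
    if "1 \<le> norm x" for x i
    using vortex_grad_angular[OF K2 that, of i] far_weight[OF K0 that] by linarith
  then show "\<exists>C. \<forall>x i. 1 \<le> norm x \<longrightarrow>
      norm (vortex_grad x $ i - \<i> * of_real (perp x $ i / (norm x)\<^sup>2) * vortex \<rho> x) \<le> C * weight x"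
    by blast
  show "\<exists>C. \<forall>x. (norm (vortex_grad x))\<^sup>2 \<le> C * weight x"
  proof (rule bounded_by_continuous)
    show "continuous_on UNIV (\<lambda>x. (norm (vortex_grad x))\<^sup>2)" by (intro continuous_intros cD)
    fix x :: "real^2" assume x: "1 \<le> norm x"
    have "norm (vortex_grad x $ i) \<le> (K + 1) / norm x" for i
    proof -
      define p where "p = perp x $ i / (norm x)\<^sup>2"
      have "\<bar>p\<bar> \<le> norm x / (norm x)\<^sup>2"
        unfolding p_def abs_divide using abs_perp_le[of x i] by (simp add: divide_right_mono)
      also have "\<dots> = 1 / norm x" by (simp add: power2_eq_square)
      finally have "\<bar>p\<bar> * norm (vortex \<rho> x) \<le> (1 / norm x) * 1" using le1 by (intro mult_mono) auto
      then have 1: "norm (\<i> * of_real p * vortex \<rho> x) \<le> 1 / norm x" by (simp add: norm_mult)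
      have "1 * norm x \<le> norm x * norm x" "0 < norm x" using x mult_right_mono[of 1 "norm x" "norm x"] by auto
      then have "K / (norm x)\<^sup>2 \<le> K / norm x"
        unfolding power2_eq_square using K0 by (intro divide_left_mono) auto
      then have 2: "norm (vortex_grad x $ i - \<i> * of_real p * vortex \<rho> x) \<le> K / norm x"
        using vortex_grad_angular[OF K2 x, of i] unfolding p_def by linarith
      show ?thesis
        using norm_triangle_ineq[of "vortex_grad x $ i - \<i> * of_real p * vortex \<rho> x" "\<i> * of_real p * vortex \<rho> x"] 1 2
        by (simp add: add_divide_distrib)
    qed
    then have "(norm (vortex_grad x $ i))\<^sup>2 \<le> ((K + 1) / norm x)\<^sup>2" for i
      by (intro power_mono) auto
    then have "(norm (vortex_grad x))\<^sup>2 \<le> 2 * ((K + 1)\<^sup>2 / (norm x)\<^sup>2)"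
      unfolding norm_sq_2_complex power_divide by (metis add_mono mult_2)
    also have "\<dots> \<le> (2 * (2 * (K + 1)\<^sup>2)) * weight x"
      using far_weight[of "2 * (K + 1)\<^sup>2" x] x by simp
    finally show "(norm (vortex_grad x))\<^sup>2 \<le> (2 * (2 * (K + 1)\<^sup>2)) * weight x" .
  qed (rule continuous_on_weight, rule weight_pos)
  fix a :: "real^2"
  have tr: "continuous_on UNIV (\<lambda>x. x + a)" by (intro continuous_intros)
  show "\<exists>C. \<forall>x. (norm (vortex \<rho> (x + a) - vortex \<rho> x))\<^sup>2 \<le> C * weight x"
  proof (rule bounded_by_continuous)
    show "continuous_on UNIV (\<lambda>x. (norm (vortex \<rho> (x + a) - vortex \<rho> x))\<^sup>2)"
      by (intro continuous_on_power continuous_on_norm continuous_on_diff cv continuous_on_compose2[OF cv tr]) auto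
    fix x :: "real^2" assume x: "2 + 2 * norm a \<le> norm x"
    define B where "B = 5 * K + 2 * norm a"
    have "(norm (vortex \<rho> (x + a) - vortex \<rho> x))\<^sup>2 \<le> (B / norm x)\<^sup>2"
      unfolding B_def by (intro power_mono vortex_shift_far K0 K1 x) auto
    also have "\<dots> \<le> (2 * B\<^sup>2) * weight x"
      unfolding power_divide using norm_shift_ge[OF x] by (intro far_weight) auto
    finally show "(norm (vortex \<rho> (x + a) - vortex \<rho> x))\<^sup>2 \<le> (2 * B\<^sup>2) * weight x" .
  qed (rule continuous_on_weight, rule weight_pos)
  show "\<exists>C. \<forall>x. (norm (vortex_grad (x + a) - vortex_grad x))\<^sup>2 \<le> C * (weight x)\<^sup>2"
  proof (rule bounded_by_continuous)
    show "continuous_on UNIV (\<lambda>x. (norm (vortex_grad (x + a) - vortex_grad x))\<^sup>2)"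
      by (intro continuous_on_power continuous_on_norm continuous_on_diff cD continuous_on_compose2[OF cD tr]) auto
    show "continuous_on UNIV (\<lambda>x. (weight x)\<^sup>2)" by (intro continuous_on_power continuous_on_weight)
    show "0 < (weight x)\<^sup>2" for x using weight_pos[of x] by simp
    fix x :: "real^2" assume x: "2 + 2 * norm a \<le> norm x"
    define B where "B = 15 * K + 6 * norm a"
    have B: "0 \<le> B" using K0 by (simp add: B_def)
    have "norm ((vortex_grad (x + a) - vortex_grad x) $ i) \<le> (2 * B) * weight x" for i
      using vortex_grad_shift_far[OF K0 K1 K2 x, of i] far_weight[OF B norm_shift_ge(3)[OF x]]
      by (simp add: B_def)
    then have "(norm ((vortex_grad (x + a) - vortex_grad x) $ i))\<^sup>2 \<le> ((2 * B) * weight x)\<^sup>2" for i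
      by (intro power_mono) auto
    then have "(norm (vortex_grad (x + a) - vortex_grad x))\<^sup>2 \<le> 2 * ((2 * B) * weight x)\<^sup>2"
      unfolding norm_sq_2_complex by (metis add_mono mult_2)
    then show "(norm (vortex_grad (x + a) - vortex_grad x))\<^sup>2 \<le> (2 * (2 * B)\<^sup>2) * (weight x)\<^sup>2"
      by (simp add: power_mult_distrib)
  qed
qed

end

text \<open>Between the radii \<open>2^n\<close> and \<open>2^(n + 1)\<close> the integrand is at most \<open>16^-n\<close>, while the area
  grows like \<open>4^n\<close>.\<close>
lemma integrable_weight_sq: "integrable lebesgue (\<lambda>x. (weight x)\<^sup>2)"
proof -
  have [measurable]: "weight \<in> borel_measurable borel"
    by (rule borel_measurable_continuous_onI[OF continuous_on_weight])
  have pt: "ennreal ((weight x)\<^sup>2) \<le> (\<Sum>n. ennreal ((1 / 16) ^ n) * indicator (ball 0 (2 ^ Suc n)) x)" for x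
  proof -
    have "\<exists>n. norm x < 2 ^ Suc n"
    proof -
      obtain n where "norm x < 2 ^ n" using real_arch_pow[of 2 "norm x"] by auto
      then have "norm x < 2 ^ Suc n" by (auto intro: less_le_trans power_increasing)
      then show ?thesis ..
    qed
    then obtain n where n: "norm x < 2 ^ Suc n" "\<And>m. m < n \<Longrightarrow> \<not> norm x < 2 ^ Suc m"
      using exists_least_iff[of "\<lambda>n. norm x < 2 ^ Suc n"] by blast
    have "(weight x)\<^sup>2 \<le> (1 / 16) ^ n"
    proof (cases n)
      case 0
      then show ?thesis using weight_pos[of x] weight_le_1[of x] by (simp add: power_le_one)
    next
      case (Suc m)
      then have "2 ^ n \<le> norm x" using n(2)[of m] by simp
      then have "(2 ^ n)\<^sup>2 \<le> (norm x)\<^sup>2" by (intro power_mono) auto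
      also have "(2 ^ n)\<^sup>2 = (4 :: real) ^ n" by (simp add: power2_eq_square power_mult_distrib[symmetric])
      finally have "weight x \<le> 1 / 4 ^ n" unfolding weight_def by (intro divide_left_mono) (auto simp: add_pos_nonneg)
      then have "(weight x)\<^sup>2 \<le> (1 / 4 ^ n)\<^sup>2" using weight_pos[of x] by (intro power_mono) auto
      also have "\<dots> = (1 / 16) ^ n" by (simp add: power_divide power2_eq_square power_mult_distrib[symmetric])
      finally show ?thesis .
    qed
    then have "ennreal ((weight x)\<^sup>2) \<le> ennreal ((1 / 16) ^ n) * indicator (ball 0 (2 ^ Suc n)) x"
      using n(1) by (simp add: ennreal_leI)
    also have "\<dots> \<le> (\<Sum>n. ennreal ((1 / 16) ^ n) * indicator (ball 0 (2 ^ Suc n)) x)"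
    proof -
      define f where "f k = ennreal ((1 / 16) ^ k) * indicator (ball 0 (2 ^ Suc k)) x" for k
      have "sum f {n} \<le> suminf f" by (rule sum_le_suminf) auto
      then have "f n \<le> suminf f" by simp
      then show ?thesis unfolding f_def .
    qed
    finally show ?thesis .
  qed
  define V where "V = unit_ball_vol (2 :: real)"
  have V: "V \<ge> 0" by (simp add: V_def unit_ball_vol_nonneg)
  have "(\<integral>\<^sup>+x. ennreal ((weight x)\<^sup>2) \<partial>lborel) \<le>
      (\<integral>\<^sup>+(x::real^2). (\<Sum>n. ennreal ((1 / 16) ^ n) * indicator (ball 0 (2 ^ Suc n)) x) \<partial>lborel)"
    by (intro nn_integral_mono pt)
  also have "\<dots> = (\<Sum>n. \<integral>\<^sup>+x. ennreal ((1 / 16) ^ n) * indicator (ball 0 (2 ^ Suc n)) (x :: real^2) \<partial>lborel)"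
    by (rule nn_integral_suminf) (intro borel_measurable_times_ennreal borel_measurable_indicator, auto)
  also have "\<dots> = (\<Sum>n. ennreal (4 * V * (1 / 4) ^ n))"
  proof (rule suminf_cong)
    fix n
    have "(\<integral>\<^sup>+x. ennreal ((1 / 16) ^ n) * indicator (ball 0 (2 ^ Suc n)) (x :: real^2) \<partial>lborel) =
        ennreal ((1 / 16) ^ n) * ennreal (V * (2 ^ Suc n)\<^sup>2)"
      by (simp add: nn_integral_cmult_indicator emeasure_ball V_def del: power_Suc)
    also have "\<dots> = ennreal ((1 / 16) ^ n * (V * (2 ^ Suc n)\<^sup>2))"
      using V by (simp add: ennreal_mult[symmetric])
    also have "(1 / 16) ^ n * (V * (2 ^ Suc n)\<^sup>2) = 4 * V * (1 / 4) ^ n"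
    proof -
      have "(2 ^ Suc n)\<^sup>2 = 4 * (4 :: real) ^ n" by (simp add: power2_eq_square power_mult_distrib[symmetric])
      moreover have "(1 / 16 :: real) ^ n * 4 ^ n = (1 / 4) ^ n" by (simp add: power_mult_distrib[symmetric])
      ultimately show ?thesis by (simp add: algebra_simps)
    qed
    finally show "(\<integral>\<^sup>+x. ennreal ((1 / 16) ^ n) * indicator (ball 0 (2 ^ Suc n)) (x :: real^2) \<partial>lborel) =
        ennreal (4 * V * (1 / 4) ^ n)" .
  qed
  also have "\<dots> < \<infinity>"
    using V by (subst suminf_ennreal2) (auto intro!: summable_mult summable_geometric)
  finally have "integrable lborel (\<lambda>x. (weight x)\<^sup>2)"
    by (intro integrableI_bounded) auto
  then show ?thesis by (subst integrable_completion) auto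
qed

lemma weight_translate: "weight (x + a) \<le> 2 * (1 + (norm a)\<^sup>2) * weight x"
proof -
  have "norm x \<le> norm (x + a) + norm a" using norm_triangle_ineq4[of "x + a" a] by simp
  then have "(norm x)\<^sup>2 \<le> (norm (x + a) + norm a)\<^sup>2" by (intro power_mono) auto
  also have "\<dots> \<le> 2 * (norm (x + a))\<^sup>2 + 2 * (norm a)\<^sup>2"
    using sum_squares_bound[of "norm (x + a)" "norm a"] by (simp add: power2_sum)
  finally have "(norm x)\<^sup>2 \<le> 2 * (norm (x + a))\<^sup>2 + 2 * (norm a)\<^sup>2" .
  moreover have "1 + X \<le> 2 * (1 + A) * (1 + B)" if "X \<le> 2 * B + 2 * A" "0 \<le> A" "0 \<le> B" for A B X :: real
  proof -
    have "2 * (1 + A) * (1 + B) = 2 + 2 * A + 2 * B + 2 * (A * B)" by (simp add: algebra_simps)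
    moreover have "0 \<le> A * B" using that by simp
    ultimately show ?thesis using that by linarith
  qed
  ultimately have "1 + (norm x)\<^sup>2 \<le> 2 * (1 + (norm a)\<^sup>2) * (1 + (norm (x + a))\<^sup>2)"
    by simp
  moreover have "1 + (norm x)\<^sup>2 > 0" "1 + (norm (x + a))\<^sup>2 > 0" by (simp_all add: add_pos_nonneg)
  ultimately show ?thesis by (simp add: weight_def field_simps)
qed

section \<open>Rotations and the angular derivative\<close>

definition rot :: "real \<Rightarrow> real^2 \<Rightarrow> real^2" where
  "rot s x = cos s *\<^sub>R x + sin s *\<^sub>R perp x"

lemma perp_add: "perp (x + y) = perp x + perp y" and perp_scaleR: "perp (c *\<^sub>R x) = c *\<^sub>R perp x"
  and perp_diff: "perp (x - y) = perp x - perp y" and perp_perp: "perp (perp x) = - x"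
  by (simp_all add: vec_eq_iff forall_2)

lemma norm_rot [simp]: "norm (rot s x) = norm x"
proof -
  have "(norm (rot s x))\<^sup>2 = (norm x)\<^sup>2 * ((cos s)\<^sup>2 + (sin s)\<^sup>2)"
  proof -
    have "(p * a - q * b)\<^sup>2 + (p * b + q * a)\<^sup>2 = (a\<^sup>2 + b\<^sup>2) * (p\<^sup>2 + q\<^sup>2)" for a b p q :: real
      by (simp add: power2_eq_square algebra_simps)
    from this[of "cos s" "x $ 1" "sin s" "x $ 2"] show ?thesis
      unfolding norm_sq_2 by (simp add: rot_def)
  qed
  then show ?thesis by simp
qed

lemma rot_rot: "rot s (rot t x) = rot (s + t) x"
  by (simp add: rot_def perp_add perp_scaleR perp_perp cos_add sin_add algebra_simps)

lemma rot_0 [simp]: "rot 0 x = x" and rot_2pi [simp]: "rot (2 * pi) x = x"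
  by (simp_all add: rot_def)

lemma rot_neg [simp]: "rot (- s) (rot s x) = x" "rot s (rot (- s) x) = x"
  by (simp_all add: rot_rot)

lemma bounded_linear_perp: "bounded_linear perp"
proof (intro bounded_linear_intro[of _ 1])
  fix x :: "real^2"
  have "(norm (perp x))\<^sup>2 = (norm x)\<^sup>2" unfolding norm_sq_2 by simp
  then show "norm (perp x) \<le> norm x * 1" by simp
qed (simp_all add: perp_add perp_scaleR)

lemma linear_rot: "linear (rot s)"
  by (intro linearI) (simp_all add: rot_def perp_add perp_scaleR algebra_simps)

lemma continuous_rot: "continuous_on UNIV (\<lambda>(s, x). rot s x)"
  unfolding rot_def case_prod_beta
  by (intro continuous_intros continuous_on_compose2[OF linear_continuous_on[OF bounded_linear_perp]]) auto

lemma lborel_preserving_rot: "lborel_preserving (rot s)"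
proof -
  have lin: "linear (rot s)" for s by (rule linear_rot)
  have cont: "continuous_on UNIV (rot s)" for s
    using linear_continuous_on linear_conv_bounded_linear lin by blast
  then have m [measurable]: "rot s \<in> borel \<rightarrow>\<^sub>M borel" by (rule borel_measurable_continuous_onI)
  have orth: "orthogonal_transformation (rot s)" for s
    unfolding orthogonal_transformation by (simp add: lin)
  have "lborel = distr lborel borel (rot s)"
  proof (rule lborel_eqI)
    fix l u :: "real^2" assume lu: "\<And>b. b \<in> Basis \<Longrightarrow> l \<bullet> b \<le> u \<bullet> b"
    have im: "rot s -` box l u = rot (- s) ` box l u"
      by (auto simp: image_iff) (metis rot_neg(1))
    have "emeasure (distr lborel borel (rot s)) (box l u) = emeasure lborel (rot s -` box l u)"
      by (subst emeasure_distr) auto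
    also have "\<dots> = emeasure lebesgue (rot (- s) ` box l u)"
    proof -
      have "rot s -` box l u \<in> sets lborel" using measurable_sets[OF m, of "box l u"] by simp
      then show ?thesis unfolding im[symmetric] by simp
    qed
    also have "\<dots> = ennreal (measure lebesgue (rot (- s) ` box l u))"
      by (intro emeasure_eq_measure2 measurable_linear_image lin) auto
    also have "measure lebesgue (rot (- s) ` box l u) = measure lebesgue (box l u)"
      by (intro measure_orthogonal_image orth) auto
    also have "ennreal (measure lebesgue (box l u)) = emeasure lborel (box l u)"
      by (subst emeasure_eq_measure2) (auto simp: measure_completion)
    finally show "emeasure (distr lborel borel (rot s)) (box l u) = ennreal (\<Prod>b\<in>Basis. (u - l) \<bullet> b)"
      using lu by (simp add: emeasure_lborel_box)
  qed simp
  then show ?thesis by (simp add: lborel_preserving_def)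
qed

lemma integral_rot:
  fixes f :: "real^2 \<Rightarrow> 'b::euclidean_space"
  assumes [measurable]: "f \<in> borel_measurable borel"
  shows "(LINT x|lborel. f (rot s x)) = (LINT x|lborel. f x)"
    "integrable lborel f \<Longrightarrow> integrable lborel (\<lambda>x. f (rot s x))"
proof -
  have T: "rot s \<in> lborel \<rightarrow>\<^sub>M borel" "distr lborel borel (rot s) = lborel"
    using lborel_preserving_rot[of s] by (auto simp: lborel_preserving_def)
  show "(LINT x|lborel. f (rot s x)) = (LINT x|lborel. f x)"
    using integral_distr[OF T(1), of f] T(2) by simp
  show "integrable lborel f \<Longrightarrow> integrable lborel (\<lambda>x. f (rot s x))"
    using integrable_distr[OF T(1), of f] T(2) by simp
qed

lemma measurable_rot_pair [measurable]:
  "(\<lambda>p. rot (c * fst p) (snd p)) \<in> borel_measurable (lborel \<Otimes>\<^sub>M lborel)"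
proof -
  have "continuous_on UNIV (\<lambda>p. (\<lambda>(s, x). rot s x) (c * fst p, snd p))"
    by (rule continuous_on_compose2[OF continuous_rot]) (auto intro!: continuous_intros)
  then show ?thesis
    unfolding lborel_prod by (auto intro!: borel_measurable_continuous_onI)
qed

lemma integrable_rot_pair:
  fixes B :: "real^2 \<Rightarrow> real"
  assumes B: "B \<in> borel_measurable borel" "integrable lborel B"
  shows "integrable (lborel \<Otimes>\<^sub>M lborel) (\<lambda>(s, x). indicator {0..l} s * B (rot (c * s) x))"
proof (rule lborel_pair.Fubini_integrable)
  note [measurable] = B(1)
  have "(\<lambda>p. indicator {0..l} (fst p) * B (rot (c * fst p) (snd p))) \<in> borel_measurable (lborel \<Otimes>\<^sub>M lborel)"
    by measurable
  then show "(\<lambda>(s, x). indicator {0..l} s * B (rot (c * s) x)) \<in> borel_measurable (lborel \<Otimes>\<^sub>M lborel)"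
    by (simp add: case_prod_beta)
  have "(LINT x|lborel. norm (indicator {0..l} s * B (rot (c * s) x))) = indicator {0..l} s * (LINT x|lborel. \<bar>B x\<bar>)" for s :: real
    using integral_rot(1)[of "\<lambda>x. \<bar>B x\<bar>" "c * s"] by (simp add: abs_mult)
  moreover have "integrable lborel (\<lambda>s::real. indicator {0..l} s * (LINT x|lborel. \<bar>B x\<bar>))"
    by (intro integrable_mult_left integrable_real_indicator) (auto simp: emeasure_lborel_Icc_eq)
  ultimately show "integrable lborel (\<lambda>s. LINT x|lborel. norm (case (s, x) of (s, x) \<Rightarrow> indicator {0..l} s * B (rot (c * s) x)))"
    by simp
  show "AE s in lborel. integrable lborel (\<lambda>x. case (s, x) of (s, x) \<Rightarrow> indicator {0..l} s * B (rot (c * s) x))"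
    using integral_rot(2)[OF B] by auto
qed

text \<open>The derivative in the polar angle of a function with gradient \<open>G\<close>.\<close>
definition angular_deriv :: "(real^2 \<Rightarrow> complex^2) \<Rightarrow> real^2 \<Rightarrow> complex" where
  "angular_deriv G x = of_real (x $ 1) * G x $ 2 - of_real (x $ 2) * G x $ 1"

lemma C1_field_component: "C1_field (\<lambda>x::real^'n. of_real (x $ i)) (\<lambda>x. \<chi> j. if j = i then 1 else 0)"
  unfolding C1_field_def
proof (intro conjI allI)
  fix x :: "real^'n"
  have "((\<lambda>x::real^'n. complex_of_real (x $ i)) has_derivative (\<lambda>h. of_real (h $ i))) (at x)"
    by (intro has_derivative_of_real bounded_linear.has_derivative[OF bounded_linear_vec_nth has_derivative_ident])
  then show "((\<lambda>x::real^'n. complex_of_real (x $ i)) has_derivative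
      (\<lambda>h. \<Sum>j\<in>UNIV. h $ j *\<^sub>R (\<chi> j. if j = i then 1 else 0) $ j)) (at x)"
    by (simp add: if_distrib[of "\<lambda>z. _ *\<^sub>R z"] of_real_def cong: if_cong)
qed simp

text \<open>The weak identities are applied to \<open>x\<^sub>1 \<phi>\<close> in the second and to \<open>x\<^sub>2 \<phi>\<close> in the first
  direction; the factors \<open>x\<^sub>1\<close> and \<open>x\<^sub>2\<close> are constant in these directions.\<close>
lemma weak_angular_deriv:
  assumes u: "has_weak_gradient u G" and \<phi>: "C1c_field \<phi> g"
  shows "(LINT x|lebesgue. u x * angular_deriv g x) = - (LINT x|lebesgue. angular_deriv G x * \<phi> x)"
    "integrable lebesgue (\<lambda>x. u x * angular_deriv g x)"
proof -
  have uL: "u \<in> L1_loc" and GL: "(\<lambda>x. G x $ i) \<in> L1_loc" for i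
    using u L1_loc_component by (auto simp: has_weak_gradient_def)
  obtain R where R: "\<And>x. R \<le> norm x \<Longrightarrow> \<phi> x = 0 \<and> g x = 0" and C: "C1_field \<phi> g"
    using \<phi> by (auto simp: C1c_field_def)
  note cont = C1_field_continuous[OF C]
  have cx: "continuous_on UNIV (\<lambda>x. complex_of_real (x $ i))" for i :: 2
    by (rule C1_field_continuous(1)[OF C1_field_component])
  note int = integrable_L1_loc_times_continuous[where R = R]
  have 1: "(LINT x|lebesgue. u x * (of_real (x $ 1) * g x $ 2)) = - (LINT x|lebesgue. G x $ 2 * (of_real (x $ 1) * \<phi> x))"
    using weak_gradient_C1c[OF u C1c_field_mult[OF C1_field_component[of 1] \<phi>], of 2] by simp
  have 2: "(LINT x|lebesgue. u x * (of_real (x $ 2) * g x $ 1)) = - (LINT x|lebesgue. G x $ 1 * (of_real (x $ 2) * \<phi> x))"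
    using weak_gradient_C1c[OF u C1c_field_mult[OF C1_field_component[of 2] \<phi>], of 1] by simp
  have i1: "integrable lebesgue (\<lambda>x. u x * (of_real (x $ 1) * g x $ 2))"
    and i2: "integrable lebesgue (\<lambda>x. u x * (of_real (x $ 2) * g x $ 1))"
    by (intro int[OF uL] continuous_on_mult cx cont; use R in auto)+
  have i3: "integrable lebesgue (\<lambda>x. G x $ 2 * (of_real (x $ 1) * \<phi> x))"
    and i4: "integrable lebesgue (\<lambda>x. G x $ 1 * (of_real (x $ 2) * \<phi> x))"
    by (intro int[OF GL] continuous_on_mult cx cont; use R in auto)+
  have e1: "u x * angular_deriv g x = u x * (of_real (x $ 1) * g x $ 2) - u x * (of_real (x $ 2) * g x $ 1)" for x
    by (simp add: angular_deriv_def algebra_simps)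
  have e2: "angular_deriv G x * \<phi> x = G x $ 2 * (of_real (x $ 1) * \<phi> x) - G x $ 1 * (of_real (x $ 2) * \<phi> x)" for x
    by (simp add: angular_deriv_def algebra_simps)
  show "(LINT x|lebesgue. u x * angular_deriv g x) = - (LINT x|lebesgue. angular_deriv G x * \<phi> x)"
    unfolding e1 e2 using i1 i2 i3 i4 1 2 by simp
  show "integrable lebesgue (\<lambda>x. u x * angular_deriv g x)"
    unfolding e1 using i1 i2 by simp
qed

text \<open>The angular derivative commutes with rotations.\<close>
lemma C1c_field_rot:
  assumes "C1c_field \<phi> g"
  obtains k where "C1c_field (\<lambda>x. \<phi> (rot s x)) k" "\<And>x. angular_deriv k x = angular_deriv g (rot s x)"
proof -
  define k :: "real^2 \<Rightarrow> complex^2" where "k x = (\<chi> i. if i = 1 then of_real (cos s) * g (rot s x) $ 1 + of_real (sin s) * g (rot s x) $ 2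
      else of_real (cos s) * g (rot s x) $ 2 - of_real (sin s) * g (rot s x) $ 1)" for x
  obtain R where R: "\<And>x. R \<le> norm x \<Longrightarrow> \<phi> x = 0 \<and> g x = 0" and C: "C1_field \<phi> g"
    using assms by (auto simp: C1c_field_def)
  have lin: "bounded_linear (rot s)" using linear_rot by (simp add: linear_conv_bounded_linear)
  have cg: "continuous_on UNIV (\<lambda>x. g (rot s x) $ i)" for i
    by (rule continuous_on_compose2[OF C1_field_continuous(2)[OF C] linear_continuous_on[OF lin]]) auto
  have "continuous_on UNIV (\<lambda>x. k x $ i)" for i
    using exhaust_2[of i] by (auto simp: k_def intro!: continuous_intros cg)
  then have "continuous_on UNIV (\<lambda>x. \<chi> i. k x $ i)" by (rule continuous_on_vec_lambda)
  then have ck: "continuous_on UNIV k" by simp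
  have D: "((\<lambda>x. \<phi> (rot s x)) has_derivative (\<lambda>h. \<Sum>i\<in>UNIV. h $ i *\<^sub>R k x $ i)) (at x)" for x
  proof -
    have "(\<phi> has_derivative (\<lambda>h. \<Sum>i\<in>UNIV. h $ i *\<^sub>R g (rot s x) $ i)) (at (rot s x))"
      using C by (auto simp: C1_field_def)
    from has_derivative_compose[OF bounded_linear.has_derivative[OF lin has_derivative_ident] this]
    have "((\<lambda>x. \<phi> (rot s x)) has_derivative (\<lambda>h. \<Sum>i\<in>UNIV. rot s h $ i *\<^sub>R g (rot s x) $ i)) (at x)" .
    moreover have "(\<Sum>i\<in>UNIV. rot s h $ i *\<^sub>R g (rot s x) $ i) = (\<Sum>i\<in>UNIV. h $ i *\<^sub>R k x $ i)" for h
      by (simp add: sum_2 rot_def k_def scaleR_conv_of_real[where 'a = complex] algebra_simps)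
    ultimately show ?thesis by simp
  qed
  show ?thesis
  proof (rule that[of k])
    have "k x = 0" if "R \<le> norm x" for x
      using R[of "rot s x"] that by (simp add: k_def vec_eq_iff)
    then show "C1c_field (\<lambda>x. \<phi> (rot s x)) k"
      unfolding C1c_field_def C1_field_def using ck D R by (auto intro!: exI[of _ R])
    show "angular_deriv k x = angular_deriv g (rot s x)" for x
      by (simp add: angular_deriv_def k_def rot_def algebra_simps)
  qed
qed

lemma rot_increment:
  assumes \<phi>: "C1c_field \<phi> g" and l: "0 \<le> l"
  shows "(LINT s|lborel. indicator {0..l} s *\<^sub>R angular_deriv g (rot (- s) x)) = \<phi> x - \<phi> (rot (- l) x)"
proof -
  have C: "C1_field \<phi> g" using \<phi> by (auto simp: C1c_field_def)
  have crot: "continuous_on UNIV (\<lambda>s. rot (- s) x)"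
    unfolding rot_def by (intro continuous_intros)
  have D: "((\<lambda>s. - \<phi> (rot (- s) x)) has_vector_derivative angular_deriv g (rot (- s) x)) (at s within S)" for s S
  proof -
    define y where "y = rot (- s) x"
    have "((\<lambda>s. rot (- s) x) has_vector_derivative (- perp y)) (at s within S)"
      unfolding rot_def y_def
      by (auto intro!: derivative_eq_intros simp: perp_add perp_diff perp_scaleR perp_perp has_vector_derivative_def fun_eq_iff algebra_simps)
    then have "((\<lambda>s. rot (- s) x) has_derivative (\<lambda>h. h *\<^sub>R (- perp y))) (at s within S)"
      by (simp add: has_vector_derivative_def)
    moreover have "(\<phi> has_derivative (\<lambda>h. \<Sum>i\<in>UNIV. h $ i *\<^sub>R g y $ i)) (at (rot (- s) x))"
      using C by (auto simp: C1_field_def y_def)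
    ultimately have "((\<lambda>s. \<phi> (rot (- s) x)) has_derivative (\<lambda>h. \<Sum>i\<in>UNIV. (h *\<^sub>R (- perp y)) $ i *\<^sub>R g y $ i)) (at s within S)"
      by (rule has_derivative_compose)
    note D = has_derivative_minus[OF this]
    have "- (\<Sum>i\<in>UNIV. (h *\<^sub>R (- perp y)) $ i *\<^sub>R g y $ i) = h *\<^sub>R angular_deriv g y" for h
      by (simp add: sum_2 angular_deriv_def scaleR_conv_of_real[where 'a = complex] algebra_simps)
    with D show ?thesis by (simp add: has_vector_derivative_def y_def[symmetric])
  qed
  have "continuous_on UNIV (angular_deriv g)"
    unfolding angular_deriv_def[abs_def] by (intro continuous_intros C1_field_continuous(2)[OF C])
  then have "continuous_on {0..l} (\<lambda>s. angular_deriv g (rot (- s) x))"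
    by (rule continuous_on_compose2[OF _ continuous_on_subset[OF crot]]) auto
  from has_bochner_integral_FTC_Icc[OF l D this] show ?thesis
    by (auto simp: has_bochner_integral_iff)
qed

section \<open>Almost every rotation orbit\<close>

lemma has_weak_gradient_cong_AE:
  fixes f :: "real^'n \<Rightarrow> complex"
  assumes f: "has_weak_gradient f G" and ae: "AE x in lebesgue. f x = f' x" "AE x in lebesgue. G x = G' x"
    and m: "f' \<in> borel_measurable lebesgue" "G' \<in> borel_measurable lebesgue"
  shows "has_weak_gradient f' G'"
  unfolding has_weak_gradient_def
proof (intro conjI allI impI)
  have fL: "f \<in> L1_loc" and GL: "G \<in> L1_loc" using f by (auto simp: has_weak_gradient_def)
  show f'L: "f' \<in> L1_loc" and G'L: "G' \<in> L1_loc"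
    using L1_loc_cong_AE[OF fL ae(1) m(1)] L1_loc_cong_AE[OF GL ae(2) m(2)] by auto
  fix \<phi> :: "real^'n \<Rightarrow> real" and i assume \<phi>: "test_function \<phi>"
  then have "C1c_field (\<lambda>x. complex_of_real (\<phi> x)) (\<lambda>x. \<chi> i. of_real (partial_deriv i \<phi> x))"
    by (rule C1c_field_test_function)
  then have C1: "C1_field (\<lambda>x. complex_of_real (\<phi> x)) (\<lambda>x. \<chi> i. of_real (partial_deriv i \<phi> x))"
    by (auto simp: C1c_field_def)
  note mm = C1_field_borel(1)[OF C1] C1_field_borel(2)[OF C1, of i, simplified]
  have "(LINT x|lebesgue. f' x * of_real (partial_deriv i \<phi> x)) = (LINT x|lebesgue. f x * of_real (partial_deriv i \<phi> x))"
    by (rule integral_cong_AE) (use ae(1) mm m(1) L1_loc_measurable[OF fL] in \<open>auto intro!: borel_measurable_times\<close>)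
  also have "\<dots> = - (LINT x|lebesgue. G x $ i * of_real (\<phi> x))"
    using f \<phi> unfolding has_weak_gradient_def by blast
  also have "(LINT x|lebesgue. G x $ i * of_real (\<phi> x)) = (LINT x|lebesgue. G' x $ i * of_real (\<phi> x))"
    by (rule integral_cong_AE) (use ae(2) mm L1_loc_measurable[OF L1_loc_component[OF GL]]
        L1_loc_measurable[OF L1_loc_component[OF G'L]] in \<open>auto intro!: borel_measurable_times\<close>)
  finally show "(LINT x|lebesgue. f' x * of_real (partial_deriv i \<phi> x)) =
      - (LINT x|lebesgue. G' x $ i * of_real (\<phi> x))" .
qed

lemma L1_loc_angular_deriv:
  assumes "G \<in> L1_loc" shows "angular_deriv G \<in> L1_loc"
proof -
  have c: "continuous_on UNIV (\<lambda>x. complex_of_real (x $ i))" for i :: 2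
    by (rule C1_field_continuous(1)[OF C1_field_component])
  have "(\<lambda>x. G x $ 2 * of_real (x $ 1)) \<in> L1_loc" "(\<lambda>x. G x $ 1 * of_real (x $ 2)) \<in> L1_loc"
    by (intro L1_loc_times_continuous L1_loc_component assms c)+
  then have "(\<lambda>x. G x $ 2 * of_real (x $ 1) - G x $ 1 * of_real (x $ 2)) \<in> L1_loc"
    by (auto simp: L1_loc_def)
  then show ?thesis by (simp add: angular_deriv_def[abs_def] mult.commute)
qed

lemma integrable_rot_pair_times:
  fixes A k :: "real^2 \<Rightarrow> complex"
  assumes A: "A \<in> borel_measurable borel" "\<And>R. integrable lborel (\<lambda>x. indicator (cball 0 R) x *\<^sub>R A x)"
    and k: "k \<in> borel_measurable borel" "\<And>x. norm (k x) \<le> M" "\<And>x. R \<le> norm x \<Longrightarrow> k x = 0"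
  shows "integrable (lborel \<Otimes>\<^sub>M lborel) (\<lambda>(s, x). indicator {0..l} s *\<^sub>R (A (rot (c * s) x) * k x))"
proof (rule Bochner_Integration.integrable_bound)
  note [measurable] = A(1) k(1)
  define B where "B x = M * norm (indicator (cball 0 R) x *\<^sub>R A x)" for x
  have [measurable]: "B \<in> borel_measurable borel" unfolding B_def
    by (intro borel_measurable_times borel_measurable_const
        measurable_compose[OF _ borel_measurable_norm] borel_measurable_scaleR borel_measurable_indicator A) auto
  show "integrable (lborel \<Otimes>\<^sub>M lborel) (\<lambda>(s, x). indicator {0..l} s * B (rot (c * s) x))"
  proof (rule integrable_rot_pair)
    show "integrable lborel B"
      unfolding B_def using A(2) by (intro integrable_mult_right integrable_norm)
  qed measurable
  have "(\<lambda>p. indicator {0..l} (fst p) *\<^sub>R (A (rot (c * fst p) (snd p)) * k (snd p))) \<in> borel_measurable (lborel \<Otimes>\<^sub>M lborel)"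
    by measurable
  then show "(\<lambda>(s, x). indicator {0..l} s *\<^sub>R (A (rot (c * s) x) * k x)) \<in> borel_measurable (lborel \<Otimes>\<^sub>M lborel)"
    by (simp add: case_prod_beta)
  have "norm (indicator {0..l} s *\<^sub>R (A (rot (c * s) x) * k x)) \<le> norm (indicator {0..l} s * B (rot (c * s) x))" for s :: real and x
  proof (cases "R \<le> norm x")
    case False
    have "norm (A (rot (c * s) x)) * norm (k x) \<le> norm (A (rot (c * s) x)) * \<bar>M\<bar>"
      using k(2)[of x] by (intro mult_left_mono) auto
    with False show ?thesis by (auto simp: B_def norm_mult abs_mult mult.commute indicator_def)
  qed (simp add: k)
  then show "AE p in lborel \<Otimes>\<^sub>M lborel. norm (case p of (s, x) \<Rightarrow> indicator {0..l} s *\<^sub>R (A (rot (c * s) x) * k x)) \<le>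
      norm (case p of (s, x) \<Rightarrow> indicator {0..l} s * B (rot (c * s) x))"
    by (intro AE_I2) (simp add: case_prod_beta)
qed

text \<open>Let \<open>d\<close> be the difference of the two sides. In the integral of \<open>d \<phi>\<close> the rotations are
  moved from \<open>u\<close> to the test function \<open>\<phi>\<close>, where the fundamental theorem of calculus holds
  pointwise (\<open>rot_increment\<close>). The weak identity for the angular derivative, applied to the
  rotated test functions and integrated over the angle, then shows that this integral is
  zero.\<close>
theorem rotation_increment_AE:
  fixes u :: "real^2 \<Rightarrow> complex"
  assumes u: "has_weak_gradient u G" and um: "u \<in> borel_measurable borel" and Gm: "angular_deriv G \<in> borel_measurable borel"
    and l: "0 \<le> l"
  shows "AE x in lborel. u (rot l x) - u x = (LINT s|lborel. indicator {0..l} s *\<^sub>R angular_deriv G (rot s x))"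
proof -
  define A where "A = angular_deriv G"
  have Am [measurable]: "A \<in> borel_measurable borel" using Gm by (simp add: A_def)
  note [measurable] = um
  have uL: "u \<in> L1_loc" and AL: "A \<in> L1_loc"
    using u L1_loc_angular_deriv by (auto simp: has_weak_gradient_def A_def)
  have mleb: "f \<in> borel_measurable borel \<Longrightarrow> f \<in> borel_measurable lebesgue" for f :: "real^2 \<Rightarrow> complex"
    by (auto intro: measurable_completion)
  have intb: "integrable lborel (\<lambda>x. indicator (cball 0 R) x *\<^sub>R f x)" if "f \<in> L1_loc" "f \<in> borel_measurable borel"
    for f :: "real^2 \<Rightarrow> complex" and R
  proof -
    have "integrable lebesgue (\<lambda>x. indicator (cball 0 R) x *\<^sub>R f x)" using that by (auto simp: L1_loc_iff_cball)
    then show ?thesis using that(2) by (subst (asm) integrable_completion) (auto intro!: borel_measurable_scaleR borel_measurable_indicator)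
  qed
  note intA = intb[OF AL Am] and intu = intb[OF uL um]
  define S where "S x = (LINT s|lborel. indicator {0..l} s *\<^sub>R A (rot (1 * s) x))" for x
  have [measurable]: "S \<in> borel_measurable borel"
  proof -
    have "(\<lambda>p. indicator {0..l} (snd p) *\<^sub>R A (rot (1 * snd p) (fst p))) \<in> borel_measurable (lborel \<Otimes>\<^sub>M lborel)"
      by (intro borel_measurable_scaleR measurable_compose[OF _ Am])
        (use measurable_compose[OF measurable_pair_swap' measurable_rot_pair[of 1]] in \<open>auto simp: case_prod_beta\<close>)
    then have "(\<lambda>x. LINT s|lborel. indicator {0..l} s *\<^sub>R A (rot (1 * s) x)) \<in> borel_measurable lborel"
      by (intro lborel.borel_measurable_lebesgue_integral) (simp add: case_prod_beta)
    then show ?thesis by (simp add: S_def[abs_def])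
  qed
  have rotm [measurable]: "rot s \<in> borel_measurable borel" for s
    using lborel_preserving_rot[of s] by (auto simp: lborel_preserving_def)
  have pair: "integrable (lborel \<Otimes>\<^sub>M lborel) (\<lambda>(s, x). indicator {0..l} s *\<^sub>R (A (rot (1 * s) x) * k x))"
    if "k \<in> borel_measurable borel" "\<And>x. norm (k x) \<le> M" "\<And>x. R \<le> norm x \<Longrightarrow> k x = 0" for k M R
    by (rule integrable_rot_pair_times[OF Am intA that])
  have Sk: "integrable lborel (\<lambda>x. S x * k x)"
    "(LINT x|lborel. S x * k x) = (LINT s|lborel. indicator {0..l} s *\<^sub>R (LINT x|lborel. A (rot s x) * k x))"
    if "k \<in> borel_measurable borel" "\<And>x. norm (k x) \<le> M" "\<And>x. R \<le> norm x \<Longrightarrow> k x = 0" for k M R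
  proof -
    have eq: "(LINT s|lborel. indicator {0..l} s *\<^sub>R (A (rot (1 * s) x) * k x)) = S x * k x" for x
      unfolding S_def by (subst integral_mult_left_zero[symmetric]) simp
    note p = pair[OF that]
    have "integrable (lborel \<Otimes>\<^sub>M lborel) (\<lambda>(x, s). indicator {0..l} s *\<^sub>R (A (rot (1 * s) x) * k x))"
      using lborel_pair.integrable_product_swap[OF p] by simp
    from lborel_pair.integrable_fst[OF this] eq show "integrable lborel (\<lambda>x. S x * k x)" by simp
    show "(LINT x|lborel. S x * k x) = (LINT s|lborel. indicator {0..l} s *\<^sub>R (LINT x|lborel. A (rot s x) * k x))"
      using lborel_pair.Fubini_integral[OF p] eq by simp
  qed
  define d where "d x = u (rot l x) - u x - S x" for x
  have [measurable]: "d \<in> borel_measurable borel" unfolding d_def by measurable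
  have "AE x in lebesgue. d x = 0"
  proof (rule AE_eq_0_if_test_integrals_0)
    have "integrable lborel (\<lambda>x. indicator (cball 0 R) x *\<^sub>R u (rot l x))" for R
    proof -
      have "indicator (cball 0 R) (rot l x) = (indicator (cball 0 R) x :: real)" for x
        by (simp add: indicator_def)
      moreover have "(\<lambda>x. indicator (cball 0 R) x *\<^sub>R u x) \<in> borel_measurable borel"
        by (intro borel_measurable_scaleR borel_measurable_indicator um) auto
      ultimately show ?thesis using integral_rot(2)[OF _ intu[of R], of l] by simp
    qed
    moreover have "integrable lborel (\<lambda>x. indicator (cball 0 R) x *\<^sub>R S x)" for R
    proof -
      have "integrable lborel (\<lambda>x. S x * (indicator (cball 0 R) x))"
        by (rule Sk(1)[of _ 1 "R + 1"]) (auto simp: indicator_def)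
      moreover have "S x * indicator (cball 0 R) x = indicator (cball 0 R) x *\<^sub>R S x" for x
        by (simp add: indicator_def)
      ultimately show ?thesis by simp
    qed
    ultimately have "integrable lborel (\<lambda>x. indicator (cball 0 R) x *\<^sub>R d x)" for R
      unfolding d_def scaleR_diff_right using intu by (intro Bochner_Integration.integrable_diff)
    then have "integrable lebesgue (\<lambda>x. indicator (cball 0 R) x *\<^sub>R d x)" for R
      by (subst integrable_completion) auto
    then show "d \<in> L1_loc"
      unfolding L1_loc_iff_cball by (auto intro: mleb)
  next
    fix \<psi> :: "real^2 \<Rightarrow> real" assume "test_function \<psi>"
    then have C: "C1c_field (\<lambda>x. complex_of_real (\<psi> x)) (\<lambda>x. \<chi> i. of_real (partial_deriv i \<psi> x))"
      by (rule C1c_field_test_function)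
    define \<phi> where "\<phi> x = complex_of_real (\<psi> x)" for x
    obtain g where \<phi>: "C1c_field \<phi> g" using C by (auto simp: \<phi>_def[abs_def])
    obtain R where R: "\<And>x. R \<le> norm x \<Longrightarrow> \<phi> x = 0 \<and> g x = 0" and C1: "C1_field \<phi> g"
      using \<phi> by (auto simp: C1c_field_def)
    obtain M where M: "\<And>x. norm (\<phi> x) \<le> M"
      using C1c_field_bounded[OF \<phi>] by metis
    note cont = C1_field_continuous[OF C1]
    have [measurable]: "\<phi> \<in> borel_measurable borel" using cont(1) by (rule borel_measurable_continuous_onI)
    define b where "b = angular_deriv g"
    have cb: "continuous_on UNIV b"
      unfolding b_def angular_deriv_def[abs_def] by (intro continuous_intros cont)
    then have bm [measurable]: "b \<in> borel_measurable borel" by (rule borel_measurable_continuous_onI)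
    have bR: "b x = 0" if "R \<le> norm x" for x using R[OF that] by (simp add: b_def angular_deriv_def)
    have "bounded (b ` cball 0 R)"
      by (intro compact_imp_bounded compact_continuous_image continuous_on_subset[OF cb]) auto
    then obtain N where "\<forall>x\<in>cball 0 R. norm (b x) \<le> N" by (auto simp: bounded_iff)
    then have N: "norm (b x) \<le> \<bar>N\<bar>" for x using bR[of x] by (cases "norm x \<le> R") force+
    have bounded_mult: "integrable lborel (\<lambda>x. f x * k x)"
      if "f \<in> L1_loc" "f \<in> borel_measurable borel" "k \<in> borel_measurable borel" "\<And>x. norm (k x) \<le> M'" "\<And>x. R \<le> norm x \<Longrightarrow> k x = 0"
      for f k :: "real^2 \<Rightarrow> complex" and M'
    proof -
      have "integrable lebesgue (\<lambda>x. f x * k x)"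
        by (rule integrable_L1_loc_times_bounded[OF that(1) mleb[OF that(3)] that(4,5)])
      then show ?thesis using that(2,3) by (subst (asm) integrable_completion) auto
    qed
    have \<phi>rot: "norm (\<phi> (rot s x)) \<le> M" "R \<le> norm x \<Longrightarrow> \<phi> (rot s x) = 0" for s x
      using M[of "rot s x"] R[of "rot s x"] by auto
    have "(LINT x|lborel. u x * (\<phi> x - \<phi> (rot (- l) x))) =
        (LINT x|lborel. (LINT s|lborel. indicator {0..l} s *\<^sub>R (b (rot (- 1 * s) x) * u x)))"
    proof (intro Bochner_Integration.integral_cong refl)
      fix x
      have "u x * (\<phi> x - \<phi> (rot (- l) x)) = (LINT s|lborel. indicator {0..l} s *\<^sub>R b (rot (- s) x)) * u x"
        using rot_increment[OF \<phi> l, of x] by (simp add: b_def mult.commute)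
      also have "\<dots> = (LINT s|lborel. (indicator {0..l} s *\<^sub>R b (rot (- s) x)) * u x)"
        by (rule integral_mult_left_zero[symmetric])
      finally show "u x * (\<phi> x - \<phi> (rot (- l) x)) =
          (LINT s|lborel. indicator {0..l} s *\<^sub>R (b (rot (- 1 * s) x) * u x))" by simp
    qed
    also have "\<dots> = (LINT s|lborel. (LINT x|lborel. indicator {0..l} s *\<^sub>R (b (rot (- 1 * s) x) * u x)))"
    proof (rule lborel_pair.Fubini_integral)
      show "integrable (lborel \<Otimes>\<^sub>M lborel) (\<lambda>(s, x). indicator {0..l} s *\<^sub>R (b (rot (- 1 * s) x) * u x))"
      proof (rule Bochner_Integration.integrable_bound)
        have "integrable (lborel \<Otimes>\<^sub>M lborel) (\<lambda>(s, x). indicator {0..l} s * norm (\<bar>N\<bar> *\<^sub>R (indicator (cball 0 R) x *\<^sub>R u x)))"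
          by (intro integrable_lborel_pair_tensor integrable_norm integrable_scaleR_right intu integrable_real_indicator)
            (auto simp: emeasure_lborel_Icc_eq)
        then show "integrable (lborel \<Otimes>\<^sub>M lborel) (\<lambda>(s, x). indicator {0..l} s * norm (\<bar>N\<bar> *\<^sub>R (indicator (cball 0 R) x *\<^sub>R u x)))" .
        have "(\<lambda>p. indicator {0..l} (fst p) *\<^sub>R (b (rot (- 1 * fst p) (snd p)) * u (snd p))) \<in> borel_measurable (lborel \<Otimes>\<^sub>M lborel)"
          by measurable
        then show "(\<lambda>(s, x). indicator {0..l} s *\<^sub>R (b (rot (- 1 * s) x) * u x)) \<in> borel_measurable (lborel \<Otimes>\<^sub>M lborel)"
          by (simp add: case_prod_beta)
        have "norm (indicator {0..l} s *\<^sub>R (b (rot (- 1 * s) x) * u x)) \<le>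
            norm (indicator {0..l} s * norm (\<bar>N\<bar> *\<^sub>R (indicator (cball 0 R) x *\<^sub>R u x)))" for s :: real and x
        proof (cases "R \<le> norm x")
          case False
          then show ?thesis
            using N[of "rot (- 1 * s) x"] by (auto simp: norm_mult indicator_def intro!: mult_right_mono)
        qed (use bR[of "rot (- 1 * s) x"] in simp)
        then show "AE p in lborel \<Otimes>\<^sub>M lborel. norm (case p of (s, x) \<Rightarrow> indicator {0..l} s *\<^sub>R (b (rot (- 1 * s) x) * u x)) \<le>
            norm (case p of (s, x) \<Rightarrow> indicator {0..l} s * norm (\<bar>N\<bar> *\<^sub>R (indicator (cball 0 R) x *\<^sub>R u x)))"
          by (intro AE_I2) (simp add: case_prod_beta)
      qed
    qed
    also have "\<dots> = (LINT s|lborel. indicator {0..l} s *\<^sub>R (- (LINT x|lborel. A (rot s x) * \<phi> x)))"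
    proof (intro Bochner_Integration.integral_cong refl)
      fix s :: real
      obtain k where k: "C1c_field (\<lambda>x. \<phi> (rot (- s) x)) k" "\<And>x. angular_deriv k x = angular_deriv g (rot (- s) x)"
        using C1c_field_rot[OF \<phi>, of "- s"] by metis
      have "(LINT x|lebesgue. u x * b (rot (- s) x)) = - (LINT x|lebesgue. A x * \<phi> (rot (- s) x))"
        using weak_angular_deriv(1)[OF u k(1)] by (simp add: k(2) b_def A_def)
      then have "(LINT x|lborel. u x * b (rot (- s) x)) = - (LINT x|lborel. A x * \<phi> (rot (- s) x))"
        by (simp add: integral_completion)
      also have "(LINT x|lborel. A x * \<phi> (rot (- s) x)) = (LINT x|lborel. A (rot s x) * \<phi> (rot (- s) (rot s x)))"
        by (rule integral_rot(1)[symmetric]) measurable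
      finally show "(LINT x|lborel. indicator {0..l} s *\<^sub>R (b (rot (- 1 * s) x) * u x)) =
          indicator {0..l} s *\<^sub>R (- (LINT x|lborel. A (rot s x) * \<phi> x))"
        by (simp add: mult.commute)
    qed
    also have "\<dots> = - (LINT x|lborel. S x * \<phi> x)"
      using Sk(2)[of \<phi> M R] M R by simp
    finally have 1: "(LINT x|lborel. u x * (\<phi> x - \<phi> (rot (- l) x))) = - (LINT x|lborel. S x * \<phi> x)" .
    have i1: "integrable lborel (\<lambda>x. u x * \<phi> x)" "integrable lborel (\<lambda>x. u x * \<phi> (rot (- l) x))"
      using M R \<phi>rot by (auto intro!: bounded_mult[OF uL um, of _ M])
    have i2: "integrable lborel (\<lambda>x. u (rot l x) * \<phi> x)" "(LINT x|lborel. u (rot l x) * \<phi> x) = (LINT x|lborel. u x * \<phi> (rot (- l) x))"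
      using integral_rot(2)[OF _ i1(2), of l] integral_rot(1)[of "\<lambda>x. u x * \<phi> (rot (- l) x)" l] by simp_all
    have "(LINT x|lborel. d x * \<phi> x) = (LINT x|lborel. u (rot l x) * \<phi> x) - (LINT x|lborel. u x * \<phi> x) - (LINT x|lborel. S x * \<phi> x)"
      using i1 i2 Sk(1)[of \<phi> M R] M R by (simp add: d_def left_diff_distrib)
    also have "\<dots> = - (LINT x|lborel. u x * (\<phi> x - \<phi> (rot (- l) x))) - (LINT x|lborel. S x * \<phi> x)"
      using i1 i2 by (simp add: right_diff_distrib)
    also have "\<dots> = 0" using 1 by simp
    finally show "(LINT x|lebesgue. d x * of_real (\<psi> x)) = 0"
      by (simp add: integral_completion \<phi>_def[symmetric])
  qed
  then have "AE x in lborel. d x = 0" by (simp add: AE_completion_iff)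
  then show ?thesis
    by eventually_elim (simp add: d_def S_def A_def)
qed

section \<open>The angular current on annuli\<close>

lemma mult_le_half_squares: "a * b \<le> (a\<^sup>2 + b\<^sup>2) / (2 :: real)"
  using sum_squares_bound[of a b] by simp

lemma mult_le_sum_squares: "a * b \<le> a\<^sup>2 + (b\<^sup>2 :: real)"
proof -
  have "0 \<le> a\<^sup>2 + b\<^sup>2" by simp
  then have "(a\<^sup>2 + b\<^sup>2) / 2 \<le> a\<^sup>2 + b\<^sup>2" by simp
  then show ?thesis using mult_le_half_squares[of a b] by (rule order_trans[rotated])
qed

text \<open>Let \<open>J\<^sub>s\<close> be the integral of \<open>cnj (u (rot s x)) A(x) w(x)\<close>; the claim concerns \<open>J\<^sub>0\<close>. The
  mean of \<open>J\<^sub>s\<close> over a full turn is zero, because \<open>A\<close> integrated along a closed orbit is the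
  increment of \<open>u\<close> over a full turn. On the other hand \<open>J\<^sub>s - J\<^sub>0\<close> contains the increment of \<open>u\<close>
  along an arc, that is, an integral of \<open>A\<close>, and is therefore bounded by the integral of
  \<open>|A|^2 w\<close>. This replaces Wirtinger's inequality on the individual circles.\<close>
theorem angular_pairing_bound_borel:
  fixes u A :: "real^2 \<Rightarrow> complex" and w :: "real^2 \<Rightarrow> real"
  assumes [measurable]: "u \<in> borel_measurable borel" "A \<in> borel_measurable borel" "w \<in> borel_measurable borel"
    and inc: "\<And>l. 0 \<le> l \<Longrightarrow> AE x in lborel. u (rot l x) - u x = (LINT s|lborel. indicator {0..l} s *\<^sub>R A (rot s x))"
    and w: "\<And>x. 0 \<le> w x" "\<And>s x. w (rot s x) = w x"
    and u2: "integrable lborel (\<lambda>x. (norm (u x))\<^sup>2 * w x)"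
    and A2: "integrable lborel (\<lambda>x. (norm (A x))\<^sup>2 * w x)"
  shows "norm (LINT x|lborel. cnj (u x) * A x * w x) \<le> 2 * pi * (LINT x|lborel. (norm (A x))\<^sup>2 * w x)"
proof -
  have [measurable]: "cnj \<in> borel_measurable borel"
    by (intro borel_measurable_continuous_onI continuous_intros)
  have rotm [measurable]: "rot s \<in> borel_measurable borel" for s
    using lborel_preserving_rot[of s] by (auto simp: lborel_preserving_def)
  define D where "D = (LINT x|lborel. (norm (A x))\<^sup>2 * w x)"
  define I :: "real \<Rightarrow> real" where "I = indicator {0..2 * pi}"
  have Im [measurable]: "I \<in> borel_measurable borel" by (simp add: I_def)
  have I0: "0 \<le> I s" "I s \<le> 1" for s by (auto simp: I_def indicator_def)
  have intI: "integrable lborel I" unfolding I_def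
    by (intro integrable_real_indicator) (auto simp: emeasure_lborel_Icc_eq)
  have LI: "(LINT s|lborel. I s) = 2 * pi" by (simp add: I_def)
  have rotp [measurable]: "(\<lambda>p. rot (fst p) (snd p)) \<in> borel_measurable (lborel \<Otimes>\<^sub>M lborel)"
    "(\<lambda>p. rot (- fst p) (snd p)) \<in> borel_measurable (lborel \<Otimes>\<^sub>M lborel)"
    using measurable_rot_pair[of 1] measurable_rot_pair[of "- 1"] by simp_all
  have Arot: "integrable lborel (\<lambda>x. (norm (A (rot s x)))\<^sup>2 * w x)" "(LINT x|lborel. (norm (A (rot s x)))\<^sup>2 * w x) = D" for s
    using integral_rot[of "\<lambda>x. (norm (A x))\<^sup>2 * w x" s] A2 by (simp_all add: w(2) D_def)
  have pairA: "integrable (lborel \<Otimes>\<^sub>M lborel) (\<lambda>(s, x). I s * ((norm (A (rot (c * s) x)))\<^sup>2 * w x))" for c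
  proof -
    have "(\<lambda>x. (norm (A x))\<^sup>2 * w x) \<in> borel_measurable borel" by measurable
    from integrable_rot_pair[OF this A2, of "2 * pi" c] show ?thesis
      by (simp add: I_def w(2))
  qed
  have pair0: "integrable (lborel \<Otimes>\<^sub>M lborel) (\<lambda>(s, x). I s * (f x))" if "integrable lborel f" for f :: "real^2 \<Rightarrow> real"
    by (intro integrable_lborel_pair_tensor intI that)
  define J where "J = (LINT x|lborel. cnj (u x) * A x * w x)"
  define Ja where "Ja s = (LINT x|lborel. cnj (u (rot s x)) * A x * w x)" for s
  have int_prod: "integrable lborel (\<lambda>x. cnj (p x) * q x * complex_of_real (w x))"
    if [measurable]: "p \<in> borel_measurable borel" "q \<in> borel_measurable borel"
      and "integrable lborel (\<lambda>x. (norm (p x))\<^sup>2 * w x)" "integrable lborel (\<lambda>x. (norm (q x))\<^sup>2 * w x)"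
    for p q :: "real^2 \<Rightarrow> complex"
  proof (rule Bochner_Integration.integrable_bound)
    show "integrable lborel (\<lambda>x. (norm (p x))\<^sup>2 * w x + (norm (q x))\<^sup>2 * w x)"
      using that by simp
    show "(\<lambda>x. cnj (p x) * q x * complex_of_real (w x)) \<in> borel_measurable lborel" by measurable
    show "AE x in lborel. norm (cnj (p x) * q x * complex_of_real (w x)) \<le> norm ((norm (p x))\<^sup>2 * w x + (norm (q x))\<^sup>2 * w x)"
    proof (rule AE_I2)
      fix x
      have "norm (p x) * norm (q x) \<le> (norm (p x))\<^sup>2 + (norm (q x))\<^sup>2"
        by (rule mult_le_sum_squares)
      then have "norm (p x) * norm (q x) * w x \<le> ((norm (p x))\<^sup>2 + (norm (q x))\<^sup>2) * w x"
        using w(1) by (intro mult_right_mono) auto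
      then show "norm (cnj (p x) * q x * complex_of_real (w x)) \<le> norm ((norm (p x))\<^sup>2 * w x + (norm (q x))\<^sup>2 * w x)"
        using w(1)[of x] by (simp add: norm_mult distrib_right)
    qed
  qed
  have urot: "integrable lborel (\<lambda>x. (norm (u (rot s x)))\<^sup>2 * w x)" for s
    using integral_rot(2)[of "\<lambda>x. (norm (u x))\<^sup>2 * w x" s] u2 by (simp add: w(2))
  have intJ: "integrable lborel (\<lambda>x. cnj (u x) * A x * w x)"
    by (rule int_prod) (use u2 A2 in auto)
  have intJa: "integrable lborel (\<lambda>x. cnj (u (rot s x)) * A x * w x)" for s
    by (rule int_prod) (use urot A2 in auto)
  \<comment> \<open>An integrable majorant for the product of \<open>A(x)\<close> and the increments of \<open>u\<close> along the orbit of \<open>x\<close>.\<close>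
  define P where "P s x = I s * (((norm (A (rot s x)))\<^sup>2 * w x + (norm (A x))\<^sup>2 * w x) / 2)" for s x
  have P0: "0 \<le> P s x" for s x using I0 w(1) by (simp add: P_def)
  have pairP: "integrable (lborel \<Otimes>\<^sub>M lborel) (\<lambda>(s, x). P s x)"
  proof -
    have "integrable (lborel \<Otimes>\<^sub>M lborel) (\<lambda>p. ((\<lambda>(s, x). I s * ((norm (A (rot (1 * s) x)))\<^sup>2 * w x)) p + (\<lambda>(s, x). I s * ((norm (A x))\<^sup>2 * w x)) p) / 2)"
      by (intro integrable_divide Bochner_Integration.integrable_add pairA pair0 A2)
    then show ?thesis by (simp add: P_def case_prod_unfold distrib_left)
  qed
  have pairP': "integrable (lborel \<Otimes>\<^sub>M lborel) (\<lambda>(x, s). P s x)"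
    using lborel_pair.integrable_product_swap[OF pairP] by simp
  have intP: "AE x in lborel. integrable lborel (\<lambda>s. P s x)" "integrable lborel (\<lambda>x. LINT s|lborel. P s x)"
    using lborel_pair.AE_integrable_fst[OF pairP'] lborel_pair.integrable_fst[OF pairP'] by simp_all
  have LP: "(LINT x|lborel. LINT s|lborel. P s x) = 2 * pi * D"
  proof -
    have "(LINT x|lborel. LINT s|lborel. P s x) = (LINT s|lborel. LINT x|lborel. P s x)"
      using lborel_pair.Fubini_integral[OF pairP] by simp
    also have "(\<lambda>s. LINT x|lborel. P s x) = (\<lambda>s. I s * D)"
      unfolding P_def using Arot A2 by (simp add: fun_eq_iff D_def)
    finally show ?thesis by (simp add: LI)
  qed
  have diff: "norm (Ja l - J) \<le> 2 * pi * D" if l: "l \<in> {0..2 * pi}" for l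
  proof -
    have "Ja l - J = (LINT x|lborel. cnj (u (rot l x) - u x) * A x * w x)"
      unfolding Ja_def J_def using intJ intJa[of l]
      by (subst Bochner_Integration.integral_diff[symmetric]) (auto simp: algebra_simps)
    also have "norm \<dots> \<le> (LINT x|lborel. norm (cnj (u (rot l x) - u x) * A x * w x))"
      by (rule integral_norm_bound)
    also have "\<dots> \<le> (LINT x|lborel. LINT s|lborel. P s x)"
    proof (rule integral_mono_AE)
      show "integrable lborel (\<lambda>x. norm (cnj (u (rot l x) - u x) * A x * w x))"
        using Bochner_Integration.integrable_diff[OF intJa[of l] intJ] by (intro integrable_norm) (simp add: algebra_simps)
      have "AE x in lborel. u (rot l x) - u x = (LINT s|lborel. indicator {0..l} s *\<^sub>R A (rot s x))"
        using inc l by simp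
      with intP(1) show "AE x in lborel. norm (cnj (u (rot l x) - u x) * A x * w x) \<le> (LINT s|lborel. P s x)"
      proof eventually_elim
        case (elim x)
        have "norm (cnj (u (rot l x) - u x) * A x * w x) = norm ((LINT s|lborel. indicator {0..l} s *\<^sub>R A (rot s x)) * (A x * w x))"
          unfolding elim(2) norm_mult complex_mod_cnj by simp
        also have "(LINT s|lborel. indicator {0..l} s *\<^sub>R A (rot s x)) * (A x * w x) =
            (LINT s|lborel. (indicator {0..l} s *\<^sub>R A (rot s x)) * (A x * w x))"
          by (rule integral_mult_left_zero[symmetric])
        also have "norm \<dots> \<le> (LINT s|lborel. norm ((indicator {0..l} s *\<^sub>R A (rot s x)) * (A x * w x)))"
          by (rule integral_norm_bound)
        also have "\<dots> \<le> (LINT s|lborel. P s x)"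
        proof (rule integral_mono'[OF elim(1)])
          fix s
          have "indicator {0..l} s * (norm (A (rot s x)) * norm (A x) * w x) \<le> I s * (((norm (A (rot s x)))\<^sup>2 + (norm (A x))\<^sup>2) / 2 * w x)"
            using l w(1) mult_le_half_squares[of "norm (A (rot s x))" "norm (A x)"] unfolding I_def
            by (intro mult_mono mult_right_mono) (auto simp: indicator_def)
          then show "norm ((indicator {0..l} s *\<^sub>R A (rot s x)) * (A x * w x)) \<le> P s x"
            using w(1)[of x] by (simp add: norm_mult P_def mult.assoc distrib_right add_divide_distrib)
        qed (rule P0)
        finally show ?case .
      qed
    qed (rule intP(2))
    finally show ?thesis by (simp add: LP)
  qed
  \<comment> \<open>The rotation is moved from \<open>u\<close> to \<open>A\<close>, as \<open>w\<close> and the measure are invariant.\<close>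
  have Ja_alt: "Ja s = (LINT x|lborel. cnj (u x) * A (rot (- s) x) * w x)" for s
  proof -
    have "(LINT x|lborel. (\<lambda>x. cnj (u x) * A (rot (- s) x) * w x) (rot s x)) = (LINT x|lborel. cnj (u x) * A (rot (- s) x) * w x)"
      by (rule integral_rot(1)) measurable
    then show ?thesis by (simp add: Ja_def w(2))
  qed
  have pairQ: "integrable (lborel \<Otimes>\<^sub>M lborel) (\<lambda>(s, x). I s *\<^sub>R (cnj (u x) * A (rot (- s) x) * w x))"
  proof (rule Bochner_Integration.integrable_bound)
    show "integrable (lborel \<Otimes>\<^sub>M lborel) (\<lambda>p. (\<lambda>(s, x). I s * ((norm (A (rot (- 1 * s) x)))\<^sup>2 * w x)) p + (\<lambda>(s, x). I s * ((norm (u x))\<^sup>2 * w x)) p)"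
      by (intro Bochner_Integration.integrable_add pairA pair0 u2)
    have "(\<lambda>p. I (fst p) *\<^sub>R (cnj (u (snd p)) * A (rot (- fst p) (snd p)) * w (snd p))) \<in> borel_measurable (lborel \<Otimes>\<^sub>M lborel)"
      by measurable
    then show "(\<lambda>(s, x). I s *\<^sub>R (cnj (u x) * A (rot (- s) x) * w x)) \<in> borel_measurable (lborel \<Otimes>\<^sub>M lborel)"
      by (simp add: case_prod_beta)
    have "norm (I s *\<^sub>R (cnj (u x) * A (rot (- s) x) * w x)) \<le> norm (I s * ((norm (A (rot (- 1 * s) x)))\<^sup>2 * w x) + I s * ((norm (u x))\<^sup>2 * w x))" for s x
    proof -
      let ?a = "norm (A (rot (- s) x))" and ?b = "norm (u x)"
      have "?b * ?a \<le> ?a\<^sup>2 + ?b\<^sup>2"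
        using mult_le_sum_squares[of ?b ?a] by (simp only: add.commute)
      then have "I s * (?b * ?a * w x) \<le> I s * ((?a\<^sup>2 + ?b\<^sup>2) * w x)"
        using w(1) I0 by (intro mult_left_mono mult_right_mono) auto
      moreover have "norm (I s *\<^sub>R (cnj (u x) * A (rot (- s) x) * w x)) = I s * (?b * ?a * w x)"
        using I0[of s] w(1)[of x] by (simp add: norm_mult)
      moreover have "0 \<le> I s * (?a\<^sup>2 * w x) + I s * (?b\<^sup>2 * w x)" using I0[of s] w(1)[of x] by simp
      ultimately show ?thesis by (simp add: distrib_left distrib_right)
    qed
    then show "AE p in lborel \<Otimes>\<^sub>M lborel. norm (case p of (s, x) \<Rightarrow> I s *\<^sub>R (cnj (u x) * A (rot (- s) x) * w x)) \<le>
        norm ((\<lambda>(s, x). I s * ((norm (A (rot (- 1 * s) x)))\<^sup>2 * w x)) p + (\<lambda>(s, x). I s * ((norm (u x))\<^sup>2 * w x)) p)"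
      by (intro AE_I2) (simp add: case_prod_beta)
  qed
  have intIJa: "integrable lborel (\<lambda>s. I s *\<^sub>R Ja s)"
    using lborel_pair.integrable_fst[OF pairQ] by (simp add: Ja_alt)
  have zero: "(LINT s|lborel. I s *\<^sub>R Ja s) = 0"
  proof -
    have "(LINT s|lborel. I s *\<^sub>R Ja s) = (LINT x|lborel. LINT s|lborel. I s *\<^sub>R (cnj (u x) * A (rot (- s) x) * w x))"
      using lborel_pair.Fubini_integral[OF pairQ] by (simp add: Ja_alt)
    also have "\<dots> = (LINT x::real^2|lborel. 0)"
    proof (rule integral_cong_AE)
      have "AE x in lborel. u (rot (2 * pi) x) - u x = (LINT s|lborel. indicator {0..2 * pi} s *\<^sub>R A (rot s x))"
        by (rule inc) simp
      then show "AE x in lborel. (LINT s|lborel. I s *\<^sub>R (cnj (u x) * A (rot (- s) x) * w x)) = 0"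
      proof eventually_elim
        case (elim x)
        \<comment> \<open>Substituting \<open>2 * pi - s\<close> for \<open>s\<close> reverses the orientation of the closed orbit.\<close>
        have "(LINT s|lborel. I s *\<^sub>R A (rot (- s) x)) = (LINT s|lborel. I (2 * pi + - 1 * s) *\<^sub>R A (rot (- (2 * pi + - 1 * s)) x))"
          using lborel_integral_real_affine[of "- 1" "\<lambda>s. I s *\<^sub>R A (rot (- s) x)" "2 * pi"] by simp
        also have "\<dots> = (LINT s|lborel. I s *\<^sub>R A (rot s x))"
        proof (intro Bochner_Integration.integral_cong refl)
          fix s
          have "rot (- (2 * pi + - 1 * s)) x = rot s (rot (- (2 * pi)) x)" by (simp add: rot_rot)
          also have "rot (- (2 * pi)) x = x" using rot_neg(1)[of "2 * pi" x] by simp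
          finally show "I (2 * pi + - 1 * s) *\<^sub>R A (rot (- (2 * pi + - 1 * s)) x) = I s *\<^sub>R A (rot s x)"
            by (auto simp: I_def indicator_def)
        qed
        also have "\<dots> = 0" using elim by (simp add: I_def)
        finally have 0: "(LINT s|lborel. I s *\<^sub>R A (rot (- s) x)) = 0" .
        have "(LINT s|lborel. I s *\<^sub>R (cnj (u x) * A (rot (- s) x) * w x)) = (LINT s|lborel. (I s *\<^sub>R A (rot (- s) x)) * (cnj (u x) * w x))"
          by (intro Bochner_Integration.integral_cong refl) (simp add: mult_ac)
        also have "\<dots> = (LINT s|lborel. I s *\<^sub>R A (rot (- s) x)) * (cnj (u x) * w x)"
          by (rule integral_mult_left_zero)
        finally show ?case using 0 by simp
      qed
      have "integrable lborel (\<lambda>x. LINT s|lborel. I s *\<^sub>R (cnj (u x) * A (rot (- s) x) * w x))"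
        using lborel_pair.integrable_snd[OF pairQ] by simp
      then show "(\<lambda>x. LINT s|lborel. I s *\<^sub>R (cnj (u x) * A (rot (- s) x) * w x)) \<in> borel_measurable lborel"
        by (rule borel_measurable_integrable)
    qed simp
    finally show ?thesis by simp
  qed
  have "(2 * pi) *\<^sub>R J = (LINT s|lborel. I s *\<^sub>R J)"
    using LI intI by (subst integral_scaleR_left) auto
  also have "\<dots> = (LINT s|lborel. I s *\<^sub>R J) - (LINT s|lborel. I s *\<^sub>R Ja s)" by (simp add: zero)
  also have "\<dots> = (LINT s|lborel. I s *\<^sub>R J - I s *\<^sub>R Ja s)"
    using intI intIJa by (intro Bochner_Integration.integral_diff[symmetric] integrable_scaleR_left) auto
  finally have "norm ((2 * pi) *\<^sub>R J) = norm (LINT s|lborel. I s *\<^sub>R J - I s *\<^sub>R Ja s)" by simp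
  also have "\<dots> \<le> (LINT s|lborel. norm (I s *\<^sub>R J - I s *\<^sub>R Ja s))" by (rule integral_norm_bound)
  also have "\<dots> \<le> (LINT s|lborel. I s * (2 * pi * D))"
  proof (rule integral_mono')
    show "integrable lborel (\<lambda>s. I s * (2 * pi * D))" using intI by simp
    have "0 \<le> D" unfolding D_def using w(1) by (intro integral_nonneg_AE) auto
    then show "0 \<le> I s * (2 * pi * D)" for s using I0[of s] by simp
    show "norm (I s *\<^sub>R J - I s *\<^sub>R Ja s) \<le> I s * (2 * pi * D)" for s
    proof (cases "s \<in> {0..2 * pi}")
      case True
      then show ?thesis using diff[OF True] by (simp add: I_def norm_minus_commute)
    qed (simp add: I_def)
  qed
  also have "\<dots> = 2 * pi * (2 * pi * D)" using LI by simp
  finally have "norm J \<le> 2 * pi * D" by (simp add: mult_ac)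
  then show ?thesis by (simp add: J_def D_def)
qed

lemma norm_angular_deriv_sq_le: "(norm (angular_deriv G x))\<^sup>2 \<le> (norm x)\<^sup>2 * (norm (G x))\<^sup>2"
proof -
  have "norm (angular_deriv G x) \<le> \<bar>x $ 1\<bar> * norm (G x $ 2) + \<bar>x $ 2\<bar> * norm (G x $ 1)"
    unfolding angular_deriv_def by (rule order_trans[OF norm_triangle_ineq4]) (simp add: norm_mult)
  then have "(norm (angular_deriv G x))\<^sup>2 \<le> (\<bar>x $ 1\<bar> * norm (G x $ 2) + \<bar>x $ 2\<bar> * norm (G x $ 1))\<^sup>2"
    by (intro power_mono) auto
  also have "\<dots> \<le> ((x $ 1)\<^sup>2 + (x $ 2)\<^sup>2) * ((norm (G x $ 1))\<^sup>2 + (norm (G x $ 2))\<^sup>2)"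
  proof -
    have "(a * d + b * c)\<^sup>2 \<le> (a\<^sup>2 + b\<^sup>2) * (c\<^sup>2 + d\<^sup>2)" for a b c d :: real
    proof -
      have "(a\<^sup>2 + b\<^sup>2) * (c\<^sup>2 + d\<^sup>2) = (a * d + b * c)\<^sup>2 + (a * c - b * d)\<^sup>2"
        by (simp add: power2_eq_square algebra_simps)
      then show ?thesis by simp
    qed
    from this[of "\<bar>x $ 1\<bar>" "norm (G x $ 2)" "\<bar>x $ 2\<bar>" "norm (G x $ 1)"] show ?thesis by simp
  qed
  finally show ?thesis by (simp add: norm_sq_2 norm_sq_2_complex)
qed

lemma integrable_lebesgue_iff_lborel:
  fixes f :: "'a::euclidean_space \<Rightarrow> 'b::euclidean_space"
  assumes "f \<in> borel_measurable borel"
  shows "integrable lebesgue f \<longleftrightarrow> integrable lborel f" "(LINT x|lebesgue. f x) = (LINT x|lborel. f x)"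
  using assms by (auto simp: integrable_completion integral_completion)

text \<open>The previous estimate for Borel representatives and the weight \<open>1 / |x|^2\<close> on an annulus,
  where \<open>|\<partial>\<^sub>\<theta> u|^2 \<le> |x|^2 |grad u|^2\<close>.\<close>
theorem angular_pairing_bound:
  fixes u :: "real^2 \<Rightarrow> complex" and s R :: real
  assumes u: "has_weak_gradient u G"
    and u2: "\<And>R. integrable lebesgue (\<lambda>x. indicator (cball 0 R) x * (norm (u x))\<^sup>2)"
    and G2: "integrable lebesgue (\<lambda>x. (norm (G x))\<^sup>2)"
    and s: "1 \<le> s"
  defines "w \<equiv> \<lambda>x. indicator {x. s \<le> norm x \<and> norm x < R} x / (norm x)\<^sup>2"
  shows "integrable lebesgue (\<lambda>x. cnj (u x) * angular_deriv G x * complex_of_real (w x))"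
    "norm (LINT x|lebesgue. cnj (u x) * angular_deriv G x * complex_of_real (w x)) \<le>
      2 * pi * (LINT x|lebesgue. indicator {x. s \<le> norm x} x * (norm (G x))\<^sup>2)"
proof -
  have uL: "u \<in> L1_loc" and GL: "G \<in> L1_loc" using u by (auto simp: has_weak_gradient_def)
  obtain u' where u' [measurable]: "u' \<in> borel_measurable borel" and uae: "AE x in lebesgue. u x = u' x"
    by (rule borel_measurable_lebesgue_version[OF L1_loc_measurable[OF uL]]) (rule that)
  obtain G' where G' [measurable]: "G' \<in> borel_measurable borel" and Gae: "AE x in lebesgue. G x = G' x"
    by (rule borel_measurable_lebesgue_version[OF L1_loc_measurable[OF GL]]) (rule that)
  define A where "A = angular_deriv G'"
  have [measurable]: "cnj \<in> borel_measurable borel"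
    by (intro borel_measurable_continuous_onI continuous_intros)
  have [measurable]: "(\<lambda>x::complex^2. x $ i) \<in> borel_measurable borel" "(\<lambda>x::real^2. x $ i) \<in> borel_measurable borel" for i
    by (intro borel_measurable_continuous_onI continuous_on_component continuous_on_id)+
  have Am [measurable]: "A \<in> borel_measurable borel"
    unfolding A_def angular_deriv_def[abs_def] by measurable
  have hwg: "has_weak_gradient u' G'"
    using u' G' by (intro has_weak_gradient_cong_AE[OF u uae Gae]) (auto intro: measurable_completion)
  have sm: "{x::real^2. s \<le> norm x \<and> norm x < R} \<in> sets borel" "{x::real^2. s \<le> norm x} \<in> sets borel"
    by measurable
  have wm [measurable]: "w \<in> borel_measurable borel"
    unfolding w_def using sm by (intro borel_measurable_divide borel_measurable_indicator) auto
  have w0: "0 \<le> w x" "w x \<le> 1" for x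
  proof -
    show "0 \<le> w x" by (simp add: w_def)
    have "1 / (norm x)\<^sup>2 \<le> 1" if "s \<le> norm x"
    proof -
      have "1 \<le> (norm x)\<^sup>2" using that s by (simp add: one_le_power)
      moreover have "1 / t \<le> 1" if "1 \<le> t" for t :: real using that by simp
      ultimately show ?thesis by blast
    qed
    then show "w x \<le> 1" by (auto simp: w_def indicator_def)
  qed
  have wR: "w x = 0" if "R \<le> norm x" for x using that by (simp add: w_def)
  have wn: "(norm x)\<^sup>2 * w x \<le> indicator {x. s \<le> norm x} x" for x
    using s by (auto simp: w_def indicator_def)
  have u'2: "integrable lborel (\<lambda>x. (norm (u' x))\<^sup>2 * w x)"
  proof -
    have "integrable lebesgue (\<lambda>x. (norm (u' x))\<^sup>2 * w x)"
    proof (rule Bochner_Integration.integrable_bound[OF u2[of R]])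
      show "(\<lambda>x. (norm (u' x))\<^sup>2 * w x) \<in> borel_measurable lebesgue"
        by (rule measurable_completion) measurable
      show "AE x in lebesgue. norm ((norm (u' x))\<^sup>2 * w x) \<le> norm (indicator (cball 0 R) x * (norm (u x))\<^sup>2)"
        using uae
      proof eventually_elim
        case (elim x)
        show ?case
          using w0[of x] wR[of x] by (cases "R \<le> norm x") (auto simp: elim mult_left_le)
      qed
    qed
    then show ?thesis by (subst (asm) integrable_lebesgue_iff_lborel(1)) auto
  qed
  have G'2: "integrable lborel (\<lambda>x. (norm (G' x))\<^sup>2)"
  proof -
    have "integrable lebesgue (\<lambda>x. (norm (G' x))\<^sup>2)"
    proof (rule Bochner_Integration.integrable_bound[OF G2])
      show "(\<lambda>x. (norm (G' x))\<^sup>2) \<in> borel_measurable lebesgue"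
        by (rule measurable_completion) measurable
      show "AE x in lebesgue. norm ((norm (G' x))\<^sup>2) \<le> norm ((norm (G x))\<^sup>2)"
        using Gae by eventually_elim simp
    qed
    then show ?thesis by (subst (asm) integrable_lebesgue_iff_lborel(1)) auto
  qed
  have A_le: "(norm (A x))\<^sup>2 * w x \<le> indicator {x. s \<le> norm x} x * (norm (G' x))\<^sup>2" for x
  proof -
    have "(norm (A x))\<^sup>2 * w x \<le> ((norm x)\<^sup>2 * (norm (G' x))\<^sup>2) * w x"
      unfolding A_def using w0 by (intro mult_right_mono norm_angular_deriv_sq_le) auto
    also have "\<dots> = ((norm x)\<^sup>2 * w x) * (norm (G' x))\<^sup>2" by (simp add: mult_ac)
    also have "\<dots> \<le> indicator {x. s \<le> norm x} x * (norm (G' x))\<^sup>2"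
      by (intro mult_right_mono wn) auto
    finally show ?thesis .
  qed
  have intG': "integrable lborel (\<lambda>x. indicator {x. s \<le> norm x} x * (norm (G' x))\<^sup>2)"
    using integrable_mult_indicator[of "{x. s \<le> norm x}" lborel, OF _ G'2] sm by simp
  have A2: "integrable lborel (\<lambda>x. (norm (A x))\<^sup>2 * w x)"
  proof (rule Bochner_Integration.integrable_bound[OF intG'])
    show "AE x in lborel. norm ((norm (A x))\<^sup>2 * w x) \<le> norm (indicator {x. s \<le> norm x} x * (norm (G' x))\<^sup>2)"
      using A_le w0 by (intro AE_I2) simp
  qed measurable
  have "norm (LINT x|lborel. cnj (u' x) * A x * w x) \<le> 2 * pi * (LINT x|lborel. (norm (A x))\<^sup>2 * w x)"
  proof (rule angular_pairing_bound_borel)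
    show "AE x in lborel. u' (rot l x) - u' x = (LINT s|lborel. indicator {0..l} s *\<^sub>R A (rot s x))" if "0 \<le> l" for l
      unfolding A_def using Am that by (intro rotation_increment_AE[OF hwg]) (auto simp: A_def)
    show "w (rot t x) = w x" for t x by (simp add: w_def indicator_def)
  qed (use w0 u'2 A2 in auto)
  also have "(LINT x|lborel. (norm (A x))\<^sup>2 * w x) \<le> (LINT x|lborel. indicator {x. s \<le> norm x} x * (norm (G' x))\<^sup>2)"
    by (intro integral_mono A2 intG' A_le)
  finally have B: "norm (LINT x|lborel. cnj (u' x) * A x * w x) \<le>
      2 * pi * (LINT x|lborel. indicator {x. s \<le> norm x} x * (norm (G' x))\<^sup>2)"
    by simp
  have I': "integrable lborel (\<lambda>x. cnj (u' x) * A x * complex_of_real (w x))"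
  proof (rule Bochner_Integration.integrable_bound[OF Bochner_Integration.integrable_add[OF u'2 A2]])
    show "AE x in lborel. norm (cnj (u' x) * A x * complex_of_real (w x)) \<le> norm ((norm (u' x))\<^sup>2 * w x + (norm (A x))\<^sup>2 * w x)"
    proof (rule AE_I2)
      fix x
      have "norm (u' x) * norm (A x) \<le> (norm (u' x))\<^sup>2 + (norm (A x))\<^sup>2"
        by (rule mult_le_sum_squares)
      then have "norm (u' x) * norm (A x) * w x \<le> ((norm (u' x))\<^sup>2 + (norm (A x))\<^sup>2) * w x"
        using w0 by (intro mult_right_mono) auto
      then show "norm (cnj (u' x) * A x * complex_of_real (w x)) \<le> norm ((norm (u' x))\<^sup>2 * w x + (norm (A x))\<^sup>2 * w x)"
        using w0[of x] by (simp add: norm_mult distrib_right)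
    qed
  qed measurable
  have m1: "(\<lambda>x. cnj (u' x) * A x * complex_of_real (w x)) \<in> borel_measurable borel" by measurable
  have m2: "(\<lambda>x. indicator {x. s \<le> norm x} x * (norm (G' x))\<^sup>2) \<in> borel_measurable borel"
    using borel_measurable_integrable[OF intG'] by simp
  have aeq: "AE x in lebesgue. cnj (u x) * angular_deriv G x * complex_of_real (w x) = cnj (u' x) * A x * complex_of_real (w x)"
    using uae Gae by eventually_elim (simp add: A_def angular_deriv_def)
  have meas: "(\<lambda>x. cnj (u x) * angular_deriv G x * complex_of_real (w x)) \<in> borel_measurable lebesgue"
  proof (intro borel_measurable_times)
    show "(\<lambda>x. cnj (u x)) \<in> borel_measurable lebesgue"
      by (rule measurable_compose[OF L1_loc_measurable[OF uL]]) measurable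
    show "angular_deriv G \<in> borel_measurable lebesgue"
      by (rule L1_loc_measurable[OF L1_loc_angular_deriv[OF GL]])
    show "(\<lambda>x. complex_of_real (w x)) \<in> borel_measurable lebesgue"
      by (rule measurable_completion) measurable
  qed
  have m1': "(\<lambda>x. cnj (u' x) * A x * complex_of_real (w x)) \<in> borel_measurable lebesgue"
    using m1 by (auto intro: measurable_completion)
  show "integrable lebesgue (\<lambda>x. cnj (u x) * angular_deriv G x * complex_of_real (w x))"
    using I' integrable_cong_AE[OF meas m1' aeq] integrable_lebesgue_iff_lborel(1)[OF m1] by simp
  have "(LINT x|lebesgue. cnj (u x) * angular_deriv G x * complex_of_real (w x)) = (LINT x|lborel. cnj (u' x) * A x * w x)"
    using integral_cong_AE[OF meas m1' aeq] integrable_lebesgue_iff_lborel(2)[OF m1] by simp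
  moreover have "(LINT x|lebesgue. indicator {x. s \<le> norm x} x * (norm (G x))\<^sup>2) =
      (LINT x|lborel. indicator {x. s \<le> norm x} x * (norm (G' x))\<^sup>2)"
  proof -
    have "(LINT x|lebesgue. indicator {x. s \<le> norm x} x * (norm (G x))\<^sup>2) =
        (LINT x|lebesgue. indicator {x. s \<le> norm x} x * (norm (G' x))\<^sup>2)"
    proof (rule integral_cong_AE)
      show "(\<lambda>x. indicator {x. s \<le> norm x} x * (norm (G x))\<^sup>2) \<in> borel_measurable lebesgue"
        using sm borel_measurable_integrable[OF G2]
        by (intro borel_measurable_times borel_measurable_indicator) auto
      show "(\<lambda>x. indicator {x. s \<le> norm x} x * (norm (G' x))\<^sup>2) \<in> borel_measurable lebesgue"
        using m2 by (auto intro: measurable_completion)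
    qed (use Gae in \<open>eventually_elim, simp\<close>)
    then show ?thesis using integrable_lebesgue_iff_lborel(2)[OF m2] by simp
  qed
  ultimately show "norm (LINT x|lebesgue. cnj (u x) * angular_deriv G x * complex_of_real (w x)) \<le>
      2 * pi * (LINT x|lebesgue. indicator {x. s \<le> norm x} x * (norm (G x))\<^sup>2)"
    using B by simp
qed

section \<open>Limits at infinity\<close>

lemma tendsto_integral_escaping:
  fixes k :: "'a \<Rightarrow> real"
  assumes k: "integrable M k" and S: "\<And>R. S R \<in> sets M"
    and esc: "\<And>x. \<forall>\<^sub>F R in at_top. x \<notin> S R"
  shows "((\<lambda>R::real. LINT x|M. indicator (S R) x * k x) \<longlongrightarrow> 0) at_top"
proof -
  note [measurable] = borel_measurable_integrable[OF k] S
  have "((\<lambda>R. LINT x|M. indicator (S R) x * k x) \<longlongrightarrow> (LINT x|M. 0)) at_top"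
  proof (rule integral_dominated_convergence_at_top)
    show "integrable M (\<lambda>x. norm (k x))" using k by (rule integrable_norm)
    show "AE x in M. ((\<lambda>R. indicator (S R) x * k x) \<longlongrightarrow> 0) at_top"
    proof (rule AE_I2)
      fix x
      show "((\<lambda>R. indicator (S R) x * k x) \<longlongrightarrow> 0) at_top"
        by (rule tendsto_eventually) (use esc[of x] in \<open>eventually_elim, simp\<close>)
    qed
    show "\<forall>\<^sub>F R in at_top. AE x in M. norm (indicator (S R) x * k x) \<le> norm (k x)"
      by (intro always_eventually allI AE_I2) (simp add: indicator_def)
    show "(\<lambda>x. indicator (S R) x * k x) \<in> borel_measurable M" for R
      by (intro borel_measurable_times borel_measurable_indicator S borel_measurable_integrable[OF k])
  qed simp
  then show ?thesis by simp
qed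

lemma convergent_at_top_of_Cauchy:
  fixes F T :: "real \<Rightarrow> real"
  assumes C: "\<And>s R. 1 \<le> s \<Longrightarrow> s \<le> R \<Longrightarrow> \<bar>F R - F s\<bar> \<le> T s" and T: "(T \<longlongrightarrow> 0) at_top"
  shows "\<exists>L. (F \<longlongrightarrow> L) at_top"
proof -
  have "Cauchy (\<lambda>n. F (real n))"
  proof (rule CauchyI)
    fix e :: real assume "0 < e"
    then have "\<forall>\<^sub>F s in at_top. T s < e / 2" using T by (intro order_tendstoD) auto
    then obtain b where b: "\<And>s. b \<le> s \<Longrightarrow> T s < e / 2" by (auto simp: eventually_at_top_linorder)
    define N where "N = nat \<lceil>max b 1\<rceil>"
    have N: "b \<le> real N" "1 \<le> real N" unfolding N_def by linarith+
    have "norm (F (real m) - F (real n)) < e" if "N \<le> m" "N \<le> n" for m n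
    proof -
      have "\<bar>F (real m) - F (real N)\<bar> \<le> T (real N)" "\<bar>F (real n) - F (real N)\<bar> \<le> T (real N)"
        using that N by (auto intro!: C)
      then show ?thesis using b[OF N(1)] by (simp only: real_norm_def)
    qed
    then show "\<exists>M. \<forall>m\<ge>M. \<forall>n\<ge>M. norm (F (real m) - F (real n)) < e" by blast
  qed
  then obtain L where L: "(\<lambda>n. F (real n)) \<longlonglongrightarrow> L"
    using Cauchy_convergent convergent_def by blast
  have est: "\<bar>F s - L\<bar> \<le> T s" if "1 \<le> s" for s
  proof (rule tendsto_le[OF sequentially_bot])
    show "(\<lambda>n. T s) \<longlonglongrightarrow> T s" by simp
    show "(\<lambda>n. \<bar>F s - F (real n)\<bar>) \<longlonglongrightarrow> \<bar>F s - L\<bar>" by (intro tendsto_intros L)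
    show "\<forall>\<^sub>F n in sequentially. \<bar>F s - F (real n)\<bar> \<le> T s"
      using eventually_ge_at_top[of "nat \<lceil>s\<rceil>"]
    proof eventually_elim
      case (elim n)
      then have "s \<le> real n" by linarith
      from C[OF that this] show ?case by (simp add: abs_minus_commute)
    qed
  qed
  have "((\<lambda>s. F s - L) \<longlongrightarrow> 0) at_top"
    by (rule Lim_null_comparison[OF _ T])
      (use eventually_ge_at_top[of 1] in \<open>eventually_elim, simp add: est\<close>)
  then show ?thesis using LIM_zero_cancel by blast
qed

section \<open>Convergence of the renormalized energy\<close>

lemma has_weak_gradient_weak_gradient: "weakly_differentiable f \<Longrightarrow> has_weak_gradient f (weak_gradient f)"
  unfolding weakly_differentiable_def using weak_gradient_AE(1) by blast

lemma weak_gradient_measurable: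
  "has_weak_gradient f G \<Longrightarrow> G \<in> borel_measurable lebesgue"
  "has_weak_gradient f G \<Longrightarrow> f \<in> borel_measurable lebesgue"
  unfolding has_weak_gradient_def using L1_loc_measurable by auto

lemma continuous_integrable_ball:
  fixes f :: "real^2 \<Rightarrow> real"
  assumes "continuous_on UNIV f"
  shows "integrable lebesgue (\<lambda>x. indicator (ball 0 r) x * f x)"
proof -
  have "integrable lborel (\<lambda>x. indicator (cball 0 r) x *\<^sub>R f x)"
    by (rule borel_integrable_compact) (auto intro: continuous_on_subset[OF assms])
  then have "integrable lborel (\<lambda>x. indicator (ball 0 r) x *\<^sub>R (indicator (cball 0 r) x *\<^sub>R f x))"
    by (rule integrable_mult_indicator[rotated]) auto
  moreover have "(\<lambda>x. indicator (ball 0 r) x *\<^sub>R (indicator (cball 0 r) x *\<^sub>R f x)) = (\<lambda>x. indicator (ball 0 r) x * f x)"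
    by (auto simp: fun_eq_iff indicator_def)
  ultimately have i: "integrable lborel (\<lambda>x. indicator (ball 0 r) x * f x)" by (simp only:)
  then show ?thesis using borel_measurable_integrable[OF i] by (subst integrable_completion) auto
qed

lemma norm_sq_diff_le: "(norm (a - b))\<^sup>2 \<le> 2 * (norm a)\<^sup>2 + 2 * (norm (b :: 'a::real_normed_vector))\<^sup>2"
proof -
  have "(norm (a - b))\<^sup>2 \<le> (norm a + norm b)\<^sup>2"
    by (intro power_mono norm_triangle_ineq4) auto
  also have "\<dots> \<le> 2 * (norm a)\<^sup>2 + 2 * (norm b)\<^sup>2"
    using sum_squares_bound[of "norm a" "norm b"] by (simp add: power2_sum)
  finally show ?thesis .
qed

lemma norm_sq_add_le: "(norm (a + b))\<^sup>2 \<le> 2 * (norm a)\<^sup>2 + 2 * (norm (b :: 'a::real_normed_vector))\<^sup>2"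
  using norm_sq_diff_le[of a "- b"] by simp

text \<open>With \<open>t = |\<Psi>|^2\<close> this trades \<open>|\<Psi>|^2\<close> for a constant plus an integrable function.\<close>
lemma sq_le_2_plus: "t \<le> 2 + (1 - t)\<^sup>2" for t :: real
proof -
  have "0 \<le> (t - 3 / 2)\<^sup>2" by simp
  then show ?thesis by (simp add: power2_eq_square algebra_simps)
qed

lemma nn_integral_finite_imp_integrable:
  fixes f :: "'a \<Rightarrow> real"
  assumes "f \<in> borel_measurable M" "\<And>x. 0 \<le> f x" "(\<integral>\<^sup>+x. ennreal (f x) \<partial>M) < \<infinity>"
  shows "integrable M f"
  using assms by (intro integrableI_bounded) auto

locale finite_energy = vortex_like +
  fixes \<Psi> :: "real^2 \<Rightarrow> complex"
  assumes \<Psi>_L2: "\<Psi> \<in> L2_loc"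
    and \<Psi>_wd: "weakly_differentiable \<Psi>"
    and U_wd: "weakly_differentiable (\<lambda>y. \<Psi> y * cnj (v y))"
    and H_fin: "(\<integral>\<^sup>+x. ennreal ((norm (weak_gradient (\<lambda>y. \<Psi> y * cnj (v y)) x))\<^sup>2 +
      (1 - (cmod (v x))\<^sup>2) * (norm (weak_gradient \<Psi> x))\<^sup>2) \<partial>lebesgue) < \<infinity>"
    and potential: "integrable lebesgue (\<lambda>x. (1 - (cmod (\<Psi> x))\<^sup>2)\<^sup>2)"
begin

abbreviation "W \<equiv> weak_gradient \<Psi>"
definition "U x = \<Psi> x * cnj (v x)"
definition "GU = weak_gradient U"
text \<open>Everything is estimated by \<open>h\<close>, the density of the squared norm of \<open>H\<close>, by \<open>q\<close>, which is
  four times the potential energy density, and by powers of \<open>weight\<close>.\<close>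
definition "h x = (norm (GU x))\<^sup>2 + (1 - (cmod (v x))\<^sup>2) * (norm (W x))\<^sup>2"
definition "q x = (1 - (cmod (\<Psi> x))\<^sup>2)\<^sup>2"

lemma hW: "has_weak_gradient \<Psi> W"
  using \<Psi>_wd by (rule has_weak_gradient_weak_gradient)

lemma hGU: "has_weak_gradient U GU"
  using has_weak_gradient_weak_gradient[OF U_wd] by (simp add: U_def[abs_def] GU_def)

lemma v_cont: "continuous_on UNIV v" and Dv_cont: "continuous_on UNIV Dv"
  using C1_field_continuous(1)[OF C1] C1 by (auto simp: C1_field_def)

lemma defect_nonneg: "0 \<le> 1 - (cmod (v x))\<^sup>2"
  using norm_le_1[of x] by (simp add: abs_square_le_1)

lemma v_meas [measurable]: "v \<in> borel_measurable lebesgue" "Dv \<in> borel_measurable lebesgue"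
  "weight \<in> borel_measurable lebesgue"
  using v_cont Dv_cont continuous_on_weight
  by (auto intro!: measurable_completion borel_measurable_continuous_onI)

lemma \<Psi>_meas [measurable]: "\<Psi> \<in> borel_measurable lebesgue" "W \<in> borel_measurable lebesgue"
  "U \<in> borel_measurable lebesgue" "GU \<in> borel_measurable lebesgue"
  using weak_gradient_measurable[OF hW] weak_gradient_measurable[OF hGU] by auto

lemma h_nonneg: "0 \<le> h x" and q_nonneg: "0 \<le> q x"
  using defect_nonneg[of x] by (auto simp: h_def q_def)

lemma h_meas [measurable]: "h \<in> borel_measurable lebesgue" and q_meas [measurable]: "q \<in> borel_measurable lebesgue"
  unfolding h_def[abs_def] q_def[abs_def] by measurable

lemma h_integrable: "integrable lebesgue h"
  by (rule nn_integral_finite_imp_integrable[OF h_meas h_nonneg])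
    (use H_fin in \<open>simp add: h_def GU_def U_def[abs_def]\<close>)

lemma q_integrable: "integrable lebesgue q"
  using potential by (simp add: q_def[abs_def])

lemma GU_le_h: "(norm (GU x))\<^sup>2 \<le> h x"
  using defect_nonneg[of x] by (simp add: h_def)

lemma GU_sq_integrable: "integrable lebesgue (\<lambda>x. (norm (GU x))\<^sup>2)"
  by (rule Bochner_Integration.integrable_bound[OF h_integrable]) (use GU_le_h h_nonneg in \<open>auto intro!: AE_I2\<close>)

lemma \<Psi>_sq_le: "(cmod (\<Psi> x))\<^sup>2 \<le> 2 + q x"
  unfolding q_def by (rule sq_le_2_plus)

lemma GU_eq: "AE x in lebesgue. \<forall>i. GU x $ i = W x $ i * cnj (v x) + \<Psi> x * cnj (Dv x $ i)"
proof -
  have "has_weak_gradient U (\<lambda>x. \<chi> i. W x $ i * cnj (v x) + \<Psi> x * (\<chi> i. cnj (Dv x $ i)) $ i)"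
    unfolding U_def[abs_def] by (rule has_weak_gradient_mult_C1[OF hW C1_field_cnj[OF C1]])
  from has_weak_gradient_unique[OF hGU this] show ?thesis
    by eventually_elim (simp add: vec_eq_iff)
qed

text \<open>The part \<open>(1 - |v|^2) |grad \<Psi>|^2\<close> of \<open>|grad \<Psi>|^2\<close> belongs to \<open>h\<close>, and the remaining part
  \<open>|v|^2 |grad \<Psi>|^2\<close> is \<open>|grad U - \<Psi> grad (cnj v)|^2\<close>.\<close>
lemma W_sq_le: "\<exists>C\<ge>0. AE x in lebesgue. (norm (W x))\<^sup>2 \<le> C * (h x + q x + weight x)"
proof -
  obtain C where C: "\<And>x. (norm (Dv x))\<^sup>2 \<le> C * weight x" using Dv_bound by blast
  have "(norm (Dv 0))\<^sup>2 \<le> C" using C[of 0] by (simp add: weight_def)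
  then have C0: "0 \<le> C" by (rule order_trans[rotated]) simp
  have "AE x in lebesgue. (norm (W x))\<^sup>2 \<le> (2 + 4 * C) * (h x + q x + weight x)"
    using GU_eq
  proof eventually_elim
    case (elim x)
    have "(norm (v x))\<^sup>2 * (norm (W x $ i))\<^sup>2 \<le> 2 * (norm (GU x $ i))\<^sup>2 + 2 * ((norm (\<Psi> x))\<^sup>2 * (norm (Dv x $ i))\<^sup>2)" for i
    proof -
      have "(norm (v x))\<^sup>2 * (norm (W x $ i))\<^sup>2 = (norm (GU x $ i - \<Psi> x * cnj (Dv x $ i)))\<^sup>2"
        using elim by (simp add: norm_mult power_mult_distrib mult.commute)
      also have "\<dots> \<le> 2 * (norm (GU x $ i))\<^sup>2 + 2 * (norm (\<Psi> x * cnj (Dv x $ i)))\<^sup>2"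
        by (rule norm_sq_diff_le)
      finally show ?thesis by (simp add: norm_mult power_mult_distrib)
    qed
    from add_mono[OF this[of 1] this[of 2]]
    have "(norm (v x))\<^sup>2 * (norm (W x))\<^sup>2 \<le> 2 * (norm (GU x))\<^sup>2 + 2 * ((norm (\<Psi> x))\<^sup>2 * (norm (Dv x))\<^sup>2)"
      unfolding norm_sq_2_complex by (simp add: algebra_simps)
    moreover have "(norm (\<Psi> x))\<^sup>2 * (norm (Dv x))\<^sup>2 \<le> (2 + q x) * (C * weight x)"
      using C[of x] \<Psi>_sq_le[of x] q_nonneg[of x] by (intro mult_mono) auto
    moreover have "(2 + q x) * (C * weight x) \<le> C * (2 * weight x + q x)"
    proof -
      have "q x * weight x \<le> q x * 1" using q_nonneg[of x] weight_le_1[of x] by (intro mult_left_mono) auto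
      then have "C * (2 * weight x + q x * weight x) \<le> C * (2 * weight x + q x)"
        using C0 by (intro mult_left_mono) auto
      then show ?thesis by (simp add: algebra_simps)
    qed
    moreover have "(norm (W x))\<^sup>2 = (norm (v x))\<^sup>2 * (norm (W x))\<^sup>2 + (1 - (norm (v x))\<^sup>2) * (norm (W x))\<^sup>2"
      by (simp add: algebra_simps)
    moreover have "0 \<le> (1 - (norm (v x))\<^sup>2) * (norm (W x))\<^sup>2" using defect_nonneg[of x] by simp
    moreover have "z \<le> 2 * (g + d) + 2 * n" if "a \<le> 2 * g + 2 * b" "b \<le> m" "m \<le> n" "z = a + d" "0 \<le> d"
      for z g d n a b m :: real using that by argo
    ultimately have "(norm (W x))\<^sup>2 \<le> 2 * h x + 2 * (C * (2 * weight x + q x))"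
      unfolding h_def by blast
    also have "\<dots> \<le> (2 + 4 * C) * (h x + q x + weight x)"
    proof -
      have "0 \<le> C * h x" "0 \<le> C * q x" "0 \<le> q x" "0 \<le> weight x"
        using C0 h_nonneg[of x] q_nonneg[of x] weight_pos[of x] by auto
      then show ?thesis by (simp add: algebra_simps)
    qed
    finally show ?case .
  qed
  then show ?thesis using C0 by (intro exI[of _ "2 + 4 * C"]) auto
qed

lemma gl_density_eq: "gl_density \<Psi> x = 1/2 * (norm (W x))\<^sup>2 + 1/4 * q x"
  by (simp add: gl_density_def q_def)

lemma gl_density_nonneg: "0 \<le> gl_density \<Psi> x"
  using q_nonneg by (simp add: gl_density_eq)

lemma gl_density_meas [measurable]: "gl_density \<Psi> \<in> borel_measurable lebesgue"
  unfolding gl_density_eq[abs_def] by measurable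

lemma gl_density_le: "\<exists>C\<ge>0. AE x in lebesgue. gl_density \<Psi> x \<le> C * (h x + q x + weight x)"
proof -
  obtain C where C0: "C \<ge> 0" and C: "AE x in lebesgue. (norm (W x))\<^sup>2 \<le> C * (h x + q x + weight x)"
    using W_sq_le by blast
  have "AE x in lebesgue. gl_density \<Psi> x \<le> (C + 1) * (h x + q x + weight x)"
    using C
  proof eventually_elim
    case (elim x)
    have "0 \<le> h x" "0 \<le> q x" "0 \<le> weight x" "0 \<le> C * (h x + q x + weight x)"
      using C0 h_nonneg[of x] q_nonneg[of x] weight_pos[of x] by auto
    moreover have "1/2 * a + 1/4 * b \<le> S + T" if "0 \<le> b" "b \<le> T" "0 \<le> S" "a \<le> S" for a b S T :: real
      using that by linarith
    ultimately show ?case using elim unfolding gl_density_eq distrib_right[of C] by simp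
  qed
  then show ?thesis using C0 by (intro exI[of _ "C + 1"]) auto
qed

lemma weight_integrable_ball: "integrable lebesgue (\<lambda>x. indicator (ball 0 r) x * weight x)"
  by (rule continuous_integrable_ball[OF continuous_on_weight])

lemma integrable_times_indicator:
  fixes f :: "real^2 \<Rightarrow> real"
  assumes "integrable lebesgue f" "S \<in> sets lebesgue"
  shows "integrable lebesgue (\<lambda>x. indicator S x * f x)"
  using integrable_mult_indicator[OF assms(2,1)] by simp

lemma gl_density_integrable_ball: "integrable lebesgue (\<lambda>x. indicator (ball 0 r) x * gl_density \<Psi> x)"
proof -
  obtain C where C0: "C \<ge> 0" and C: "AE x in lebesgue. gl_density \<Psi> x \<le> C * (h x + q x + weight x)"
    using gl_density_le by blast
  show ?thesis
  proof (rule Bochner_Integration.integrable_bound)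
    show "integrable lebesgue (\<lambda>x. C * (indicator (ball 0 r) x * h x + indicator (ball 0 r) x * q x + indicator (ball 0 r) x * weight x))"
      by (intro integrable_mult_right Bochner_Integration.integrable_add weight_integrable_ball
          integrable_times_indicator h_integrable q_integrable) auto
    show "(\<lambda>x. indicator (ball 0 r) x * gl_density \<Psi> x) \<in> borel_measurable lebesgue"
      by (intro borel_measurable_times borel_measurable_indicator) auto
    show "AE x in lebesgue. norm (indicator (ball 0 r) x * gl_density \<Psi> x) \<le>
        norm (C * (indicator (ball 0 r) x * h x + indicator (ball 0 r) x * q x + indicator (ball 0 r) x * weight x))"
      using C by eventually_elim (use gl_density_nonneg in \<open>auto simp: indicator_def\<close>)
  qed
qed

lemma weak_gradient_v: "AE x in lebesgue. weak_gradient v x = Dv x"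
  by (rule weak_gradient_AE(2)[OF has_weak_gradient_C1[OF C1]])

definition "ev x = 1/2 * (norm (Dv x))\<^sup>2 + 1/4 * (1 - (cmod (v x))\<^sup>2)\<^sup>2"

lemma gl_density_v: "AE x in lebesgue. gl_density v x = ev x"
  using weak_gradient_v by eventually_elim (simp add: gl_density_def ev_def)

lemma gl_density_v_meas [measurable]: "gl_density v \<in> borel_measurable lebesgue"
proof -
  have "weak_gradient v \<in> borel_measurable lebesgue"
    using weak_gradient_measurable(1)[OF weak_gradient_AE(1)[OF has_weak_gradient_C1[OF C1]]] .
  then show ?thesis unfolding gl_density_def[abs_def] by measurable
qed

lemma gl_density_v_integrable_ball: "integrable lebesgue (\<lambda>x. indicator (ball 0 r) x * gl_density v x)"
proof -
  have "integrable lebesgue (\<lambda>x. indicator (ball 0 r) x * ev x)"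
    unfolding ev_def by (intro continuous_integrable_ball continuous_intros v_cont Dv_cont)
  then show ?thesis
  proof (rule Bochner_Integration.integrable_bound)
    show "(\<lambda>x. indicator (ball 0 r) x * gl_density v x) \<in> borel_measurable lebesgue"
      by (intro borel_measurable_times borel_measurable_indicator) auto
    show "AE x in lebesgue. norm (indicator (ball 0 r) x * gl_density v x) \<le> norm (indicator (ball 0 r) x * ev x)"
      using gl_density_v by eventually_elim simp
  qed
qed

definition "excess x = gl_density \<Psi> x - gl_density v x"

lemma excess_integrable_ball: "integrable lebesgue (\<lambda>x. indicator (ball 0 r) x * excess x)"
  unfolding excess_def right_diff_distrib
  by (intro Bochner_Integration.integrable_diff gl_density_integrable_ball gl_density_v_integrable_ball)

text \<open>The part of the excess density that is of order \<open>|U| |grad U| / |x|\<close>. It is cut off near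
  the origin, where the excess density is integrable anyway.\<close>
definition "current x = indicator {x. 1 \<le> norm x} x * (Im (cnj (U x) * angular_deriv GU x) / (norm x)\<^sup>2)"

definition "remainder x = excess x - current x"

text \<open>The expansion of \<open>|grad \<Psi>|^2 - |grad V|^2\<close> at one point, with \<open>p = V\<close>, \<open>\<psi> = \<Psi>\<close>,
  \<open>w = grad \<Psi>\<close>, \<open>D = grad V\<close>, \<open>g = grad U\<close> and \<open>t = grad \<theta>\<close>. The vector \<open>e = D - \<i> t p\<close> is the
  part of \<open>D\<close> that is not angular.\<close>
lemma remainder_pointwise:
  fixes p \<psi> :: complex and w D E :: "complex^2" and t :: "real^2" and B b :: real
  assumes g: "\<And>i. g $ i = w $ i * cnj p + \<psi> * cnj (D $ i)"
    and E: "\<And>i. norm (D $ i - \<i> * of_real (t $ i) * p) \<le> B"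
    and D2: "(norm D)\<^sup>2 \<le> B" and p1: "norm p \<le> 1" and p2: "1 - (norm p)\<^sup>2 \<le> B"
  defines "hh \<equiv> (norm g)\<^sup>2 + (1 - (norm p)\<^sup>2) * (norm w)\<^sup>2" and "qq \<equiv> (1 - (norm \<psi>)\<^sup>2)\<^sup>2"
  shows "\<bar>1/2 * (norm w)\<^sup>2 + 1/4 * qq - (1/2 * (norm D)\<^sup>2 + 1/4 * (1 - (norm p)\<^sup>2)\<^sup>2)
      - Im (cnj (\<psi> * cnj p) * (of_real (t $ 1) * g $ 1 + of_real (t $ 2) * g $ 2))\<bar>
    \<le> hh + qq + B\<^sup>2 * (3 + qq)"
proof -
  define e where "e i = D $ i - \<i> * of_real (t $ i) * p" for i
  have key: "(norm (w $ i))\<^sup>2 - (norm (D $ i))\<^sup>2 = (1 - (norm p)\<^sup>2) * (norm (w $ i))\<^sup>2 + (norm (g $ i))\<^sup>2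
      - 2 * Re (g $ i * cnj \<psi> * e i) + 2 * Im (cnj (\<psi> * cnj p) * (of_real (t $ i) * g $ i))
      + ((norm \<psi>)\<^sup>2 - 1) * (norm (D $ i))\<^sup>2" for i
  proof -
    have "(norm p)\<^sup>2 * (norm (w $ i))\<^sup>2 = (norm (g $ i - \<psi> * cnj (D $ i)))\<^sup>2"
      using g[of i] by (simp add: norm_mult power_mult_distrib mult.commute)
    also have "\<dots> = (norm (g $ i))\<^sup>2 - 2 * Re (g $ i * cnj \<psi> * D $ i) + (norm \<psi>)\<^sup>2 * (norm (D $ i))\<^sup>2"
      by (simp only: cmod_power2) (simp add: power2_eq_square algebra_simps)
    also have "Re (g $ i * cnj \<psi> * D $ i) = Re (g $ i * cnj \<psi> * e i) - Im (cnj (\<psi> * cnj p) * (of_real (t $ i) * g $ i))"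
      unfolding e_def by (simp add: algebra_simps)
    finally show ?thesis by (simp add: algebra_simps)
  qed
  define X where "X i = Re (g $ i * cnj \<psi> * e i)" for i
  have X: "\<bar>X i\<bar> \<le> 1/2 * (norm (g $ i))\<^sup>2 + 1/2 * (B\<^sup>2 * (2 + qq))" for i
  proof -
    have "\<bar>X i\<bar> \<le> norm (g $ i * cnj \<psi> * e i)" unfolding X_def by (rule abs_Re_le_cmod)
    also have "\<dots> = norm (g $ i) * (norm \<psi> * norm (e i))" by (simp add: norm_mult)
    also have "\<dots> \<le> ((norm (g $ i))\<^sup>2 + (norm \<psi> * norm (e i))\<^sup>2) / 2" by (rule mult_le_half_squares)
    also have "(norm \<psi> * norm (e i))\<^sup>2 \<le> (2 + qq) * B\<^sup>2"
      unfolding power_mult_distrib qq_def using E[of i]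
      by (intro mult_mono sq_le_2_plus power_mono) (auto simp: e_def)
    finally show ?thesis by (simp add: field_simps)
  qed
  define Y where "Y = ((norm \<psi>)\<^sup>2 - 1) * (norm D)\<^sup>2"
  have Y: "\<bar>Y\<bar> \<le> 1/2 * qq + 1/2 * B\<^sup>2"
  proof -
    have "\<bar>Y\<bar> = \<bar>(norm \<psi>)\<^sup>2 - 1\<bar> * (norm D)\<^sup>2" by (simp add: Y_def abs_mult)
    also have "\<dots> \<le> ((\<bar>(norm \<psi>)\<^sup>2 - 1\<bar>)\<^sup>2 + ((norm D)\<^sup>2)\<^sup>2) / 2" by (rule mult_le_half_squares)
    also have "((norm D)\<^sup>2)\<^sup>2 \<le> B\<^sup>2" using D2 by (intro power_mono) auto
    also have "(\<bar>(norm \<psi>)\<^sup>2 - 1\<bar>)\<^sup>2 = qq" by (simp add: qq_def power2_commute)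
    finally show ?thesis by (simp add: field_simps)
  qed
  define Z where "Z = (1 - (norm p)\<^sup>2)\<^sup>2"
  have p0: "0 \<le> 1 - (norm p)\<^sup>2" using p1 by (simp add: abs_square_le_1)
  have Z: "0 \<le> Z" "Z \<le> B\<^sup>2" unfolding Z_def using p0 p2 by (auto intro: power_mono)
  define I where "I i = Im (cnj (\<psi> * cnj p) * (of_real (t $ i) * g $ i))" for i
  have "(norm w)\<^sup>2 - (norm D)\<^sup>2 = (1 - (norm p)\<^sup>2) * (norm w)\<^sup>2 + (norm g)\<^sup>2 - 2 * (X 1 + X 2) + 2 * (I 1 + I 2) + Y"
    unfolding norm_sq_2_complex Y_def X_def I_def using key[of 1] key[of 2] by (simp add: algebra_simps)
  then have main: "(norm w)\<^sup>2 - (norm D)\<^sup>2 = hh - 2 * (X 1 + X 2) + 2 * (I 1 + I 2) + Y" by (simp add: hh_def)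
  have II: "Im (cnj (\<psi> * cnj p) * (of_real (t $ 1) * g $ 1 + of_real (t $ 2) * g $ 2)) = I 1 + I 2"
    by (simp add: I_def distrib_left del: complex_cnj_mult)
  have g2: "(norm (g $ 1))\<^sup>2 + (norm (g $ 2))\<^sup>2 \<le> hh"
    using p0 by (simp add: hh_def norm_sq_2_complex[of g])
  have hh0: "0 \<le> hh" and qq0: "0 \<le> qq" using p0 by (simp_all add: hh_def qq_def)
  have "B\<^sup>2 * (3 + qq) = B\<^sup>2 * (2 + qq) + B\<^sup>2" by (simp add: algebra_simps)
  moreover have "\<bar>1/2 * w2 + 1/4 * r - (1/2 * d2 + 1/4 * z) - i\<bar> \<le> k + r + Q"
    if "Q = P + b" "w2 - d2 = k - 2 * (x1 + x2) + 2 * i + y" "\<bar>x1\<bar> \<le> 1/2 * g1 + 1/2 * P"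
      "\<bar>x2\<bar> \<le> 1/2 * g2 + 1/2 * P" "\<bar>y\<bar> \<le> 1/2 * r + 1/2 * b" "0 \<le> z" "z \<le> b" "g1 + g2 \<le> k" "0 \<le> r" "0 \<le> k"
    for w2 r d2 z i k Q P b x1 x2 y g1 g2 :: real
  proof -
    have "1/2 * w2 + 1/4 * r - (1/2 * d2 + 1/4 * z) - i = 1/2 * k - x1 - x2 + 1/2 * y + 1/4 * r - 1/4 * z"
      using that(2) by argo
    moreover have "\<bar>1/2 * k - x1 - x2 + 1/2 * y + 1/4 * r - 1/4 * z\<bar> \<le> 1/2 * k + \<bar>x1\<bar> + \<bar>x2\<bar> + 1/2 * \<bar>y\<bar> + 1/4 * r + 1/4 * z"
      using that(6,9) that(10) by linarith
    ultimately show ?thesis using that(1,3-9) by argo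
  qed
  ultimately show ?thesis
    unfolding II Z_def[symmetric] using main X[of 1] X[of 2] Y Z g2 qq0 hh0 by blast
qed

lemma remainder_le: "\<exists>C\<ge>0. AE x in lebesgue. 1 \<le> norm x \<longrightarrow> \<bar>remainder x\<bar> \<le> C * (h x + q x + (weight x)\<^sup>2)"
proof -
  obtain C1 where C1: "\<And>x. (norm (Dv x))\<^sup>2 \<le> C1 * weight x" using Dv_bound by blast
  obtain C2 where C2: "\<And>x. 1 - (norm (v x))\<^sup>2 \<le> C2 * weight x" using defect by blast
  obtain C3 where C3: "\<And>x i. 1 \<le> norm x \<Longrightarrow>
      norm (Dv x $ i - \<i> * of_real (perp x $ i / (norm x)\<^sup>2) * v x) \<le> C3 * weight x"
    using Dv_angular by blast
  define K where "K = \<bar>C1\<bar> + \<bar>C2\<bar> + \<bar>C3\<bar>"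
  have K0: "0 \<le> K" by (simp add: K_def)
  have KC: "C1 * weight x \<le> K * weight x" "C2 * weight x \<le> K * weight x" "C3 * weight x \<le> K * weight x" for x
    using weight_pos[of x] unfolding K_def by (auto intro!: mult_right_mono)
  have "AE x in lebesgue. 1 \<le> norm x \<longrightarrow> \<bar>remainder x\<bar> \<le> (1 + 3 * K\<^sup>2) * (h x + q x + (weight x)\<^sup>2)"
    using GU_eq gl_density_v
  proof eventually_elim
    case (elim x)
    show ?case
    proof
      assume x: "1 \<le> norm x"
      define t :: "real^2" where "t = (\<chi> i. perp x $ i / (norm x)\<^sup>2)"
      have t: "t $ i = perp x $ i / (norm x)\<^sup>2" for i by (simp add: t_def)
      define B where "B = K * weight x"
      have rem: "remainder x = 1/2 * (norm (W x))\<^sup>2 + 1/4 * (1 - (norm (\<Psi> x))\<^sup>2)\<^sup>2 - (1/2 * (norm (Dv x))\<^sup>2 + 1/4 * (1 - (norm (v x))\<^sup>2)\<^sup>2)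
        - Im (cnj (\<Psi> x * cnj (v x)) * (of_real (t $ 1) * GU x $ 1 + of_real (t $ 2) * GU x $ 2))"
      proof -
        have "of_real (t $ 1) * GU x $ 1 + of_real (t $ 2) * GU x $ 2 = angular_deriv GU x / of_real ((norm x)\<^sup>2)"
          using x by (simp add: t angular_deriv_def add_divide_distrib diff_divide_distrib)
        then have "Im (cnj (\<Psi> x * cnj (v x)) * (of_real (t $ 1) * GU x $ 1 + of_real (t $ 2) * GU x $ 2)) =
            Im (cnj (U x) * angular_deriv GU x / of_real ((norm x)\<^sup>2))"
          by (simp add: U_def)
        also have "\<dots> = Im (cnj (U x) * angular_deriv GU x) / (norm x)\<^sup>2"
          by (rule Im_divide_of_real)
        finally show ?thesis
          using x elim(2) by (simp add: remainder_def excess_def current_def gl_density_eq q_def ev_def)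
      qed
      have "\<bar>remainder x\<bar> \<le> ((norm (GU x))\<^sup>2 + (1 - (norm (v x))\<^sup>2) * (norm (W x))\<^sup>2) + (1 - (norm (\<Psi> x))\<^sup>2)\<^sup>2
          + B\<^sup>2 * (3 + (1 - (norm (\<Psi> x))\<^sup>2)\<^sup>2)"
        unfolding rem
      proof (rule remainder_pointwise)
        show "GU x $ i = W x $ i * cnj (v x) + \<Psi> x * cnj (Dv x $ i)" for i using elim(1) by simp
        show "norm (Dv x $ i - \<i> * of_real (t $ i) * v x) \<le> B" for i
          using C3[OF x, of i] KC(3)[of x] by (simp add: t B_def)
        show "(norm (Dv x))\<^sup>2 \<le> B" using C1[of x] KC(1)[of x] by (simp add: B_def)
        show "1 - (norm (v x))\<^sup>2 \<le> B" using C2[of x] KC(2)[of x] by (simp add: B_def)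
      qed (rule norm_le_1)
      then have "\<bar>remainder x\<bar> \<le> h x + q x + B\<^sup>2 * (3 + q x)" by (simp add: h_def q_def)
      also have "B\<^sup>2 * (3 + q x) \<le> 3 * K\<^sup>2 * (weight x)\<^sup>2 + K\<^sup>2 * q x"
      proof -
        have "(weight x)\<^sup>2 \<le> 1" using weight_pos[of x] weight_le_1[of x] by (simp add: power_le_one)
        then have "(weight x)\<^sup>2 * q x \<le> 1 * q x" using q_nonneg[of x] by (intro mult_right_mono) auto
        then have "K\<^sup>2 * ((weight x)\<^sup>2 * q x) \<le> K\<^sup>2 * q x" by (intro mult_left_mono) auto
        then show ?thesis by (simp add: B_def power_mult_distrib algebra_simps)
      qed
      also have "h x + q x + (3 * K\<^sup>2 * (weight x)\<^sup>2 + K\<^sup>2 * q x) \<le> (1 + 3 * K\<^sup>2) * (h x + q x + (weight x)\<^sup>2)"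
      proof -
        have "0 \<le> K\<^sup>2 * h x" "0 \<le> K\<^sup>2 * q x" "0 \<le> (weight x)\<^sup>2"
          using h_nonneg[of x] q_nonneg[of x] by auto
        then show ?thesis by (simp add: algebra_simps)
      qed
      finally show "\<bar>remainder x\<bar> \<le> (1 + 3 * K\<^sup>2) * (h x + q x + (weight x)\<^sup>2)" by simp
    qed
  qed
  then show ?thesis by (intro exI[of _ "1 + 3 * K\<^sup>2"]) auto
qed

lemma current_meas: "current \<in> borel_measurable lebesgue"
proof -
  have GUL: "GU \<in> L1_loc" using hGU by (auto simp: has_weak_gradient_def)
  have [measurable]: "angular_deriv GU \<in> borel_measurable lebesgue"
    by (rule L1_loc_measurable[OF L1_loc_angular_deriv[OF GUL]])
  have "cnj \<in> borel_measurable borel" by (intro borel_measurable_continuous_onI continuous_intros)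
  note [measurable] = measurable_compose[OF \<Psi>_meas(3) this]
  have [measurable]: "(\<lambda>x::real^2. (norm x)\<^sup>2) \<in> borel_measurable lebesgue"
    by (rule measurable_completion) measurable
  have [measurable]: "(\<lambda>x. indicator {x::real^2. 1 \<le> norm x} x :: real) \<in> borel_measurable lebesgue"
  proof (rule borel_measurable_indicator)
    have "{x::real^2. 1 \<le> norm x} \<in> sets borel" by measurable
    then show "{x::real^2. 1 \<le> norm x} \<in> sets lebesgue" by simp
  qed
  have "(\<lambda>x. cnj (U x) * angular_deriv GU x) \<in> borel_measurable lebesgue" by measurable
  from measurable_compose[OF this borel_measurable_Im]
  have [measurable]: "(\<lambda>x. Im (cnj (U x) * angular_deriv GU x)) \<in> borel_measurable lebesgue" .
  show ?thesis unfolding current_def[abs_def] by (intro borel_measurable_times borel_measurable_divide) measurable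
qed

lemma remainder_integrable: "integrable lebesgue remainder"
proof -
  obtain C where C0: "C \<ge> 0" and C: "AE x in lebesgue. 1 \<le> norm x \<longrightarrow> \<bar>remainder x\<bar> \<le> C * (h x + q x + (weight x)\<^sup>2)"
    using remainder_le by blast
  show ?thesis
  proof (rule Bochner_Integration.integrable_bound)
    show "integrable lebesgue (\<lambda>x. \<bar>indicator (ball 0 1) x * excess x\<bar> + C * (h x + q x + (weight x)\<^sup>2))"
      by (intro Bochner_Integration.integrable_add integrable_abs excess_integrable_ball integrable_mult_right
          h_integrable q_integrable integrable_weight_sq)
    show "remainder \<in> borel_measurable lebesgue"
      unfolding remainder_def[abs_def] excess_def using current_meas by measurable
    show "AE x in lebesgue. norm (remainder x) \<le> norm (\<bar>indicator (ball 0 1) x * excess x\<bar> + C * (h x + q x + (weight x)\<^sup>2))"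
      using C
    proof eventually_elim
      case (elim x)
      have nn: "0 \<le> C * (h x + q x + (weight x)\<^sup>2)"
        using C0 h_nonneg[of x] q_nonneg[of x] by (intro mult_nonneg_nonneg) auto
      show ?case
      proof (cases "1 \<le> norm x")
        case True
        with elim nn show ?thesis by simp
      next
        case False
        then have "remainder x = excess x" by (simp add: remainder_def current_def)
        with False nn show ?thesis by simp
      qed
    qed
  qed
qed

lemma current_integrable_ball: "integrable lebesgue (\<lambda>x. indicator (ball 0 r) x * current x)"
proof -
  have "integrable lebesgue (\<lambda>x. indicator (ball 0 r) x * excess x - indicator (ball 0 r) x * remainder x)"
    by (intro Bochner_Integration.integrable_diff excess_integrable_ball integrable_times_indicator remainder_integrable) auto
  then show ?thesis by (simp add: remainder_def right_diff_distrib)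
qed

lemma U_sq_integrable: "integrable lebesgue (\<lambda>x. indicator (cball 0 R) x * (norm (U x))\<^sup>2)"
proof -
  have "integrable lebesgue (\<lambda>x. indicator (cball 0 R) x * (cmod (\<Psi> x))\<^sup>2)"
    using \<Psi>_L2 compact_cball[of "0 :: real^2" R] by (auto simp: L2_loc_def set_integrable_def)
  then show ?thesis
  proof (rule Bochner_Integration.integrable_bound)
    show "(\<lambda>x. indicator (cball 0 R) x * (norm (U x))\<^sup>2) \<in> borel_measurable lebesgue"
      by (intro borel_measurable_times borel_measurable_indicator) auto
    have "(norm (U x))\<^sup>2 \<le> (cmod (\<Psi> x))\<^sup>2" for x
    proof (intro power_mono)
      have "cmod (\<Psi> x) * cmod (v x) \<le> cmod (\<Psi> x) * 1" using norm_le_1 by (intro mult_left_mono) auto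
      then show "norm (U x) \<le> cmod (\<Psi> x)" by (simp add: U_def norm_mult)
    qed auto
    then show "AE x in lebesgue. norm (indicator (cball 0 R) x * (norm (U x))\<^sup>2) \<le> norm (indicator (cball 0 R) x * (cmod (\<Psi> x))\<^sup>2)"
      by (intro AE_I2) (auto simp: indicator_def)
  qed
qed

text \<open>The Cauchy criterion for the integrals of the current.\<close>
lemma current_shell:
  assumes "1 \<le> s" "s \<le> R"
  shows "\<bar>(LINT x|lebesgue. indicator (ball 0 R) x * current x) - (LINT x|lebesgue. indicator (ball 0 s) x * current x)\<bar>
    \<le> 2 * pi * (LINT x|lebesgue. indicator {x. s \<le> norm x} x * (norm (GU x))\<^sup>2)"
proof -
  define w where "w x = indicator {x. s \<le> norm x \<and> norm x < R} x / (norm x)\<^sup>2" for x :: "real^2"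
  note B = angular_pairing_bound[OF hGU U_sq_integrable GU_sq_integrable assms(1), of R, folded w_def[abs_def], unfolded w_def[symmetric]]
  have "(LINT x|lebesgue. indicator (ball 0 R) x * current x) - (LINT x|lebesgue. indicator (ball 0 s) x * current x) =
      (LINT x|lebesgue. indicator (ball 0 R) x * current x - indicator (ball 0 s) x * current x)"
    by (intro Bochner_Integration.integral_diff[symmetric] current_integrable_ball)
  also have "\<dots> = (LINT x|lebesgue. Im (cnj (U x) * angular_deriv GU x * complex_of_real (w x)))"
  proof (intro Bochner_Integration.integral_cong refl)
    fix x :: "real^2"
    have "Im (cnj (U x) * angular_deriv GU x * complex_of_real (w x)) = Im (cnj (U x) * angular_deriv GU x) * w x"
      by simp
    then show "indicator (ball 0 R) x * current x - indicator (ball 0 s) x * current x =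
        Im (cnj (U x) * angular_deriv GU x * complex_of_real (w x))"
      using assms by (auto simp: current_def w_def indicator_def)
  qed
  also have "\<dots> = Im (LINT x|lebesgue. cnj (U x) * angular_deriv GU x * complex_of_real (w x))"
    using integral_Im[OF B(1)] by simp
  also have "\<bar>\<dots>\<bar> \<le> norm (LINT x|lebesgue. cnj (U x) * angular_deriv GU x * complex_of_real (w x))"
    by (rule abs_Im_le_cmod)
  finally show ?thesis using B(2) by linarith
qed

definition "energy r = (LINT x|lebesgue. indicator (ball 0 r) x * excess x)"

text \<open>The remainder is integrable, and the integrals of the current converge by the Cauchy
  criterion, as \<open>|grad U|^2\<close> is integrable.\<close>
theorem energy_converges: "\<exists>L. (energy \<longlongrightarrow> L) at_top"
proof -
  have escape: "\<forall>\<^sub>F R in at_top. x \<notin> {x. R \<le> norm x}" for x :: "real^2"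
    using eventually_gt_at_top[of "norm x"] by eventually_elim simp
  have sets: "{x::real^2. R \<le> norm x} \<in> sets lebesgue" for R
  proof -
    have "{x::real^2. R \<le> norm x} \<in> sets borel" by measurable
    then show ?thesis by simp
  qed
  have "((\<lambda>s. 2 * pi * (LINT x|lebesgue. indicator {x. s \<le> norm x} x * (norm (GU x))\<^sup>2)) \<longlongrightarrow> 2 * pi * 0) at_top"
    by (intro tendsto_mult tendsto_const tendsto_integral_escaping GU_sq_integrable sets escape)
  then have T0: "((\<lambda>s. 2 * pi * (LINT x|lebesgue. indicator {x. s \<le> norm x} x * (norm (GU x))\<^sup>2)) \<longlongrightarrow> 0) at_top"
    by simp
  have "\<exists>L1. ((\<lambda>R. LINT x|lebesgue. indicator (ball 0 R) x * current x) \<longlongrightarrow> L1) at_top"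
    by (rule convergent_at_top_of_Cauchy[OF _ T0]) (rule current_shell)
  then obtain L1 where L1: "((\<lambda>R. LINT x|lebesgue. indicator (ball 0 R) x * current x) \<longlongrightarrow> L1) at_top" ..
  have L2: "((\<lambda>R. LINT x|lebesgue. indicator (ball 0 R) x * remainder x) \<longlongrightarrow> (LINT x|lebesgue. remainder x)) at_top"
  proof (rule integral_dominated_convergence_at_top)
    show "integrable lebesgue (\<lambda>x. norm (remainder x))" using remainder_integrable by (rule integrable_norm)
    show "remainder \<in> borel_measurable lebesgue" using remainder_integrable by (rule borel_measurable_integrable)
    then show "(\<lambda>x. indicator (ball 0 R) x * remainder x) \<in> borel_measurable lebesgue" for R
      by (intro borel_measurable_times borel_measurable_indicator) auto
    show "AE x in lebesgue. ((\<lambda>R. indicator (ball 0 R) x * remainder x) \<longlongrightarrow> remainder x) at_top"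
    proof (rule AE_I2)
      fix x
      show "((\<lambda>R. indicator (ball 0 R) x * remainder x) \<longlongrightarrow> remainder x) at_top"
        by (rule tendsto_eventually) (use eventually_gt_at_top[of "norm x"] in \<open>eventually_elim, simp\<close>)
    qed
    show "\<forall>\<^sub>F R in at_top. AE x in lebesgue. norm (indicator (ball 0 R) x * remainder x) \<le> norm (remainder x)"
      by (intro always_eventually allI AE_I2) (simp add: indicator_def)
  qed
  have "energy = (\<lambda>R. (LINT x|lebesgue. indicator (ball 0 R) x * remainder x) + (LINT x|lebesgue. indicator (ball 0 R) x * current x))"
  proof
    fix R
    have "energy R = (LINT x|lebesgue. indicator (ball 0 R) x * remainder x + indicator (ball 0 R) x * current x)"
      by (simp add: energy_def remainder_def algebra_simps)
    also have "\<dots> = (LINT x|lebesgue. indicator (ball 0 R) x * remainder x) + (LINT x|lebesgue. indicator (ball 0 R) x * current x)"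
      by (intro Bochner_Integration.integral_add current_integrable_ball integrable_times_indicator remainder_integrable) auto
    finally show "energy R = (LINT x|lebesgue. indicator (ball 0 R) x * remainder x) + (LINT x|lebesgue. indicator (ball 0 R) x * current x)" .
  qed
  then show ?thesis using tendsto_add[OF L2 L1] by auto
qed

end

context finite_energy
begin

section \<open>Translations and phase shifts\<close>

definition "moved a c x = c * \<Psi> (x + a)"

lemma translate_weak_gradient:
  "has_weak_gradient (moved a c) (\<lambda>x. \<chi> i. c * W (x + a) $ i)"
  unfolding moved_def by (rule has_weak_gradient_cmult[OF has_weak_gradient_translate[OF hW]])

lemma AE_translate: "(AE x in lebesgue. P x) \<Longrightarrow> (AE x in lebesgue. P (x + a))" for P :: "real^2 \<Rightarrow> bool"
  by (rule AE_lborel_preserving[OF lborel_preserving_plus])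

lemma norm_cmult_vec: "norm (\<chi> i. c * (w :: complex^2) $ i) = norm c * norm w"
proof -
  have "(norm (\<chi> i. c * w $ i))\<^sup>2 = (norm c * norm w)\<^sup>2"
    by (simp add: norm_sq_2_complex norm_mult power_mult_distrib distrib_left)
  then show ?thesis by simp
qed

lemma translate_gl_density:
  assumes c: "norm c = 1"
  shows "AE x in lebesgue. gl_density (moved a c) x = gl_density \<Psi> (x + a)"
  using weak_gradient_AE(2)[OF translate_weak_gradient[of a c]]
  by eventually_elim (simp add: gl_density_def norm_cmult_vec moved_def norm_mult c)

lemma translate_L2_loc:
  assumes c: "norm c = 1"
  shows "moved a c \<in> L2_loc"
proof -
  have m: "moved a c \<in> borel_measurable lebesgue"
    using weak_gradient_measurable(2)[OF translate_weak_gradient] .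
  have "(\<lambda>x. (cmod (\<Psi> x))\<^sup>2) \<in> L1_loc"
    using \<Psi>_L2 by (auto simp: L2_loc_def L1_loc_def)
  from L1_loc_translate[OF this, of a] show ?thesis
    using m by (auto simp: L2_loc_def L1_loc_def moved_def norm_mult c)
qed

lemma translate_U_weak_gradient:
  "has_weak_gradient (\<lambda>y. moved a c y * cnj (v y))
    (\<lambda>x. \<chi> i. c * W (x + a) $ i * cnj (v x) + moved a c x * cnj (Dv x $ i))"
  using has_weak_gradient_mult_C1[OF translate_weak_gradient C1_field_cnj[OF C1], of a c] by simp

text \<open>The gradient of \<open>\<Psi>(x + a) cnj (v x)\<close> is compared with the translated gradient \<open>g\<close> of \<open>U\<close>,
  in which \<open>p' = v (x + a)\<close> and \<open>D' = Dv (x + a)\<close> take the places of \<open>p\<close> and \<open>D\<close>.\<close>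
lemma translate_gradient_pointwise:
  fixes p p' \<psi> c :: complex and w D D' g :: "complex^2"
  assumes g: "\<And>i. g $ i = w $ i * cnj p' + \<psi> * cnj (D' $ i)" and c: "norm c = 1"
  shows "(norm (\<chi> i. c * w $ i * cnj p + c * \<psi> * cnj (D $ i)))\<^sup>2 \<le>
    2 * (norm g)\<^sup>2 + 4 * ((norm (p' - p))\<^sup>2 * (norm w)\<^sup>2 + (norm \<psi>)\<^sup>2 * (norm (D' - D))\<^sup>2)"
proof -
  have "(norm (c * w $ i * cnj p + c * \<psi> * cnj (D $ i)))\<^sup>2 \<le>
    2 * (norm (g $ i))\<^sup>2 + 4 * ((norm (p' - p))\<^sup>2 * (norm (w $ i))\<^sup>2 + (norm \<psi>)\<^sup>2 * (norm ((D' - D) $ i))\<^sup>2)" for i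
  proof -
    define a where "a = w $ i * cnj (p' - p)"
    define b where "b = \<psi> * cnj (D' $ i - D $ i)"
    have "c * w $ i * cnj p + c * \<psi> * cnj (D $ i) = c * (g $ i - (a + b))"
      unfolding a_def b_def g by (simp add: algebra_simps)
    then have "(norm (c * w $ i * cnj p + c * \<psi> * cnj (D $ i)))\<^sup>2 = (norm (g $ i - (a + b)))\<^sup>2"
      using c by (simp add: norm_mult)
    also have "\<dots> \<le> 2 * (norm (g $ i))\<^sup>2 + 2 * (norm (a + b))\<^sup>2" by (rule norm_sq_diff_le)
    also have "(norm (a + b))\<^sup>2 \<le> 2 * (norm a)\<^sup>2 + 2 * (norm b)\<^sup>2" by (rule norm_sq_add_le)
    also have "(norm a)\<^sup>2 = (norm (p' - p))\<^sup>2 * (norm (w $ i))\<^sup>2"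
      unfolding a_def norm_mult complex_mod_cnj power_mult_distrib by simp
    also have "(norm b)\<^sup>2 = (norm \<psi>)\<^sup>2 * (norm ((D' - D) $ i))\<^sup>2"
      unfolding b_def norm_mult complex_mod_cnj power_mult_distrib by simp
    finally show ?thesis by simp
  qed
  from add_mono[OF this[of 1] this[of 2]] show ?thesis
    unfolding norm_sq_2_complex by (simp add: algebra_simps)
qed

text \<open>The factors \<open>|v (x + a) - v x|^2\<close> and \<open>1 - |v|^2\<close> are of the order of \<open>weight\<close>, and the
  product of \<open>weight\<close> with the bound for \<open>|grad \<Psi>|^2\<close> is integrable.\<close>
lemma translate_H_integrand:
  assumes c: "norm c = 1"
  shows "\<exists>C\<ge>0. AE x in lebesgue.
    (norm (weak_gradient (\<lambda>y. moved a c y * cnj (v y)) x))\<^sup>2 + (1 - (cmod (v x))\<^sup>2) * (norm (weak_gradient (moved a c) x))\<^sup>2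
      \<le> C * (h (x + a) + q (x + a) + (weight x)\<^sup>2)"
proof -
  obtain K1 where K1: "\<And>x. (norm (v (x + a) - v x))\<^sup>2 \<le> K1 * weight x" using shift by blast
  obtain K2 where K2: "\<And>x. (norm (Dv (x + a) - Dv x))\<^sup>2 \<le> K2 * (weight x)\<^sup>2" using Dv_shift by blast
  obtain K3 where K3: "\<And>x. 1 - (norm (v x))\<^sup>2 \<le> K3 * weight x" using defect by blast
  obtain C where C0: "C \<ge> 0" and C: "AE x in lebesgue. (norm (W x))\<^sup>2 \<le> C * (h x + q x + weight x)"
    using W_sq_le by blast
  define K where "K = \<bar>K1\<bar> + \<bar>K2\<bar> + \<bar>K3\<bar>"
  have K0: "0 \<le> K" by (simp add: K_def)
  have KK: "K1 * t \<le> K * t" "K2 * t \<le> K * t" "K3 * t \<le> K * t" if "0 \<le> t" for t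
    using that unfolding K_def by (auto intro!: mult_right_mono)
  \<comment> \<open>The factor by which a translation by \<open>a\<close> can increase \<open>weight\<close>.\<close>
  define A where "A = 2 * (1 + (norm a)\<^sup>2)"
  have A1: "1 \<le> A" by (simp add: A_def)
  define S where "S x = h (x + a) + q (x + a) + (weight x)\<^sup>2" for x
  define M where "M = 2 + 4 * (K * (C * A) + K * 2) + K * (C * A)"
  have wW: "K * weight x * (norm (W (x + a)))\<^sup>2 \<le> K * (C * A) * S x"
    if "(norm (W (x + a)))\<^sup>2 \<le> C * (h (x + a) + q (x + a) + weight (x + a))" for x
  proof -
    have w1: "0 \<le> weight x" "weight x \<le> 1" using weight_pos[of x] weight_le_1[of x] by auto
    have "weight x * (h (x + a) + q (x + a) + weight (x + a)) \<le> weight x * (h (x + a) + q (x + a) + A * weight x)"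
      using weight_translate[of x a] w1 by (intro mult_left_mono) (auto simp: A_def)
    also have "\<dots> = weight x * (h (x + a) + q (x + a)) + A * (weight x)\<^sup>2"
      by (simp add: power2_eq_square algebra_simps)
    also have "\<dots> \<le> A * (h (x + a) + q (x + a)) + A * (weight x)\<^sup>2"
      using w1 A1 h_nonneg[of "x + a"] q_nonneg[of "x + a"] by (intro add_right_mono mult_right_mono) auto
    also have "\<dots> = A * S x" by (simp add: S_def algebra_simps)
    finally have 1: "weight x * (h (x + a) + q (x + a) + weight (x + a)) \<le> A * S x" .
    have "K * weight x * (norm (W (x + a)))\<^sup>2 \<le> K * weight x * (C * (h (x + a) + q (x + a) + weight (x + a)))"
      using that K0 w1 by (intro mult_left_mono) auto
    also have "\<dots> = K * C * (weight x * (h (x + a) + q (x + a) + weight (x + a)))" by (simp add: mult_ac)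
    also have "\<dots> \<le> K * C * (A * S x)" using 1 K0 C0 by (intro mult_left_mono) auto
    finally show ?thesis by (simp add: mult_ac)
  qed
  have "AE x in lebesgue.
    (norm (weak_gradient (\<lambda>y. moved a c y * cnj (v y)) x))\<^sup>2 + (1 - (cmod (v x))\<^sup>2) * (norm (weak_gradient (moved a c) x))\<^sup>2
      \<le> M * S x"
    using weak_gradient_AE(2)[OF translate_weak_gradient[of a c]] weak_gradient_AE(2)[OF translate_U_weak_gradient[of a c]]
      AE_translate[OF C, of a] AE_translate[OF GU_eq, of a]
  proof eventually_elim
    case (elim x)
    have w1: "0 \<le> weight x" "weight x \<le> 1" using weight_pos[of x] weight_le_1[of x] by auto
    have v: "(norm (v (x + a) - v x))\<^sup>2 \<le> K * weight x"
      using K1[of x] KK(1)[OF w1(1)] by linarith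
    have D: "(norm (Dv (x + a) - Dv x))\<^sup>2 \<le> K * (weight x)\<^sup>2"
      using K2[of x] KK(2)[of "(weight x)\<^sup>2"] by simp
    have p: "(norm (\<chi> i. c * W (x + a) $ i * cnj (v x) + c * \<Psi> (x + a) * cnj (Dv x $ i)))\<^sup>2 \<le>
        2 * (norm (GU (x + a)))\<^sup>2 + 4 * ((norm (v (x + a) - v x))\<^sup>2 * (norm (W (x + a)))\<^sup>2
          + (norm (\<Psi> (x + a)))\<^sup>2 * (norm (Dv (x + a) - Dv x))\<^sup>2)"
      by (rule translate_gradient_pointwise[OF _ c]) (use elim(4) in simp)
    have t1: "(norm (v (x + a) - v x))\<^sup>2 * (norm (W (x + a)))\<^sup>2 \<le> K * (C * A) * S x"
      using mult_right_mono[OF v, of "(norm (W (x + a)))\<^sup>2"] wW[OF elim(3)] by simp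
    have t2: "(norm (\<Psi> (x + a)))\<^sup>2 * (norm (Dv (x + a) - Dv x))\<^sup>2 \<le> K * 2 * S x"
    proof -
      have "(norm (\<Psi> (x + a)))\<^sup>2 * (norm (Dv (x + a) - Dv x))\<^sup>2 \<le> (2 + q (x + a)) * (K * (weight x)\<^sup>2)"
        using \<Psi>_sq_le[of "x + a"] D q_nonneg[of "x + a"] by (intro mult_mono) auto
      also have "\<dots> = K * (2 * (weight x)\<^sup>2 + q (x + a) * (weight x)\<^sup>2)" by (simp add: algebra_simps)
      also have "\<dots> \<le> K * (2 * S x)"
      proof (intro mult_left_mono K0)
        have "q (x + a) * (weight x)\<^sup>2 \<le> q (x + a) * 1"
          using w1 q_nonneg[of "x + a"] by (intro mult_left_mono) (auto simp: power_le_one)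
        then show "2 * (weight x)\<^sup>2 + q (x + a) * (weight x)\<^sup>2 \<le> 2 * S x"
          using h_nonneg[of "x + a"] q_nonneg[of "x + a"] unfolding S_def by argo
      qed
      finally show ?thesis by (simp add: mult_ac)
    qed
    have t3: "(1 - (cmod (v x))\<^sup>2) * (norm (W (x + a)))\<^sup>2 \<le> K * (C * A) * S x"
    proof -
      have "1 - (cmod (v x))\<^sup>2 \<le> K * weight x" using K3[of x] KK(3)[OF w1(1)] by linarith
      from mult_right_mono[OF this, of "(norm (W (x + a)))\<^sup>2"] show ?thesis
        using wW[OF elim(3)] by simp
    qed
    have g: "(norm (GU (x + a)))\<^sup>2 \<le> S x"
      using GU_le_h[of "x + a"] q_nonneg[of "x + a"] by (simp add: S_def add_increasing2)
    have gU: "weak_gradient (\<lambda>y. moved a c y * cnj (v y)) x = (\<chi> i. c * W (x + a) $ i * cnj (v x) + c * \<Psi> (x + a) * cnj (Dv x $ i))"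
      using elim(2) by (simp add: moved_def)
    have "norm (weak_gradient (moved a c) x) = norm (W (x + a))"
      using elim(1) by (simp add: norm_cmult_vec c)
    moreover have "N + n3 \<le> 2 * s + 4 * (m1 + m2) + m1"
      if "N \<le> 2 * g + 4 * (n1 + n2)" "n1 \<le> m1" "n2 \<le> m2" "n3 \<le> m1" "g \<le> s" for N n1 n2 n3 m1 m2 g s :: real
      using that by argo
    from this[OF p t1 t2 t3 g] have "(norm (weak_gradient (\<lambda>y. moved a c y * cnj (v y)) x))\<^sup>2 + (1 - (cmod (v x))\<^sup>2) * (norm (W (x + a)))\<^sup>2
        \<le> 2 * S x + 4 * (K * (C * A) * S x + K * 2 * S x) + K * (C * A) * S x"
      unfolding gU .
    ultimately show ?case by (simp add: M_def algebra_simps)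
  qed
  moreover have "0 \<le> M" using K0 C0 A1 by (simp add: M_def)
  ultimately show ?thesis unfolding S_def by blast
qed

lemma integrable_translate:
  fixes f :: "real^2 \<Rightarrow> real"
  shows "integrable lebesgue f \<Longrightarrow> integrable lebesgue (\<lambda>x. f (x + a))"
  by (rule integrable_lborel_preserving[OF lborel_preserving_plus])

theorem finite_energy_translate:
  assumes c: "norm c = 1"
  shows "finite_energy v Dv (moved a c)"
proof
  show "moved a c \<in> L2_loc" by (rule translate_L2_loc[OF c])
  show "weakly_differentiable (moved a c)"
    unfolding weakly_differentiable_def using translate_weak_gradient by blast
  show "weakly_differentiable (\<lambda>y. moved a c y * cnj (v y))"
    unfolding weakly_differentiable_def using translate_U_weak_gradient by blast
  show "integrable lebesgue (\<lambda>x. (1 - (cmod (moved a c x))\<^sup>2)\<^sup>2)"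
    using integrable_translate[OF q_integrable, of a] by (simp add: q_def moved_def norm_mult c)
  obtain C where C0: "C \<ge> 0" and C: "AE x in lebesgue.
    (norm (weak_gradient (\<lambda>y. moved a c y * cnj (v y)) x))\<^sup>2 + (1 - (cmod (v x))\<^sup>2) * (norm (weak_gradient (moved a c) x))\<^sup>2
      \<le> C * (h (x + a) + q (x + a) + (weight x)\<^sup>2)"
    using translate_H_integrand[OF c] by blast
  have i: "integrable lebesgue (\<lambda>x. C * (h (x + a) + q (x + a) + (weight x)\<^sup>2))"
    by (intro integrable_mult_right Bochner_Integration.integrable_add integrable_translate h_integrable q_integrable integrable_weight_sq)
  have "(\<integral>\<^sup>+x. ennreal ((norm (weak_gradient (\<lambda>y. moved a c y * cnj (v y)) x))\<^sup>2 +
      (1 - (cmod (v x))\<^sup>2) * (norm (weak_gradient (moved a c) x))\<^sup>2) \<partial>lebesgue) \<le>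
      (\<integral>\<^sup>+x. ennreal (norm (C * (h (x + a) + q (x + a) + (weight x)\<^sup>2))) \<partial>lebesgue)"
    by (rule nn_integral_mono_AE) (use C in \<open>eventually_elim, auto intro!: ennreal_leI\<close>)
  also have "\<dots> < \<infinity>" using i unfolding integrable_iff_bounded by blast
  finally show "(\<integral>\<^sup>+x. ennreal ((norm (weak_gradient (\<lambda>y. moved a c y * cnj (v y)) x))\<^sup>2 +
      (1 - (cmod (v x))\<^sup>2) * (norm (weak_gradient (moved a c) x))\<^sup>2) \<partial>lebesgue) < \<infinity>" .
qed

text \<open>For \<open>\<alpha> = |a|\<close> the shell contains the symmetric difference of the balls of radius \<open>R\<close> about
  0 and \<open>a\<close>.\<close>
definition "shell \<alpha> R = ball 0 (R + \<alpha>) - ball (0 :: real^2) (R - \<alpha>)"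

lemma measure_shell:
  assumes "0 \<le> \<alpha>" "\<alpha> \<le> R"
  shows "shell \<alpha> R \<in> lmeasurable" "measure lebesgue (shell \<alpha> R) = 4 * unit_ball_vol 2 * \<alpha> * R"
proof -
  show "shell \<alpha> R \<in> lmeasurable" unfolding shell_def by (intro fmeasurable.Diff) auto
  have "measure lebesgue (shell \<alpha> R) = measure lebesgue (ball (0 :: real^2) (R + \<alpha>)) - measure lebesgue (ball (0 :: real^2) (R - \<alpha>))"
    unfolding shell_def by (intro measurable_measure_Diff) (use assms in auto)
  also have "\<dots> = 4 * unit_ball_vol 2 * \<alpha> * R"
    using assms by (simp add: content_ball power2_eq_square algebra_simps)
  finally show "measure lebesgue (shell \<alpha> R) = 4 * unit_ball_vol 2 * \<alpha> * R" .
qed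

text \<open>The area of the shell is of order \<open>R\<close> and \<open>weight\<close> is of order \<open>R^-2\<close> on it.\<close>
lemma shell_weight_tendsto_0:
  assumes \<alpha>: "0 \<le> \<alpha>"
  shows "((\<lambda>R. LINT x|lebesgue. indicator (shell \<alpha> R) x * weight x) \<longlongrightarrow> 0) at_top"
proof (rule Lim_null_comparison)
  define V where "V = unit_ball_vol (2 :: real)"
  show "\<forall>\<^sub>F R in at_top. norm (LINT x|lebesgue. indicator (shell \<alpha> R) x * weight x) \<le> (16 * V * \<alpha>) / R"
    using eventually_ge_at_top[of "2 * \<alpha> + 1"]
  proof eventually_elim
    case (elim R)
    have R: "\<alpha> \<le> R" "R > 0" "R / 2 \<le> R - \<alpha>" using elim \<alpha> by auto
    note m = measure_shell[OF \<alpha> R(1)]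
    have ind: "integrable lebesgue (\<lambda>x. indicator (shell \<alpha> R) x * (4 / R\<^sup>2))"
      using m(1) by (intro integrable_mult_left integrable_real_indicator) (auto simp: fmeasurable_def)
    have le: "indicator (shell \<alpha> R) x * weight x \<le> indicator (shell \<alpha> R) x * (4 / R\<^sup>2)" for x
    proof (cases "x \<in> shell \<alpha> R")
      case True
      then have "R / 2 \<le> norm x" using R(3) by (auto simp: shell_def)
      then have "(R / 2)\<^sup>2 \<le> (norm x)\<^sup>2" using R(2) by (intro power_mono) auto
      then have "(R / 2)\<^sup>2 \<le> 1 + (norm x)\<^sup>2" by linarith
      moreover have "0 < (R / 2)\<^sup>2" "0 < 1 + (norm x)\<^sup>2" using R(2) by (auto simp: add_pos_nonneg)
      ultimately have "weight x \<le> 1 / (R / 2)\<^sup>2"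
        unfolding weight_def by (intro divide_left_mono mult_pos_pos) auto
      then show ?thesis using True by (simp add: power_divide)
    qed simp
    have "norm (LINT x|lebesgue. indicator (shell \<alpha> R) x * weight x) = (LINT x|lebesgue. indicator (shell \<alpha> R) x * weight x)"
      using weight_pos by (simp add: integral_nonneg_AE less_imp_le)
    also have "\<dots> \<le> (LINT x|lebesgue. indicator (shell \<alpha> R) x * (4 / R\<^sup>2))"
      using weight_pos by (intro integral_mono' ind le) (simp add: )
    also have "\<dots> = measure lebesgue (shell \<alpha> R) * (4 / R\<^sup>2)" by simp
    also have "\<dots> = (16 * V * \<alpha>) / R"
      unfolding m(2) V_def using R(2) by (simp add: power2_eq_square field_simps)
    finally show ?case .
  qed
  show "((\<lambda>R. (16 * V * \<alpha>) / R) \<longlongrightarrow> 0) at_top"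
    by (rule real_tendsto_divide_at_top[OF tendsto_const filterlim_ident])
qed

lemma gl_density_shell_tendsto_0:
  assumes \<alpha>: "0 \<le> \<alpha>"
  shows "((\<lambda>R. LINT x|lebesgue. indicator (shell \<alpha> R) x * gl_density \<Psi> x) \<longlongrightarrow> 0) at_top"
proof -
  obtain C where C0: "C \<ge> 0" and C: "AE x in lebesgue. gl_density \<Psi> x \<le> C * (h x + q x + weight x)"
    using gl_density_le by blast
  have sets: "shell \<alpha> R \<in> sets lebesgue" for R by (simp add: shell_def)
  have esc: "\<forall>\<^sub>F R in at_top. x \<notin> shell \<alpha> R" for x
    using eventually_gt_at_top[of "norm x + \<alpha>"] by eventually_elim (auto simp: shell_def)
  have hq: "integrable lebesgue (\<lambda>x. h x + q x)" using h_integrable q_integrable by simp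
  have wi: "integrable lebesgue (\<lambda>x. indicator (shell \<alpha> R) x * weight x)" for R
  proof (rule Bochner_Integration.integrable_bound[OF weight_integrable_ball[of "R + \<alpha>"]])
    show "(\<lambda>x. indicator (shell \<alpha> R) x * weight x) \<in> borel_measurable lebesgue"
      using sets by (intro borel_measurable_times borel_measurable_indicator) auto
  qed (auto simp: shell_def indicator_def intro!: AE_I2)
  have "((\<lambda>R. C * ((LINT x|lebesgue. indicator (shell \<alpha> R) x * (h x + q x)) + (LINT x|lebesgue. indicator (shell \<alpha> R) x * weight x)))
      \<longlongrightarrow> C * (0 + 0)) at_top"
    by (intro tendsto_mult tendsto_add tendsto_const shell_weight_tendsto_0[OF \<alpha>]
        tendsto_integral_escaping[OF hq sets esc])
  then have lim: "((\<lambda>R. C * ((LINT x|lebesgue. indicator (shell \<alpha> R) x * (h x + q x)) + (LINT x|lebesgue. indicator (shell \<alpha> R) x * weight x)))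
      \<longlongrightarrow> 0) at_top" by simp
  have "norm (LINT x|lebesgue. indicator (shell \<alpha> R) x * gl_density \<Psi> x) \<le>
      C * ((LINT x|lebesgue. indicator (shell \<alpha> R) x * (h x + q x)) + (LINT x|lebesgue. indicator (shell \<alpha> R) x * weight x))" for R
  proof -
    have i1: "integrable lebesgue (\<lambda>x. indicator (shell \<alpha> R) x * (h x + q x))"
      by (rule integrable_times_indicator[OF hq sets])
    have i2: "integrable lebesgue (\<lambda>x. C * (indicator (shell \<alpha> R) x * (h x + q x) + indicator (shell \<alpha> R) x * weight x))"
      by (intro integrable_mult_right Bochner_Integration.integrable_add i1 wi)
    have le: "AE x in lebesgue. norm (indicator (shell \<alpha> R) x * gl_density \<Psi> x) \<le>
        C * (indicator (shell \<alpha> R) x * (h x + q x) + indicator (shell \<alpha> R) x * weight x)"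
      using C by eventually_elim (use gl_density_nonneg in \<open>auto simp: indicator_def\<close>)
    have "integrable lebesgue (\<lambda>x. indicator (shell \<alpha> R) x * gl_density \<Psi> x)"
    proof (rule Bochner_Integration.integrable_bound[OF i2])
      show "(\<lambda>x. indicator (shell \<alpha> R) x * gl_density \<Psi> x) \<in> borel_measurable lebesgue"
        using sets by (intro borel_measurable_times borel_measurable_indicator) auto
    qed (use le in \<open>eventually_elim, simp\<close>)
    then have "norm (LINT x|lebesgue. indicator (shell \<alpha> R) x * gl_density \<Psi> x) \<le>
        (LINT x|lebesgue. C * (indicator (shell \<alpha> R) x * (h x + q x) + indicator (shell \<alpha> R) x * weight x))"
      using i2 le by (intro order_trans[OF integral_norm_bound] integral_mono_AE integrable_norm)
    also have "\<dots> = C * ((LINT x|lebesgue. indicator (shell \<alpha> R) x * (h x + q x)) + (LINT x|lebesgue. indicator (shell \<alpha> R) x * weight x))"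
      using i1 wi by simp
    finally show ?thesis .
  qed
  then show ?thesis by (intro Lim_null_comparison[OF _ lim] always_eventually allI)
qed

text \<open>The energy of the translated function on a ball about 0 is the energy of \<open>\<Psi>\<close> on a ball
  about \<open>a\<close>. The two balls differ by a subset of a shell, on which the integral of the energy
  density of \<open>\<Psi>\<close> tends to zero.\<close>
theorem energy_translate:
  assumes c: "norm c = 1"
  shows "((\<lambda>R. finite_energy.energy v (moved a c) R - energy R) \<longlongrightarrow> 0) at_top"
proof (rule Lim_null_comparison)
  interpret T: finite_energy v Dv "moved a c" by (rule finite_energy_translate[OF c])
  define \<alpha> where "\<alpha> = norm a"
  have \<alpha>0: "0 \<le> \<alpha>" by (simp add: \<alpha>_def)
  show "((\<lambda>R. LINT x|lebesgue. indicator (shell \<alpha> R) x * gl_density \<Psi> x) \<longlongrightarrow> 0) at_top"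
    by (rule gl_density_shell_tendsto_0[OF \<alpha>0])
  have "norm (T.energy R - energy R) \<le> (LINT x|lebesgue. indicator (shell \<alpha> R) x * gl_density \<Psi> x)" for R
  proof -
    define e where "e = gl_density \<Psi>"
    have e0: "0 \<le> e x" for x by (simp add: e_def gl_density_nonneg)
    have [measurable]: "e \<in> borel_measurable lebesgue" by (simp add: e_def gl_density_meas)
    have ie: "integrable lebesgue (\<lambda>x. indicator (ball 0 r) x * e x)" for r
      unfolding e_def by (rule gl_density_integrable_ball)
    have mb: "(\<lambda>x. indicator (ball 0 R) (x - a) * e x) \<in> borel_measurable lebesgue"
    proof -
      have "(\<lambda>x. indicator (ball a R) x * e x) \<in> borel_measurable lebesgue"
        by (intro borel_measurable_times borel_measurable_indicator) auto
      moreover have "indicator (ball 0 R) (x - a) = (indicator (ball a R) x :: real)" for x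
        by (simp add: indicator_def dist_norm norm_minus_commute)
      ultimately show ?thesis by simp
    qed
    have ia: "integrable lebesgue (\<lambda>x. indicator (ball 0 R) (x - a) * e x)"
    proof (rule Bochner_Integration.integrable_bound[OF ie[of "R + \<alpha>"]])
      have "norm x < R + \<alpha>" if "norm (x - a) < R" for x
        using that norm_triangle_sub[of x a] by (simp add: \<alpha>_def)
      then show "AE x in lebesgue. norm (indicator (ball 0 R) (x - a) * e x) \<le> norm (indicator (ball 0 (R + \<alpha>)) x * e x)"
        by (intro AE_I2) (auto simp: indicator_def)
    qed (rule mb)
    have "(LINT x|lebesgue. indicator (ball 0 R) x * gl_density (moved a c) x) =
        (LINT x|lebesgue. (\<lambda>x. indicator (ball 0 R) (x - a) * e x) (x + a))"
    proof (rule integral_cong_AE)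
      show "(\<lambda>x. indicator (ball 0 R) x * gl_density (moved a c) x) \<in> borel_measurable lebesgue"
        by (intro borel_measurable_times borel_measurable_indicator T.gl_density_meas) auto
      show "(\<lambda>x. indicator (ball 0 R) (x + a - a) * e (x + a)) \<in> borel_measurable lebesgue"
        by (rule measurable_lborel_preserving[OF lborel_preserving_plus mb])
    qed (use translate_gl_density[OF c, of a] in \<open>eventually_elim, simp add: e_def\<close>)
    also have "\<dots> = (LINT x|lebesgue. indicator (ball 0 R) (x - a) * e x)"
      by (rule integral_lborel_preserving[OF lborel_preserving_plus mb])
    finally have t: "(LINT x|lebesgue. indicator (ball 0 R) x * gl_density (moved a c) x) = (LINT x|lebesgue. indicator (ball 0 R) (x - a) * e x)" .
    have E1: "T.energy R = (LINT x|lebesgue. indicator (ball 0 R) x * gl_density (moved a c) x) - (LINT x|lebesgue. indicator (ball 0 R) x * gl_density v x)"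
      unfolding T.energy_def T.excess_def right_diff_distrib
      by (intro Bochner_Integration.integral_diff T.gl_density_integrable_ball gl_density_v_integrable_ball)
    have E2: "energy R = (LINT x|lebesgue. indicator (ball 0 R) x * e x) - (LINT x|lebesgue. indicator (ball 0 R) x * gl_density v x)"
      unfolding energy_def excess_def right_diff_distrib e_def
      by (intro Bochner_Integration.integral_diff gl_density_integrable_ball gl_density_v_integrable_ball)
    have "T.energy R - energy R = (LINT x|lebesgue. indicator (ball 0 R) (x - a) * e x) - (LINT x|lebesgue. indicator (ball 0 R) x * e x)"
      unfolding E1 E2 t by simp
    also have "\<dots> = (LINT x|lebesgue. indicator (ball 0 R) (x - a) * e x - indicator (ball 0 R) x * e x)"
      by (intro Bochner_Integration.integral_diff[symmetric] ia ie)
    also have "norm \<dots> \<le> (LINT x|lebesgue. indicator (shell \<alpha> R) x * e x)"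
    proof (rule order_trans[OF integral_norm_bound integral_mono'])
      show "integrable lebesgue (\<lambda>x. indicator (shell \<alpha> R) x * e x)"
      proof (rule Bochner_Integration.integrable_bound[OF ie[of "R + \<alpha>"]])
        show "(\<lambda>x. indicator (shell \<alpha> R) x * e x) \<in> borel_measurable lebesgue"
          by (intro borel_measurable_times borel_measurable_indicator) (auto simp: shell_def)
      qed (auto simp: shell_def indicator_def intro!: AE_I2)
      fix x
      show "0 \<le> indicator (shell \<alpha> R) x * e x" using e0 by simp
      have "x \<in> shell \<alpha> R" if "norm (x - a) < R \<longleftrightarrow> \<not> norm x < R"
        using that norm_triangle_sub[of x a] norm_triangle_ineq4[of x a] by (auto simp: shell_def \<alpha>_def)
      then show "norm (indicator (ball 0 R) (x - a) * e x - indicator (ball 0 R) x * e x) \<le> indicator (shell \<alpha> R) x * e x"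
        using e0[of x] by (cases "norm (x - a) < R"; cases "norm x < R") (auto simp: indicator_def)
    qed
    finally show ?thesis by (simp add: e_def)
  qed
  then show "\<forall>\<^sub>F R in at_top. norm (T.energy R - energy R) \<le> (LINT x|lebesgue. indicator (shell \<alpha> R) x * gl_density \<Psi> x)"
    by (intro always_eventually allI)
qed

end

section \<open>The renormalized energy on the energy space\<close>

theorem proposition1:
  fixes \<rho> :: "real \<Rightarrow> real"
  assumes "vortex_profile \<rho>"
  shows "(\<forall>\<Psi> \<in> energy_space \<rho>.
            (\<forall>r>0. excess_density \<rho> \<Psi> absolutely_integrable_on ball 0 r) \<and>
            (excess_energy \<rho> \<Psi> \<longlongrightarrow> renormalized_energy \<rho> \<Psi>) at_top) \<and>
         (\<forall>\<Psi> \<in> energy_space \<rho>. \<forall>(a::real^2) (\<phi>::real).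
            (\<lambda>x. cis \<phi> * \<Psi> (x + a)) \<in> energy_space \<rho> \<and>
            renormalized_energy \<rho> (\<lambda>x. cis \<phi> * \<Psi> (x + a)) = renormalized_energy \<rho> \<Psi>)"
proof -
  obtain \<rho>' \<rho>'' where "vortex_ode \<rho> \<rho>' \<rho>''"
    using assms unfolding vortex_profile_def vortex_ode_def by blast
  then interpret vortex_ode \<rho> \<rho>' \<rho>'' .
  let ?v = "vortex \<rho>"
  have VL: "vortex_like ?v vortex_grad" by (rule vortex_like_vortex)
  have iff: "\<Psi> \<in> energy_space \<rho> \<longleftrightarrow> finite_energy ?v vortex_grad \<Psi>" for \<Psi>
    using VL unfolding energy_space_def H_space_def H_norm_sq_def finite_energy_def finite_energy_axioms_def
    by auto
  have E: "excess_energy \<rho> \<Psi> = finite_energy.energy ?v \<Psi>" "excess_density \<rho> \<Psi> = finite_energy.excess ?v \<Psi>"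
    if "finite_energy ?v vortex_grad \<Psi>" for \<Psi>
  proof -
    interpret finite_energy ?v vortex_grad \<Psi> by (rule that)
    show 1: "excess_density \<rho> \<Psi> = excess" by (simp add: fun_eq_iff excess_density_def excess_def)
    show "excess_energy \<rho> \<Psi> = energy"
      by (simp add: fun_eq_iff excess_energy_def energy_def 1 set_lebesgue_integral_def)
  qed
  have lim: "(excess_energy \<rho> \<Psi> \<longlongrightarrow> renormalized_energy \<rho> \<Psi>) at_top" if FE: "finite_energy ?v vortex_grad \<Psi>" for \<Psi>
  proof -
    interpret finite_energy ?v vortex_grad \<Psi> by (rule FE)
    obtain L where L: "(excess_energy \<rho> \<Psi> \<longlongrightarrow> L) at_top"
      using energy_converges unfolding E(1)[OF FE] by blast
    then have "renormalized_energy \<rho> \<Psi> = L"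
      unfolding renormalized_energy_def by (intro tendsto_Lim) auto
    with L show ?thesis by simp
  qed
  show ?thesis
  proof (intro conjI ballI allI impI)
    fix \<Psi> assume "\<Psi> \<in> energy_space \<rho>"
    then have FE: "finite_energy ?v vortex_grad \<Psi>" by (simp add: iff)
    then interpret finite_energy ?v vortex_grad \<Psi> .
    show "(excess_energy \<rho> \<Psi> \<longlongrightarrow> renormalized_energy \<rho> \<Psi>) at_top" by (rule lim[OF FE])
    show "excess_density \<rho> \<Psi> absolutely_integrable_on ball 0 r" for r
      using excess_integrable_ball[of r] by (simp add: E(2)[OF FE] set_integrable_def)
    fix a :: "real^2" and \<phi> :: real
    have eq: "(\<lambda>x. cis \<phi> * \<Psi> (x + a)) = moved a (cis \<phi>)" by (simp add: fun_eq_iff moved_def)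
    have FE': "finite_energy ?v vortex_grad (\<lambda>x. cis \<phi> * \<Psi> (x + a))"
      unfolding eq by (rule finite_energy_translate) simp
    then show "(\<lambda>x. cis \<phi> * \<Psi> (x + a)) \<in> energy_space \<rho>" by (simp add: iff)
    have "((\<lambda>R. excess_energy \<rho> (\<lambda>x. cis \<phi> * \<Psi> (x + a)) R - excess_energy \<rho> \<Psi> R) \<longlongrightarrow> 0) at_top"
      unfolding E(1)[OF FE'] E(1)[OF FE] unfolding eq by (rule energy_translate) simp
    moreover have "((\<lambda>R. excess_energy \<rho> (\<lambda>x. cis \<phi> * \<Psi> (x + a)) R - excess_energy \<rho> \<Psi> R) \<longlongrightarrow>
        renormalized_energy \<rho> (\<lambda>x. cis \<phi> * \<Psi> (x + a)) - renormalized_energy \<rho> \<Psi>) at_top"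
      by (intro tendsto_diff lim FE FE')
    ultimately have "renormalized_energy \<rho> (\<lambda>x. cis \<phi> * \<Psi> (x + a)) - renormalized_energy \<rho> \<Psi> = 0"
      using tendsto_unique[OF trivial_limit_at_top_linorder] by blast
    then show "renormalized_energy \<rho> (\<lambda>x. cis \<phi> * \<Psi> (x + a)) = renormalized_energy \<rho> \<Psi>" by simp
  qed
qed

end
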